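(* Let $\Omega \subset\subset \mathbb{C}^n$ be a smoothly bounded pseudoconvex domain and let $1\le q\le n$. Suppose that for some $r>2$ there is a constant $C>0$ such that $$\|u\|_r \le C\left(\|\overline{\partial}u\|^2+\|\overline{\partial}^*u\|^2\right)^{1/2}$$ for all $u\in \mathrm{dom}(\overline{\partial})\cap \mathrm{dom}(\overline{\partial}^* )\subset L^2_{(0,q)}(\Omega)$. Then the $\overline{\partial}$-Neumann operator $$N: L^2_{(0,q)}(\Omega)\longrightarrow L^2_{(0,q)}(\Omega)$$ is compact.
   Context: $L^2_{(0,q)}(\Omega)$ is the Hilbert space of $(0,q)$-forms $u=\sum_J' u_J\,d\overline{z}_J$ on $\Omega$ with coefficients in $L^2(\Omega)$ (with respect to Lebesgue measure $\lambda$), where $\sum'$ means summation over strictly increasing multi-indices $J$ with $|J|=q$; $|u|^2=\sum_J'|u_J|^2$, and $\|\cdot\|$ denotes the $L^2$-norm on forms. For $r\ge 1$, $\|u\|_r=\left(\int_\Omega |u|^r\,d\lambda\right)^{1/r}$ (with value $+\infty$ allowed; the assumed inequality includes that $\|u\|_r$ is finite). The operator $\overline{\partial}:L^2_{(0,q)}(\Omega)\to L^2_{(0,q+1)}(\Omega)$ is given by $\overline{\partial}\left(\sum_J' a_J\,d\overline{z}_J\right)=\sum_{j=1}^n\sum_J' \frac{\partial a_J}{\partial \overline{z}_j}\,d\overline{z}_j\wedge d\overline{z}_J$, with derivatives in the sense of distributions; its domain consists of those forms for which the right-hand side lies in $L^2_{(0,q+1)}(\Omega)$ (for $q=n$, $\overline{\partial}=0$).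 It is a densely defined closed operator, and $\overline{\partial}^*:L^2_{(0,q+1)}(\Omega)\to L^2_{(0,q)}(\Omega)$ denotes its Hilbert space adjoint. In $\mathrm{dom}(\overline{\partial})\cap\mathrm{dom}(\overline{\partial}^* )$ on $(0,q)$-forms, $\overline{\partial}$ maps to $(0,q+1)$-forms and $\overline{\partial}^*$ maps to $(0,q-1)$-forms. The complex Laplacian is $\Box=\overline{\partial}\,\overline{\partial}^*+\overline{\partial}^*\overline{\partial}$ on $\mathrm{dom}(\Box)=\{u\in L^2_{(0,q)}(\Omega): u\in\mathrm{dom}(\overline{\partial})\cap\mathrm{dom}(\overline{\partial}^* ),\ \overline{\partial}u\in\mathrm{dom}(\overline{\partial}^* ),\ \overline{\partial}^*u\in\mathrm{dom}(\overline{\partial})\}$. For a smoothly bounded pseudoconvex domain there is $c>0$ with $\|\overline{\partial}u\|^2+\|\overline{\partial}^*u\|^2\ge c\|u\|^2$ for all $u\in\mathrm{dom}(\overline{\partial})\cap\mathrm{dom}(\overline{\partial}^* )$, and consequently $\Box:\mathrm{dom}(\Box)\to L^2_{(0,q)}(\Omega)$ is bijective with bounded inverse; this inverse $N$ is the $\overline{\partial}$-Neumann operator on $(0,q)$-forms. *)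

theory Defs
  imports "HOL-Analysis.Analysis"
begin

section \<open>Smooth functions and Wirtinger derivatives\<close>

text \<open>Intended for open \<open>S\<close>: \<open>f\<close> is of class \<open>C\<^sup>k\<close> on \<open>S\<close> in the real sense.\<close>

primrec Ck_on :: "nat \<Rightarrow> ('a::euclidean_space \<Rightarrow> 'b::real_normed_vector) \<Rightarrow> 'a set \<Rightarrow> bool" where
  "Ck_on 0 f S \<longleftrightarrow> continuous_on S f"
| "Ck_on (Suc k) f S \<longleftrightarrow> (\<forall>x\<in>S. f differentiable (at x)) \<and>
     (\<forall>v\<in>Basis. Ck_on k (\<lambda>x. frechet_derivative f (at x) v) S)"

definition smooth_on :: "('a::euclidean_space \<Rightarrow> 'b::real_normed_vector) \<Rightarrow> 'a set \<Rightarrow> bool" where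
  "smooth_on f S \<longleftrightarrow> (\<forall>k. Ck_on k f S)"

text \<open>\<open>axis j 1\<close> and \<open>axis j \<i>\<close> are the real directions \<open>x\<^sub>j\<close> and \<open>y\<^sub>j\<close> of \<open>z\<^sub>j = x\<^sub>j + \<i> y\<^sub>j\<close>.\<close>

definition dz :: "'n::finite \<Rightarrow> (complex^'n \<Rightarrow> complex) \<Rightarrow> complex^'n \<Rightarrow> complex" where
  "dz j f p = (frechet_derivative f (at p) (axis j 1)
               - \<i> * frechet_derivative f (at p) (axis j \<i>)) / 2"

definition dzbar :: "'n::finite \<Rightarrow> (complex^'n \<Rightarrow> complex) \<Rightarrow> complex^'n \<Rightarrow> complex" where
  "dzbar j f p = (frechet_derivative f (at p) (axis j 1)
                  + \<i> * frechet_derivative f (at p) (axis j \<i>)) / 2"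

section \<open>Smoothly bounded pseudoconvex domains\<close>

definition smooth_defining_function ::
  "(complex^'n::finite) set \<Rightarrow> (complex^'n) set \<Rightarrow> (complex^'n \<Rightarrow> real) \<Rightarrow> bool" where
  "smooth_defining_function \<Omega> U \<rho> \<longleftrightarrow>
     open U \<and> frontier \<Omega> \<subseteq> U \<and> smooth_on \<rho> U \<and>
     \<Omega> \<inter> U = {z\<in>U. \<rho> z < 0} \<and>
     (\<forall>p\<in>frontier \<Omega>. frechet_derivative \<rho> (at p) \<noteq> (\<lambda>v. 0))"

definition smoothly_bounded_domain :: "(complex^'n::finite) set \<Rightarrow> bool" where
  "smoothly_bounded_domain \<Omega> \<longleftrightarrow>
     open \<Omega> \<and> connected \<Omega> \<and> \<Omega> \<noteq> {} \<and> bounded \<Omega> \<and>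
     (\<exists>U \<rho>. smooth_defining_function \<Omega> U \<rho>)"

text \<open>
  Levi pseudoconvexity: the Levi form of a defining function is positive semidefinite on the
  complex tangent space at every boundary point. This does not depend on the choice of \<open>\<rho>\<close>.
  The Hermitian sum is real because \<open>\<rho>\<close> is real valued; \<open>Re\<close> only adjusts the type.
\<close>

definition pseudoconvex :: "(complex^'n::finite) set \<Rightarrow> bool" where
  "pseudoconvex \<Omega> \<longleftrightarrow>
     (\<exists>U \<rho>. smooth_defining_function \<Omega> U \<rho> \<and>
       (\<forall>p\<in>frontier \<Omega>. \<forall>t::complex^'n.
          (\<Sum>j\<in>UNIV. dz j (\<lambda>z. complex_of_real (\<rho> z)) p * t$j) = 0 \<longrightarrow>
          Re (\<Sum>j\<in>UNIV. \<Sum>k\<in>UNIV.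
                dz j (dzbar k (\<lambda>z. complex_of_real (\<rho> z))) p * t$j * cnj (t$k)) \<ge> 0))"

section \<open>Square-integrable forms\<close>

text \<open>
  A strictly increasing multi-index \<open>J\<close> with \<open>|J| = q\<close> is the set of its entries, a \<open>q\<close>-element
  subset of the linearly ordered index type. A \<open>(0,q)\<close>-form is the function \<open>z \<mapsto> (u\<^sub>J(z))\<^sub>J\<close>, with
  components \<open>u\<^sub>J = 0\<close> on \<open>\<Omega>\<close> for \<open>|J| \<noteq> q\<close>; then the library norm satisfies \<open>|u|\<^sup>2 = \<Sum>\<^sub>J |u\<^sub>J|\<^sup>2\<close>.
  Elements of \<open>L\<^sup>2\<close> are given by representatives, which are identified when they agree almost
  everywhere on \<open>\<Omega>\<close>; values outside \<open>\<Omega>\<close> are irrelevant.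
\<close>

type_synonym 'n form = "complex^'n \<Rightarrow> complex^('n set)"

definition L2_forms :: "(complex^'n::finite) set \<Rightarrow> nat \<Rightarrow> 'n form set" where
  "L2_forms \<Omega> q = {u. u \<in> borel_measurable (lebesgue_on \<Omega>) \<and>
     integrable (lebesgue_on \<Omega>) (\<lambda>z. (norm (u z))\<^sup>2) \<and>
     (\<forall>z\<in>\<Omega>. \<forall>J. card J \<noteq> q \<longrightarrow> u z $ J = 0)}"

definition ae_eq :: "(complex^'n::finite) set \<Rightarrow> 'n form \<Rightarrow> 'n form \<Rightarrow> bool" where
  "ae_eq \<Omega> u v \<longleftrightarrow> (AE z in lebesgue_on \<Omega>. u z = v z)"

definition L2_inner :: "(complex^'n::finite) set \<Rightarrow> 'n form \<Rightarrow> 'n form \<Rightarrow> complex" where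
  "L2_inner \<Omega> u v = (LINT z|lebesgue_on \<Omega>. (\<Sum>J\<in>UNIV. u z $ J * cnj (v z $ J)))"

definition L2_norm :: "(complex^'n::finite) set \<Rightarrow> 'n form \<Rightarrow> real" where
  "L2_norm \<Omega> u = sqrt (LINT z|lebesgue_on \<Omega>. (norm (u z))\<^sup>2)"

definition Lr_norm :: "(complex^'n::finite) set \<Rightarrow> real \<Rightarrow> 'n form \<Rightarrow> ennreal" where
  "Lr_norm \<Omega> r u =
     (let I = (\<integral>\<^sup>+ z. ennreal (norm (u z) powr r) \<partial>lebesgue_on \<Omega>)
      in if I = \<infinity> then \<infinity> else ennreal (enn2real I powr (1 / r)))"

section \<open>The operator $\overline\partial$ and its Hilbert space adjoint\<close>

definition test_functions :: "(complex^'n::finite) set \<Rightarrow> (complex^'n \<Rightarrow> complex) set" where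
  "test_functions \<Omega> = {\<phi>. smooth_on \<phi> UNIV \<and> compact (closure {z. \<phi> z \<noteq> 0}) \<and>
                           closure {z. \<phi> z \<noteq> 0} \<subseteq> \<Omega>}"

text \<open>The distribution \<open>\<partial>a/\<partial>\<zeta>\<close>, \<open>\<zeta>\<close> the conjugate of \<open>z\<^sub>j\<close>, applied to the test function \<open>\<phi>\<close>.\<close>

definition dist_dzbar ::
  "(complex^'n::finite) set \<Rightarrow> 'n \<Rightarrow> (complex^'n \<Rightarrow> complex) \<Rightarrow> (complex^'n \<Rightarrow> complex) \<Rightarrow> complex" where
  "dist_dzbar \<Omega> j a \<phi> = - (LINT z|lebesgue_on \<Omega>. a z * dzbar j \<phi> z)"

text \<open>
  The coefficient of $d\overline z_K$ in $d\overline z_j \wedge d\overline z_J$: the sign counts the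
  transpositions that move \<open>j\<close> to its place in the increasing order.
\<close>

definition wedge_coeff :: "'n::{finite,linorder} \<Rightarrow> 'n set \<Rightarrow> 'n set \<Rightarrow> complex" where
  "wedge_coeff j J K = (if j \<notin> J \<and> K = insert j J then (-1) ^ card {k\<in>J. k < j} else 0)"

definition has_dbar ::
  "(complex^'n::{finite,linorder}) set \<Rightarrow> nat \<Rightarrow> 'n form \<Rightarrow> 'n form \<Rightarrow> bool" where
  "has_dbar \<Omega> q u f \<longleftrightarrow> u \<in> L2_forms \<Omega> q \<and> f \<in> L2_forms \<Omega> (Suc q) \<and>
     (\<forall>K. card K = Suc q \<longrightarrow> (\<forall>\<phi>\<in>test_functions \<Omega>.
        (\<Sum>j\<in>UNIV. \<Sum>J | card J = q. wedge_coeff j J K * dist_dzbar \<Omega> j (\<lambda>z. u z $ J) \<phi>)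
        = (LINT z|lebesgue_on \<Omega>. f z $ K * \<phi> z)))"

text \<open>
  The operators below return some representative of their value, which is determined only up to
  equality almost everywhere. The degree argument \<open>q\<close> is always that of
  $\overline\partial : L^2_{(0,q)}(\Omega) \to L^2_{(0,q+1)}(\Omega)$; thus \<open>dbar_adj \<Omega> q\<close> acts on
  \<open>(0,q+1)\<close>-forms.
\<close>

definition dom_dbar :: "(complex^'n::{finite,linorder}) set \<Rightarrow> nat \<Rightarrow> 'n form set" where
  "dom_dbar \<Omega> q = {u. \<exists>f. has_dbar \<Omega> q u f}"

definition dbar :: "(complex^'n::{finite,linorder}) set \<Rightarrow> nat \<Rightarrow> 'n form \<Rightarrow> 'n form" where
  "dbar \<Omega> q u = (SOME f. has_dbar \<Omega> q u f)"

definition has_dbar_adj ::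
  "(complex^'n::{finite,linorder}) set \<Rightarrow> nat \<Rightarrow> 'n form \<Rightarrow> 'n form \<Rightarrow> bool" where
  "has_dbar_adj \<Omega> q v w \<longleftrightarrow> v \<in> L2_forms \<Omega> (Suc q) \<and> w \<in> L2_forms \<Omega> q \<and>
     (\<forall>u\<in>dom_dbar \<Omega> q. L2_inner \<Omega> (dbar \<Omega> q u) v = L2_inner \<Omega> u w)"

definition dom_dbar_adj :: "(complex^'n::{finite,linorder}) set \<Rightarrow> nat \<Rightarrow> 'n form set" where
  "dom_dbar_adj \<Omega> q = {v. \<exists>w. has_dbar_adj \<Omega> q v w}"

definition dbar_adj :: "(complex^'n::{finite,linorder}) set \<Rightarrow> nat \<Rightarrow> 'n form \<Rightarrow> 'n form" where
  "dbar_adj \<Omega> q v = (SOME w. has_dbar_adj \<Omega> q v w)"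

section \<open>The complex Laplacian and the $\overline\partial$-Neumann operator\<close>

text \<open>In this section \<open>q \<ge> 1\<close> is the degree of the forms on which the operators act.\<close>

definition dom_complex_laplacian :: "(complex^'n::{finite,linorder}) set \<Rightarrow> nat \<Rightarrow> 'n form set" where
  "dom_complex_laplacian \<Omega> q = {u \<in> dom_dbar \<Omega> q \<inter> dom_dbar_adj \<Omega> (q - 1).
     dbar \<Omega> q u \<in> dom_dbar_adj \<Omega> q \<and> dbar_adj \<Omega> (q - 1) u \<in> dom_dbar \<Omega> (q - 1)}"

definition complex_laplacian :: "(complex^'n::{finite,linorder}) set \<Rightarrow> nat \<Rightarrow> 'n form \<Rightarrow> 'n form" where
  "complex_laplacian \<Omega> q u = (\<lambda>z. dbar \<Omega> (q - 1) (dbar_adj \<Omega> (q - 1) u) z + dbar_adj \<Omega> q (dbar \<Omega> q u) z)"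

text \<open>
  The inverse of \<open>complex_laplacian\<close>. The choice is meaningful whenever
  \<open>complex_laplacian \<Omega> q : dom_complex_laplacian \<Omega> q \<rightarrow> L2_forms \<Omega> q\<close> is bijective modulo \<open>ae_eq \<Omega>\<close>.
\<close>

definition dbar_Neumann :: "(complex^'n::{finite,linorder}) set \<Rightarrow> nat \<Rightarrow> 'n form \<Rightarrow> 'n form" where
  "dbar_Neumann \<Omega> q f = (SOME u. u \<in> dom_complex_laplacian \<Omega> q \<and> ae_eq \<Omega> (complex_laplacian \<Omega> q u) f)"

section \<open>Compact operators on square-integrable forms\<close>

text \<open>
  \<open>T\<close> acts on representatives; the first two clauses say that it induces a map on \<open>L\<^sup>2\<close>.
\<close>

definition linear_operator_L2 ::
  "(complex^'n::finite) set \<Rightarrow> nat \<Rightarrow> ('n form \<Rightarrow> 'n form) \<Rightarrow> bool" where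
  "linear_operator_L2 \<Omega> q T \<longleftrightarrow>
     (\<forall>f\<in>L2_forms \<Omega> q. T f \<in> L2_forms \<Omega> q) \<and>
     (\<forall>f\<in>L2_forms \<Omega> q. \<forall>g\<in>L2_forms \<Omega> q. ae_eq \<Omega> f g \<longrightarrow> ae_eq \<Omega> (T f) (T g)) \<and>
     (\<forall>f\<in>L2_forms \<Omega> q. \<forall>g\<in>L2_forms \<Omega> q.
        ae_eq \<Omega> (T (\<lambda>z. f z + g z)) (\<lambda>z. T f z + T g z)) \<and>
     (\<forall>c. \<forall>f\<in>L2_forms \<Omega> q. ae_eq \<Omega> (T (\<lambda>z. c *s f z)) (\<lambda>z. c *s T f z))"

definition compact_operator_L2 ::
  "(complex^'n::finite) set \<Rightarrow> nat \<Rightarrow> ('n form \<Rightarrow> 'n form) \<Rightarrow> bool" where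
  "compact_operator_L2 \<Omega> q T \<longleftrightarrow> linear_operator_L2 \<Omega> q T \<and>
     (\<forall>F :: nat \<Rightarrow> 'n form.
        (\<forall>k. F k \<in> L2_forms \<Omega> q) \<and> (\<exists>B. \<forall>k. L2_norm \<Omega> (F k) \<le> B) \<longrightarrow>
        (\<exists>g\<in>L2_forms \<Omega> q. \<exists>\<sigma>. strict_mono \<sigma> \<and>
           (\<lambda>k. L2_norm \<Omega> (\<lambda>z. T (F (\<sigma> k)) z - g z)) \<longlonglongrightarrow> 0))"

end

theory Submission
  imports Defs
begin

text \<open>Write \<open>D\<close> for the Cauchy-Riemann operator. As \<open>r > 2\<close>, the gain of integrability bounds \<open>\<parallel>u\<parallel>\<close> by
  \<open>\<parallel>(D u, D\<^sup>* u)\<parallel>\<close> and makes the mass of \<open>u\<close> near the boundary uniformly small when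
  \<open>\<parallel>(D u, D\<^sup>* u)\<parallel> \<le> 1\<close>. The first bound gives the existence of \<open>N\<close>; by the second one, only compactness in
  the interior is left. For a cutoff function \<open>h\<close>, consider the Fourier series of \<open>h u\<close> on a cube. Since
  \<open>D D\<^sup>* + D\<^sup>* D\<close> has symbol \<open>|\<mu>|\<^sup>2 / 4\<close>, the coefficients weighted by \<open>|\<mu>| / 2\<close> are bounded in
  \<open>\<ell>\<^sup>2\<close>, so \<open>\<parallel>h u\<parallel>\<close> is controlled by finitely many linear functionals up to an arbitrarily small error.
  All Hilbert spaces are treated as real ones; complex linearity of \<open>N\<close> is recovered at the end.\<close>

section \<open>Real Hilbert spaces\<close>

text \<open>The obstacle is that a form in \<open>dom D \<inter> dom D*\<close> is known only
  weakly, while identities for \<open>D (h u)\<close> and \<open>D* (h u)\<close> are usually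
  derived for smooth forms and extended by approximation in the graph norm. This is avoided by
  attaching the cutoff to the exponential: \<open>h * cis\<close> is a test function, so inserting
  it into the weak definitions of \<open>D u\<close> and \<open>D* u\<close> gives exact equations
  between Fourier coefficients of \<open>h u\<close> and of expressions without derivatives of
  \<open>u\<close>. Operators are treated as graphs, that is, as closed subspaces cut out by linear
  equations; this suits values determined only up to null sets and makes adjoints and limits easy.
  Nothing is lost over the reals, because a complex linear equation tested with
  \<open>\<phi>\<close> and \<open>- \<i> * \<phi>\<close> is the same as its real part for all test
  functions. Everything meets in one estimate: at unit energy,
  \<open>|u|^2 \<le> e + B * (\<Sum>y\<in>Y. (u \<bullet> y)^2)\<close> with a finite set
  \<open>Y\<close>. It says that the unit energy ball is totally bounded. The condition
  \<open>r > 2\<close> makes \<open>M powr (2 - r)\<close> small for large \<open>M\<close>, which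
  controls the part of \<open>u\<close> above the level \<open>M\<close>.\<close>

text \<open>Minimise the energy \<open>E\<close> on \<open>M\<close>: the parallelogram law makes a
  minimising sequence Cauchy, and minimality along lines through the limit is the asserted equation.
  Linearity and boundedness are asked only on \<open>M\<close>, since the functional of the later
  application is meaningful only on the range of an operator.\<close>

lemma riesz_representation:
  fixes M :: "'h::{real_inner,complete_space} set"
  assumes M: "subspace M" "closed M"
    and add: "\<And>x y. x \<in> M \<Longrightarrow> y \<in> M \<Longrightarrow> \<phi> (x + y) = \<phi> x + \<phi> y"
    and scale: "\<And>c x. x \<in> M \<Longrightarrow> \<phi> (c *\<^sub>R x) = c * \<phi> x"
    and bd: "\<And>x. x \<in> M \<Longrightarrow> \<bar>\<phi> x\<bar> \<le> B * norm x"
  obtains a where "a \<in> M" "\<And>x. x \<in> M \<Longrightarrow> \<phi> x = x \<bullet> a"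
proof -
  define E where "E x = norm x ^ 2 - 2 * \<phi> x" for x
  define m where "m = Inf (E ` M)"
  have zero: "0 \<in> M" using M subspace_0 by blast
  have lb: "- (B ^ 2) \<le> E x" if "x \<in> M" for x
  proof -
    have "\<phi> x \<le> B * norm x" using bd[OF that] by linarith
    moreover have "0 \<le> (norm x - B) ^ 2" by simp
    ultimately show ?thesis unfolding E_def by (simp add: power2_eq_square algebra_simps)
  qed
  have bdd: "bdd_below (E ` M)" using lb by (auto intro!: bdd_belowI[of _ "- (B^2)"])
  have m_le: "m \<le> E x" if "x \<in> M" for x
    unfolding m_def using bdd that by (auto intro: cInf_lower)
  have "\<exists>x\<in>M. E x < m + inverse (real (Suc n))" for n
  proof -
    have "Inf (E ` M) < m + inverse (real (Suc n))" unfolding m_def by simp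
    then show ?thesis using cInf_lessD[of "E ` M"] zero by blast
  qed
  then obtain X where X: "\<And>n. X n \<in> M" "\<And>n. E (X n) < m + inverse (real (Suc n))" by metis
  \<comment> \<open>The midpoint lies in \<open>M\<close> and has energy at least \<open>m\<close>,
    so two almost minimal points are close together.\<close>
  have mid: "norm (x - y) ^ 2 \<le> 2 * (E x - m) + 2 * (E y - m)" if "x \<in> M" "y \<in> M" for x y
  proof -
    define z where "z = (1/2) *\<^sub>R (x + y)"
    have z: "z \<in> M" unfolding z_def using M that by (simp add: subspace_add subspace_scale)
    have phz: "\<phi> z = (\<phi> x + \<phi> y) / 2" unfolding z_def using scale[of "x+y"] add[OF that] M that
      by (simp add: subspace_add)
    have "norm (x - y) ^ 2 = 2 * norm x ^ 2 + 2 * norm y ^ 2 - 4 * norm z ^ 2"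
      unfolding z_def power2_norm_eq_inner by (simp add: algebra_simps inner_commute)
    also have "\<dots> = 2 * E x + 2 * E y - 4 * E z" unfolding E_def phz by (simp add: field_simps)
    finally have "norm (x - y) ^ 2 = 2 * E x + 2 * E y - 4 * E z" .
    moreover have "4 * m \<le> 4 * E z" using m_le[OF z] by simp
    ultimately show ?thesis by (simp add: right_diff_distrib)
  qed
  have "Cauchy X"
  proof (rule metric_CauchyI)
    fix e :: real assume e: "e > 0"
    obtain N where N: "inverse (real (Suc N)) < e^2 / 4"
      using reals_Archimedean e by (metis divide_pos_pos zero_less_numeral zero_less_power)
    have "dist (X i) (X j) < e" if "i \<ge> N" "j \<ge> N" for i j
    proof -
      have ij: "inverse (real (Suc i)) \<le> inverse (real (Suc N))" "inverse (real (Suc j)) \<le> inverse (real (Suc N))"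
        using that by (auto intro!: le_imp_inverse_le)
      have "norm (X i - X j) ^ 2 < e ^ 2"
      proof -
        have *: "p < q" if "p \<le> 2 * (a - k) + 2 * (b - k)" "a < k + i" "b < k + j" "i \<le> l" "j \<le> l" "l < q / 4"
          for p q a b i j k l :: real
          using that unfolding right_diff_distrib by linarith
        show ?thesis using *[OF mid[OF X(1) X(1), of i j] X(2)[of i] X(2)[of j] ij N] .
      qed
      then show ?thesis unfolding dist_norm using e by (simp add: power_less_imp_less_base)
    qed
    then show "\<exists>N. \<forall>i\<ge>N. \<forall>j\<ge>N. dist (X i) (X j) < e" by blast
  qed
  then obtain a where a: "X \<longlonglongrightarrow> a" using Cauchy_convergent convergent_def by blast
  have aM: "a \<in> M" using M(2) X(1) a closed_sequentially by blast
  have "\<phi> x = x \<bullet> a" if x: "x \<in> M" for x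
  proof -
    have lim\<phi>: "(\<lambda>n. \<phi> (X n)) \<longlonglongrightarrow> \<phi> a"
    proof (rule LIM_zero_cancel)
      have eq: "\<phi> (X n) - \<phi> a = \<phi> (X n - a)" for n
        using add[of "X n - a" a] X(1) aM M(1) by (simp add: subspace_diff)
      have "(\<lambda>n. B * norm (X n - a)) \<longlonglongrightarrow> B * 0"
        by (intro tendsto_mult_left tendsto_norm_zero LIM_zero a)
      then have *: "(\<lambda>n. B * norm (X n - a)) \<longlonglongrightarrow> 0" by simp
      have "norm (\<phi> (X n) - \<phi> a) \<le> B * norm (X n - a)" for n
        unfolding eq real_norm_def by (intro bd subspace_diff M X(1) aM)
      then show "(\<lambda>n. \<phi> (X n) - \<phi> a) \<longlonglongrightarrow> 0"
        by (intro Lim_null_comparison[OF _ *] always_eventually allI)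
    qed
    have "(\<lambda>n. E (X n)) \<longlonglongrightarrow> E a" unfolding E_def
      by (intro tendsto_intros a lim\<phi>)
    moreover have "(\<lambda>n. m + inverse (real (Suc n))) \<longlonglongrightarrow> m + 0"
      by (intro tendsto_intros LIMSEQ_inverse_real_of_nat)
    moreover have "\<exists>N. \<forall>n\<ge>N. E (X n) \<le> m + inverse (real (Suc n))" using X(2) less_imp_le by blast
    ultimately have "E a \<le> m + 0" by (rule LIMSEQ_le)
    then have "E a \<le> m" by simp
    \<comment> \<open>Minimality of \<open>a\<close> along the line \<open>a + t x\<close>: a
      quadratic in \<open>t\<close> with zero constant term stays nonnegative, so its linear term
      must vanish.\<close>
    have quad: "0 \<le> t ^ 2 * norm x ^ 2 - 2 * t * (\<phi> x - x \<bullet> a)" for t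
    proof -
      have "E a \<le> E (a + t *\<^sub>R x)"
        using \<open>E a \<le> m\<close> m_le[of "a + t *\<^sub>R x"] aM x M(1) by (simp add: subspace_add subspace_scale)
      moreover have "E (a + t *\<^sub>R x) = E a + t ^ 2 * norm x ^ 2 - 2 * t * (\<phi> x - x \<bullet> a)"
        unfolding E_def power2_norm_eq_inner using add[OF aM, of "t *\<^sub>R x"] scale[OF x, of t] x M(1)
        by (simp add: subspace_scale algebra_simps inner_commute power2_eq_square)
      ultimately show ?thesis by linarith
    qed
    define d where "d = \<phi> x - x \<bullet> a"
    \<comment> \<open>Positive also for \<open>x = 0\<close>; the choice \<open>t = d / s\<close> in
      \<open>quad\<close> then yields \<open>d^2 / s \<le> 0\<close>.\<close>
    define s where "s = norm x ^ 2 + 1"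
    have s: "s > 0" unfolding s_def by (simp add: add_nonneg_pos)
    have "0 \<le> (d/s)^2 * s - 2 * (d/s) * d"
    proof -
      have "(d/s)^2 * norm x ^ 2 \<le> (d/s)^2 * s" unfolding s_def by (intro mult_left_mono) auto
      then show ?thesis using quad[of "d/s"] unfolding d_def by linarith
    qed
    also have "(d/s)^2 * s - 2 * (d/s) * d = - (d^2 / s)"
      using s by (simp add: field_simps power2_eq_square)
    finally have "d ^ 2 / s \<le> 0" by simp
    then have "d = 0" using s by (simp add: divide_le_0_iff)
    then show ?thesis unfolding d_def by simp
  qed
  then show thesis using that aM by blast
qed

text \<open>The projection of \<open>y\<close> is the Riesz vector of the functional
  \<open>x \<bullet> y\<close> restricted to \<open>M\<close>.\<close>

lemma orthogonal_projection:
  fixes M :: "'h::{real_inner,complete_space} set"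
  assumes "subspace M" "closed M"
  obtains p where "p \<in> M" "\<And>x. x \<in> M \<Longrightarrow> x \<bullet> (y - p) = 0"
proof (rule riesz_representation[OF assms, of "\<lambda>x. x \<bullet> y" "norm y"])
  show "\<bar>x \<bullet> y\<bar> \<le> norm y * norm x" for x
    using Cauchy_Schwarz_ineq2[of x y] by (simp add: mult.commute)
qed (auto simp: inner_add_left inner_diff_right intro: that)

lemma subspace_closure_subspace:
  fixes S :: "'a::real_normed_vector set"
  assumes "subspace S"
  shows "subspace (closure S)"
proof (rule subspaceI)
  show "0 \<in> closure S" using subspace_0[OF assms] closure_subset by blast
next
  fix x y assume "x \<in> closure S" "y \<in> closure S"
  then obtain X Y where "\<And>n. X n \<in> S" "X \<longlonglongrightarrow> x" "\<And>n. Y n \<in> S" "Y \<longlonglongrightarrow> y"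
    unfolding closure_sequential by blast
  then have "\<forall>n. X n + Y n \<in> S" "(\<lambda>n. X n + Y n) \<longlonglongrightarrow> x + y"
    using subspace_add[OF assms] by (auto intro: tendsto_add)
  then show "x + y \<in> closure S" unfolding closure_sequential by (intro exI[of _ "\<lambda>n. X n + Y n"] conjI)
next
  fix c x assume "x \<in> closure S"
  then obtain X where "\<And>n. X n \<in> S" "X \<longlonglongrightarrow> x" unfolding closure_sequential by blast
  then have "\<forall>n. c *\<^sub>R X n \<in> S" "(\<lambda>n. c *\<^sub>R X n) \<longlonglongrightarrow> c *\<^sub>R x"
    using subspace_scale[OF assms] by (auto intro: tendsto_scaleR)
  then show "c *\<^sub>R x \<in> closure S" unfolding closure_sequential by (intro exI[of _ "\<lambda>n. c *\<^sub>R X n"] conjI)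
qed

text \<open>The difference between \<open>v\<close> and its projection to the closed span stays in
  \<open>W\<close> and is orthogonal to \<open>E\<close>, so totality makes it vanish.\<close>

lemma mem_closure_span:
  fixes E :: "'h::{real_inner,complete_space} set"
  assumes W: "subspace W" "closed W" "E \<subseteq> W"
    and total: "\<And>w. w \<in> W \<Longrightarrow> (\<And>x. x \<in> E \<Longrightarrow> x \<bullet> w = 0) \<Longrightarrow> w = 0"
    and v: "v \<in> W"
  shows "v \<in> closure (span E)"
proof -
  have sub: "closure (span E) \<subseteq> W"
    using W by (simp add: closure_minimal span_minimal)
  obtain p where p: "p \<in> closure (span E)" "\<And>x. x \<in> closure (span E) \<Longrightarrow> x \<bullet> (v - p) = 0"
    using orthogonal_projection[OF subspace_closure_subspace[OF subspace_span] closed_closure, of E v] by blast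
  have "v - p = 0"
  proof (rule total)
    show "v - p \<in> W" using v p(1) sub W by (auto intro: subspace_diff)
    show "x \<bullet> (v - p) = 0" if "x \<in> E" for x
      using p(2)[of x] that span_base[of x E] closure_subset[of "span E"] by auto
  qed
  then show ?thesis using p(1) by simp
qed

section \<open>Bessel and Parseval for orthogonal systems\<close>

context
  fixes E :: "'h::real_inner set" and \<kappa> :: real
  assumes orth: "\<And>x y. x \<in> E \<Longrightarrow> y \<in> E \<Longrightarrow> x \<noteq> y \<Longrightarrow> x \<bullet> y = 0"
    and \<kappa>: "\<kappa> > 0" "\<And>x. x \<in> E \<Longrightarrow> x \<bullet> x = \<kappa>"
begin

text \<open>The vectors share one square length \<open>\<kappa>\<close> instead of being normalised,
  because the exponentials on a cube all have its volume as square length.\<close>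

lemma norm_diff_orthogonal_sum:
  assumes F: "finite F" "F \<subseteq> E"
  shows "norm (v - (\<Sum>x\<in>F. c x *\<^sub>R x)) ^ 2 = norm v ^ 2 - 2 * (\<Sum>x\<in>F. c x * (v \<bullet> x)) + \<kappa> * (\<Sum>x\<in>F. c x ^ 2)"
proof -
  have 1: "(\<Sum>x\<in>F. c x *\<^sub>R x) \<bullet> y = c y * \<kappa>" if "y \<in> F" for y
  proof -
    have "(\<Sum>x\<in>F. c x *\<^sub>R x) \<bullet> y = (\<Sum>x\<in>F. if x = y then c y * \<kappa> else 0)"
      unfolding inner_sum_left
    proof (rule sum.cong)
      show "c x *\<^sub>R x \<bullet> y = (if x = y then c y * \<kappa> else 0)" if "x \<in> F" for x
        using orth[of x y] \<kappa>(2)[of y] that \<open>y \<in> F\<close> F by auto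
    qed simp
    then show ?thesis using that F by simp
  qed
  have "(\<Sum>x\<in>F. c x *\<^sub>R x) \<bullet> (\<Sum>y\<in>F. c y *\<^sub>R y) = (\<Sum>y\<in>F. c y * ((\<Sum>x\<in>F. c x *\<^sub>R x) \<bullet> y))"
    by (simp add: inner_sum_right)
  also have "\<dots> = \<kappa> * (\<Sum>x\<in>F. c x ^ 2)"
    using 1 by (simp add: sum_distrib_left power2_eq_square ac_simps)
  moreover have "v \<bullet> (\<Sum>x\<in>F. c x *\<^sub>R x) = (\<Sum>x\<in>F. c x * (v \<bullet> x))" by (simp add: inner_sum_right)
  ultimately show ?thesis
    unfolding power2_norm_eq_inner inner_diff_left inner_diff_right
    by (simp add: inner_commute[of "\<Sum>x\<in>F. c x *\<^sub>R x" v])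
qed

lemma bessel_inequality:
  assumes F: "finite F" "F \<subseteq> E"
  shows "(\<Sum>x\<in>F. (v \<bullet> x) ^ 2) \<le> \<kappa> * norm v ^ 2"
proof -
  have "0 \<le> norm (v - (\<Sum>x\<in>F. ((v \<bullet> x) / \<kappa>) *\<^sub>R x)) ^ 2" by simp
  also have "\<dots> = norm v ^ 2 - 2 * ((\<Sum>x\<in>F. (v \<bullet> x) ^ 2) / \<kappa>) + \<kappa> * ((\<Sum>x\<in>F. (v \<bullet> x) ^ 2) / \<kappa> ^ 2)"
    unfolding norm_diff_orthogonal_sum[OF F]
    by (simp add: power_divide sum_divide_distrib power2_eq_square)
  also have "\<dots> = norm v ^ 2 - (\<Sum>x\<in>F. (v \<bullet> x) ^ 2) / \<kappa>" using \<kappa>(1) by (simp add: power2_eq_square)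
  finally show ?thesis using \<kappa>(1) by (simp add: field_simps)
qed

text \<open>A vector of the closed span is close to a finite combination of \<open>E\<close>, and on
  the vectors used there the Fourier coefficients do at least as well as the given ones. A finite
  set with an error takes the place of a convergent series.\<close>

lemma parseval_approx:
  assumes v: "v \<in> closure (span E)" and e: "e > 0"
  obtains F where "finite F" "F \<subseteq> E" "\<kappa> * norm v ^ 2 \<le> (\<Sum>x\<in>F. (v \<bullet> x) ^ 2) + e"
proof -
  have "sqrt (e / \<kappa>) > 0" using e \<kappa> by simp
  then obtain y where y: "y \<in> span E" "dist y v < sqrt (e / \<kappa>)" using v closure_approachable by metis
  obtain F c where F: "finite F" "F \<subseteq> E" "y = (\<Sum>x\<in>F. c x *\<^sub>R x)"
    using y(1) unfolding span_explicit by auto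
  have "norm (v - y) < sqrt (e / \<kappa>)" using y(2) by (simp add: dist_norm norm_minus_commute)
  then have "norm (v - y) ^ 2 < (sqrt (e / \<kappa>)) ^ 2" by (intro power_strict_mono) auto
  then have 1: "\<kappa> * norm (v - y) ^ 2 < e" using e \<kappa>(1) by (simp add: field_simps)
  \<comment> \<open>Compares the coefficients \<open>c\<close> with the optimal ones
    \<open>(v \<bullet> x) / \<kappa>\<close>.\<close>
  have "0 \<le> (\<Sum>x\<in>F. (v \<bullet> x - \<kappa> * c x) ^ 2)" by (intro sum_nonneg) auto
  also have "\<dots> = (\<Sum>x\<in>F. (v \<bullet> x) ^ 2) - 2 * \<kappa> * (\<Sum>x\<in>F. c x * (v \<bullet> x)) + \<kappa> ^ 2 * (\<Sum>x\<in>F. c x ^ 2)"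
    unfolding sum_distrib_left sum_subtractf[symmetric] sum.distrib[symmetric]
    by (intro sum.cong) (auto simp: power2_eq_square algebra_simps)
  finally have "\<kappa> * norm v ^ 2 \<le> (\<Sum>x\<in>F. (v \<bullet> x) ^ 2) + \<kappa> * norm (v - y) ^ 2"
    unfolding F(3) norm_diff_orthogonal_sum[OF F(1,2)] by (simp add: algebra_simps power2_eq_square)
  with 1 show thesis using that[OF F(1,2)] by linarith
qed

end

text \<open>The graph of the Hilbert space adjoint of the operator from \<open>H0\<close> to
  \<open>H1\<close> with graph \<open>S\<close>. A relation needs no density of the domain. The
  spaces are subspaces of one type, since the degree of a form is a number and not a type.\<close>

definition adjoint_rel :: "'h::real_inner set \<Rightarrow> 'h set \<Rightarrow> ('h \<times> 'h) set \<Rightarrow> ('h \<times> 'h) set" where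
  "adjoint_rel H0 H1 S = {(v, w). v \<in> H1 \<and> w \<in> H0 \<and> (\<forall>(u, f)\<in>S. f \<bullet> v = u \<bullet> w)}"

lemma adjoint_relI:
  "v \<in> H1 \<Longrightarrow> w \<in> H0 \<Longrightarrow> (\<And>u f. (u, f) \<in> S \<Longrightarrow> f \<bullet> v = u \<bullet> w) \<Longrightarrow> (v, w) \<in> adjoint_rel H0 H1 S"
  unfolding adjoint_rel_def by auto

lemma adjoint_relD:
  assumes "(v, w) \<in> adjoint_rel H0 H1 S"
  shows "v \<in> H1" "w \<in> H0" "(u, f) \<in> S \<Longrightarrow> f \<bullet> v = u \<bullet> w"
  using assms unfolding adjoint_rel_def by auto

lemma subspace_adjoint_rel:
  "subspace H0 \<Longrightarrow> subspace H1 \<Longrightarrow> subspace (adjoint_rel H0 H1 S)"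
  unfolding subspace_def adjoint_rel_def
  by (simp add: inner_add_right zero_prod_def split_beta)

lemma closed_adjoint_rel:
  assumes "closed H0" "closed H1"
  shows "closed (adjoint_rel H0 H1 S)"
proof -
  have "adjoint_rel H0 H1 S = (H1 \<times> H0) \<inter> (\<Inter>p\<in>S. {x. snd p \<bullet> fst x = fst p \<bullet> snd x})"
    unfolding adjoint_rel_def by fastforce
  also have "closed \<dots>"
    by (intro closed_Int closed_Times assms closed_INT ballI closed_Collect_eq continuous_intros)
  finally show ?thesis .
qed

text \<open>Up to the rotation \<open>(x, y) \<mapsto> (y, - x)\<close> the adjoint graph is the
  orthogonal complement of \<open>S\<close> in \<open>H0 \<times> H1\<close>, so a closed graph can
  be recovered from its adjoint.\<close>

lemma double_adjoint_rel:
  fixes S :: "('h::{real_inner,complete_space} \<times> 'h) set"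
  assumes H: "subspace H0" "subspace H1"
    and S: "subspace S" "closed S" "S \<subseteq> H0 \<times> H1"
    and bg: "b \<in> H0" "g \<in> H1" "\<And>v w. (v, w) \<in> adjoint_rel H0 H1 S \<Longrightarrow> w \<bullet> b = v \<bullet> g"
  shows "(b, g) \<in> S"
proof -
  obtain p where p: "p \<in> S" "\<And>x. x \<in> S \<Longrightarrow> x \<bullet> ((b, g) - p) = 0"
    using orthogonal_projection[OF S(1,2)] by blast
  obtain x y where xy: "(b, g) - p = (x, y)" by (cases "(b, g) - p")
  have x: "x \<in> H0" "y \<in> H1"
    using xy p(1) S(3) bg(1,2) H by (cases p; auto intro: subspace_diff)+
  \<comment> \<open>The part of \<open>(b, g)\<close> orthogonal to \<open>S\<close>, rotated. By
    assumption on \<open>(b, g)\<close> it is then orthogonal to \<open>(b, g)\<close> as well,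
    hence to itself.\<close>
  have "(y, - x) \<in> adjoint_rel H0 H1 S"
  proof (rule adjoint_relI)
    fix u f assume "(u, f) \<in> S"
    then show "f \<bullet> y = u \<bullet> - x" using p(2)[of "(u, f)"] xy by auto
  qed (use x H in \<open>auto simp: subspace_neg\<close>)
  then have "- x \<bullet> b = y \<bullet> g" using bg(3) by blast
  then have "((b, g) - p) \<bullet> (b, g) = 0" unfolding xy by simp
  moreover have "((b, g) - p) \<bullet> p = 0" using p by (simp add: inner_commute)
  ultimately have "((b, g) - p) \<bullet> ((b, g) - p) = 0" unfolding inner_diff_right[of "(b,g) - p" "(b,g)" p] by simp
  then show ?thesis using p(1) by simp
qed

subsection \<open>The Laplacian of a Hilbert complex\<close>

text \<open>\<open>S\<close> and \<open>T\<close> are the graphs of two consecutive operators of the complex.\<close>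

locale hilbert_complex =
  fixes H0 H1 H2 :: "'h::{real_inner,complete_space} set" and S T :: "('h \<times> 'h) set" and c :: real
  assumes H: "subspace H0" "closed H0" "subspace H1" "closed H1" "subspace H2" "closed H2"
    and S: "subspace S" "closed S" "S \<subseteq> H0 \<times> H1"
    and T: "subspace T" "closed T" "T \<subseteq> H1 \<times> H2"
    and complex: "(x, y) \<in> S \<Longrightarrow> (y, 0) \<in> T"
    and c_nonneg: "0 \<le> c"
    and estimate: "(u, a) \<in> T \<Longrightarrow> (u, b) \<in> adjoint_rel H0 H1 S \<Longrightarrow> norm u \<le> c * norm (a, b)"
begin

abbreviation "S' \<equiv> adjoint_rel H0 H1 S"
abbreviation "T' \<equiv> adjoint_rel H1 H2 T"

text \<open>\<open>u\<close> solves \<open>S S' u + T' T u = f\<close>. The values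
  \<open>a = T u\<close> and \<open>b = S' u\<close> are arguments because all estimates are in
  terms of the energy \<open>norm (a, b)\<close>.\<close>

definition laplacian_rel :: "'h \<Rightarrow> 'h \<Rightarrow> 'h \<Rightarrow> 'h \<Rightarrow> bool" where
  "laplacian_rel u a b f \<longleftrightarrow> (u, a) \<in> T \<and> (u, b) \<in> S' \<and> (\<exists>g h. (b, g) \<in> S \<and> (a, h) \<in> T' \<and> g + h = f)"

text \<open>Pair the equation with \<open>u\<close> and move the outer operators to the other
  factor.\<close>

lemma laplacian_rel_energy:
  assumes "laplacian_rel u a b f"
  shows "norm (a, b) ^ 2 = u \<bullet> f"
proof -
  obtain g h where *: "(u, a) \<in> T" "(u, b) \<in> S'" "(b, g) \<in> S" "(a, h) \<in> T'" "g + h = f"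
    using assms unfolding laplacian_rel_def by blast
  have "a \<bullet> a = u \<bullet> h" using adjoint_relD(3)[OF *(4) *(1)] .
  moreover have "g \<bullet> u = b \<bullet> b" using adjoint_relD(3)[OF *(2) *(3)] .
  ultimately show ?thesis using *(5)
    by (auto simp: power2_norm_eq_inner inner_add_right inner_commute)
qed

text \<open>The energy identity, Cauchy-Schwarz and \<open>estimate\<close> give
  \<open>|(a, b)|^2 \<le> c * |(a, b)| * |f|\<close>; one factor cancels.\<close>

lemma laplacian_rel_bound:
  assumes "laplacian_rel u a b f"
  shows "norm (a, b) \<le> c * norm f"
proof (cases "norm (a, b) = 0")
  case True
  then show ?thesis using c_nonneg by simp
next
  case False
  have *: "(u, a) \<in> T" "(u, b) \<in> S'" using assms unfolding laplacian_rel_def by auto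
  have "norm (a, b) ^ 2 \<le> norm u * norm f"
    using laplacian_rel_energy[OF assms] norm_cauchy_schwarz by metis
  also have "\<dots> \<le> (c * norm (a, b)) * norm f"
    using estimate[OF *] by (rule mult_right_mono) auto
  finally have "norm (a, b) * norm (a, b) \<le> norm (a, b) * (c * norm f)"
    by (simp add: power2_eq_square ac_simps)
  then show ?thesis using False by (metis mult_le_cancel_left_pos norm_ge_zero order_le_less)
qed

lemma subspace_kernel: "subspace {v. (v, 0) \<in> T}"
  unfolding subspace_def
  using subspace_0[OF T(1)] subspace_add[OF T(1)] subspace_scale[OF T(1)]
  by (force simp: zero_prod_def)

lemma closed_kernel: "closed {v. (v, 0) \<in> T}"
proof -
  have "closed ((\<lambda>v. (v, 0::'h)) -` T)"
    by (rule closed_vimage[OF T(2)]) (intro continuous_intros)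
  then show ?thesis by (simp add: vimage_def)
qed

text \<open>Projection to the kernel of \<open>T\<close>. The range of \<open>S\<close> lies in this
  kernel, so the complementary part \<open>v2\<close> is orthogonal to it, that is,
  \<open>S' v2 = 0\<close>.\<close>

lemma kernel_split:
  assumes "v \<in> H1"
  obtains v1 v2 where "v = v1 + v2" "(v1, 0) \<in> T" "\<And>z. (z, 0) \<in> T \<Longrightarrow> z \<bullet> v2 = 0" "(v2, 0) \<in> S'"
proof -
  obtain p where p: "p \<in> {v. (v, 0) \<in> T}" "\<And>x. x \<in> {v. (v, 0) \<in> T} \<Longrightarrow> x \<bullet> (v - p) = 0"
    using orthogonal_projection[OF subspace_kernel closed_kernel] by blast
  have "(v - p, 0) \<in> S'"
  proof (rule adjoint_relI)
    show "v - p \<in> H1" using p(1) T(3) assms H(3) by (auto intro: subspace_diff)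
    show "0 \<in> H0" using H(1) subspace_0 by blast
    show "f \<bullet> (v - p) = u \<bullet> 0" if "(u, f) \<in> S" for u f using p(2) complex[OF that] by simp
  qed
  then show thesis using that[of p "v - p"] p by auto
qed

text \<open>The weak solution of \<open>\<Box>u = f\<close> is given by the Riesz theorem in the range of
  \<open>u \<mapsto> (T u, S' u)\<close>. It is a strong solution because the orthogonal projection to the kernel
  of \<open>T\<close> changes neither \<open>T u\<close> nor, since the range of \<open>S\<close> lies in that kernel, \<open>S' u\<close>.\<close>

lemma laplacian_rel_exists:
  assumes f: "f \<in> H1"
  obtains u a b where "laplacian_rel u a b f"
proof -
  define R where "R = {(a, b). \<exists>u. (u, a) \<in> T \<and> (u, b) \<in> S'}"
  have sS': "subspace S'" and cS': "closed S'"
    using H by (auto intro: subspace_adjoint_rel closed_adjoint_rel)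
  have uniq: "u = v" if "(u, a) \<in> T" "(u, b) \<in> S'" "(v, a) \<in> T" "(v, b) \<in> S'" for u v a b
  proof -
    have "(u - v, 0) \<in> T" "(u - v, 0) \<in> S'"
      using subspace_diff[OF T(1) that(1,3)] subspace_diff[OF sS' that(2,4)] by auto
    then show ?thesis using estimate[of "u - v" 0 0] by (simp add: norm_Pair)
  qed
  have sR: "subspace R" unfolding subspace_def
  proof (intro conjI ballI allI)
    show "0 \<in> R" unfolding R_def using subspace_0[OF T(1)] subspace_0[OF sS'] by (auto simp: zero_prod_def)
    show "x + y \<in> R" if "x \<in> R" "y \<in> R" for x y
      using that subspace_add[OF T(1)] subspace_add[OF sS'] unfolding R_def by fastforce
    show "k *\<^sub>R x \<in> R" if "x \<in> R" for k x
      using that subspace_scale[OF T(1)] subspace_scale[OF sS'] unfolding R_def by fastforce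
  qed
  \<comment> \<open>By \<open>estimate\<close> the preimages of a convergent sequence of energy
    pairs are Cauchy, and both graphs are closed.\<close>
  have cR: "closed R" unfolding closed_sequential_limits
  proof (intro allI impI, elim conjE)
    fix X l assume X: "\<forall>n. X n \<in> R" and lim: "X \<longlonglongrightarrow> l"
    have "\<exists>u. (u, fst (X n)) \<in> T \<and> (u, snd (X n)) \<in> S'" for n
      using X[rule_format, of n] unfolding R_def by (auto simp: case_prod_beta)
    then obtain U where U: "\<And>n. (U n, fst (X n)) \<in> T" "\<And>n. (U n, snd (X n)) \<in> S'" by metis
    have d: "norm (U i - U j) \<le> c * norm (X i - X j)" for i j
      using estimate[of "U i - U j" "fst (X i - X j)" "snd (X i - X j)"]
        subspace_diff[OF T(1) U(1) U(1), of i j] subspace_diff[OF sS' U(2) U(2), of i j]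
      by (simp add: prod_eq_iff[symmetric] flip: fst_diff snd_diff)
    have "Cauchy U"
    proof (rule metric_CauchyI)
      fix e :: real assume "e > 0"
      then have "e / (c + 1) > 0" using c_nonneg by simp
      then obtain N where N: "\<And>i j. i \<ge> N \<Longrightarrow> j \<ge> N \<Longrightarrow> dist (X i) (X j) < e / (c + 1)"
        using LIMSEQ_imp_Cauchy[OF lim] metric_CauchyD by metis
      have "dist (U i) (U j) < e" if "i \<ge> N" "j \<ge> N" for i j
      proof -
        have "norm (U i - U j) \<le> (c + 1) * norm (X i - X j)"
          using d[of i j] by (smt (verit) mult_right_mono norm_ge_zero)
        also have "\<dots> < e" using N[OF that] c_nonneg
          by (simp add: dist_norm pos_less_divide_eq mult.commute add_nonneg_pos)
        finally show ?thesis by (simp add: dist_norm)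
      qed
      then show "\<exists>N. \<forall>i\<ge>N. \<forall>j\<ge>N. dist (U i) (U j) < e" by blast
    qed
    then obtain u where u: "U \<longlonglongrightarrow> u" using Cauchy_convergent convergent_def by blast
    have "(u, fst l) \<in> T"
      by (rule closed_sequentially[OF T(2), of "\<lambda>n. (U n, fst (X n))"]) (auto intro!: U tendsto_intros u lim)
    moreover have "(u, snd l) \<in> S'"
      by (rule closed_sequentially[OF cS', of "\<lambda>n. (U n, snd (X n))"]) (auto intro!: U tendsto_intros u lim)
    ultimately show "l \<in> R" unfolding R_def by (auto simp: case_prod_beta)
  qed
  \<comment> \<open>The inverse of \<open>u \<mapsto> (T u, S' u)\<close>, well defined by
    \<open>uniq\<close>; the functional to be represented is \<open>V x \<bullet> f\<close>.\<close>
  define V where "V x = (THE u. (u, fst x) \<in> T \<and> (u, snd x) \<in> S')" for x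
  have V_eq: "V (a, b) = u" if "(u, a) \<in> T" "(u, b) \<in> S'" for u a b
    unfolding V_def using that by (auto intro: uniq)
  have VR: "(V x, fst x) \<in> T" "(V x, snd x) \<in> S'" if "x \<in> R" for x
    using that V_eq unfolding R_def by auto
  obtain w where w: "w \<in> R" "\<And>x. x \<in> R \<Longrightarrow> V x \<bullet> f = x \<bullet> w"
  proof (rule riesz_representation[OF sR cR, of "\<lambda>x. V x \<bullet> f" "c * norm f"])
    fix x y assume xy: "x \<in> R" "y \<in> R"
    have "V (x + y) = V x + V y"
      using V_eq[of "V x + V y" "fst (x+y)" "snd (x+y)"]
        subspace_add[OF T(1) VR(1)[OF xy(1)] VR(1)[OF xy(2)]] subspace_add[OF sS' VR(2)[OF xy(1)] VR(2)[OF xy(2)]]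
      by (simp add: plus_prod_def)
    then show "V (x + y) \<bullet> f = V x \<bullet> f + V y \<bullet> f" by (simp add: inner_add_left)
  next
    fix k x assume x: "x \<in> R"
    have "V (k *\<^sub>R x) = k *\<^sub>R V x"
      using V_eq[of "k *\<^sub>R V x" "k *\<^sub>R fst x" "k *\<^sub>R snd x"]
        subspace_scale[OF T(1) VR(1)[OF x], of k] subspace_scale[OF sS' VR(2)[OF x], of k]
      by (cases x) simp
    then show "V (k *\<^sub>R x) \<bullet> f = k * (V x \<bullet> f)" by simp
  next
    fix x assume x: "x \<in> R"
    have "\<bar>V x \<bullet> f\<bar> \<le> norm (V x) * norm f" by (rule Cauchy_Schwarz_ineq2)
    also have "\<dots> \<le> (c * norm x) * norm f"
      using estimate[OF VR[OF x]] by (intro mult_right_mono) auto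
    finally show "\<bar>V x \<bullet> f\<bar> \<le> c * norm f * norm x" by (simp add: ac_simps)
  qed blast
  obtain a0 b0 where ab: "w = (a0, b0)" by (cases w)
  \<comment> \<open>The Riesz vector lies in \<open>R\<close>, so it is the energy pair of some
    \<open>u0\<close>; this is the weak solution.\<close>
  obtain u0 where u0: "(u0, a0) \<in> T" "(u0, b0) \<in> S'" using w(1) unfolding R_def ab by blast
  have weak: "a \<bullet> a0 + b \<bullet> b0 = u \<bullet> f" if "(u, a) \<in> T" "(u, b) \<in> S'" for u a b
  proof -
    have "(a, b) \<in> R" using that unfolding R_def by blast
    from w(2)[OF this] show ?thesis unfolding V_eq[OF that] ab by simp
  qed
  obtain f1 f2 where fs: "f = f1 + f2" "(f1, 0) \<in> T" "\<And>z. (z, 0) \<in> T \<Longrightarrow> z \<bullet> f2 = 0" "(f2, 0) \<in> S'"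
    using kernel_split[OF f] by blast
  have "(a0, f2) \<in> T'"
  proof (rule adjoint_relI)
    show "a0 \<in> H2" using u0 T(3) by auto
    show "f2 \<in> H1" using adjoint_relD(1)[OF fs(4)] .
    fix v y assume vy: "(v, y) \<in> T"
    then have "v \<in> H1" using T(3) by auto
    then obtain v1 v2 where v: "v = v1 + v2" "(v1, 0) \<in> T" "\<And>z. (z, 0) \<in> T \<Longrightarrow> z \<bullet> v2 = 0" "(v2, 0) \<in> S'"
      using kernel_split by blast
    have "(v2, y) \<in> T" using subspace_diff[OF T(1) vy v(2)] v(1) by simp
    \<comment> \<open>\<open>v2\<close> has the same image under \<open>T\<close> as
      \<open>v\<close>, and \<open>S' v2 = 0\<close>, so only the first term of the weak equation
      remains.\<close>
    then have "y \<bullet> a0 = v2 \<bullet> f" using weak[of v2 y 0] v(4) by simp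
    also have "\<dots> = v2 \<bullet> f2" using v(3)[OF fs(2)] unfolding fs(1) by (simp add: inner_add_right inner_commute)
    also have "\<dots> = v \<bullet> f2" using fs(3)[OF v(2)] unfolding v(1) by (simp add: inner_add_left)
    finally show "y \<bullet> a0 = v \<bullet> f2" .
  qed
  moreover have "(b0, f1) \<in> S"
  \<comment> \<open>\<open>S\<close> is its own double adjoint, so it suffices to test
    \<open>b0\<close> against the graph of \<open>S'\<close>. Dually to the above, the kernel part
    \<open>v1\<close> has the same image under \<open>S'\<close> as \<open>v\<close>.\<close>
  proof (rule double_adjoint_rel[OF H(1,3) S])
    show "b0 \<in> H0" using adjoint_relD(2)[OF u0(2)] .
    show "f1 \<in> H1" using fs(2) T(3) by auto
    fix v w assume vw: "(v, w) \<in> S'"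
    then obtain v1 v2 where v: "v = v1 + v2" "(v1, 0) \<in> T" "\<And>z. (z, 0) \<in> T \<Longrightarrow> z \<bullet> v2 = 0" "(v2, 0) \<in> S'"
      using kernel_split[OF adjoint_relD(1)[OF vw]] by blast
    have "(v1, w) \<in> S'" using subspace_diff[OF sS' vw v(4)] v(1) by simp
    then have "w \<bullet> b0 = v1 \<bullet> f" using weak[of v1 0 w] v(2) by simp
    also have "\<dots> = v1 \<bullet> f1" using fs(3)[OF v(2)] unfolding fs(1) by (simp add: inner_add_right)
    also have "\<dots> = v \<bullet> f1" using v(3)[OF fs(2)] unfolding v(1)
      by (simp add: inner_add_left inner_commute[of v2] )
    finally show "w \<bullet> b0 = v \<bullet> f1" .
  qed
  ultimately show thesis using that[of u0 a0 b0] u0 fs(1) unfolding laplacian_rel_def by blast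
qed

lemma laplacian_rel_add:
  assumes "laplacian_rel u a b f" "laplacian_rel u' a' b' f'"
  shows "laplacian_rel (u + u') (a + a') (b + b') (f + f')"
proof -
  have sub: "subspace S'" "subspace T'" using H by (auto intro: subspace_adjoint_rel)
  obtain g h where 1: "(u, a) \<in> T" "(u, b) \<in> S'" "(b, g) \<in> S" "(a, h) \<in> T'" "g + h = f"
    using assms(1) unfolding laplacian_rel_def by blast
  obtain g' h' where 2: "(u', a') \<in> T" "(u', b') \<in> S'" "(b', g') \<in> S" "(a', h') \<in> T'" "g' + h' = f'"
    using assms(2) unfolding laplacian_rel_def by blast
  have "(u + u', a + a') \<in> T" "(u + u', b + b') \<in> S'" "(b + b', g + g') \<in> S" "(a + a', h + h') \<in> T'"
    using subspace_add[OF T(1) 1(1) 2(1)] subspace_add[OF sub(1) 1(2) 2(2)]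
      subspace_add[OF S(1) 1(3) 2(3)] subspace_add[OF sub(2) 1(4) 2(4)] by simp_all
  moreover have "(g + g') + (h + h') = f + f'" using 1(5) 2(5) by (simp add: algebra_simps flip: 1(5) 2(5))
  ultimately show ?thesis unfolding laplacian_rel_def by blast
qed

lemma laplacian_rel_minus:
  assumes "laplacian_rel u a b f"
  shows "laplacian_rel (- u) (- a) (- b) (- f)"
proof -
  have sub: "subspace S'" "subspace T'" using H by (auto intro: subspace_adjoint_rel)
  obtain g h where 1: "(u, a) \<in> T" "(u, b) \<in> S'" "(b, g) \<in> S" "(a, h) \<in> T'" "g + h = f"
    using assms(1) unfolding laplacian_rel_def by blast
  have "(- u, - a) \<in> T" "(- u, - b) \<in> S'" "(- b, - g) \<in> S" "(- a, - h) \<in> T'"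
    using subspace_neg[OF T(1) 1(1)] subspace_neg[OF sub(1) 1(2)]
      subspace_neg[OF S(1) 1(3)] subspace_neg[OF sub(2) 1(4)] by simp_all
  moreover have "(- g) + (- h) = - f" by (simp flip: 1(5))
  ultimately show ?thesis unfolding laplacian_rel_def by blast
qed

lemma laplacian_rel_unique:
  assumes "laplacian_rel u a b f" "laplacian_rel u' a' b' f"
  shows "u = u'"
proof -
  have *: "laplacian_rel (u - u') (a - a') (b - b') 0"
    using laplacian_rel_add[OF assms(1) laplacian_rel_minus[OF assms(2)]] by simp
  have 0: "norm (a - a', b - b') = 0"
    using laplacian_rel_bound[OF *] norm_ge_zero[of "(a - a', b - b')"] by simp
  have "norm (u - u') \<le> c * norm (a - a', b - b')"
    using * by (intro estimate) (auto simp: laplacian_rel_def)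
  then show ?thesis unfolding 0 by simp
qed

text \<open>By \<open>est\<close>, differences of the \<open>U n\<close> are small as soon as
  finitely many inner products are close. These range over a bounded set, which a finite grid
  covers; hence the sequence is totally bounded.\<close>

lemma compactness:
  assumes est: "\<And>e. e > 0 \<Longrightarrow> \<exists>Y D. finite Y \<and> D \<ge> 0 \<and> (\<forall>u a b. (u, a) \<in> T \<longrightarrow> (u, b) \<in> S' \<longrightarrow> norm (a, b) \<le> 1 \<longrightarrow>
      norm u ^ 2 \<le> e + D * (\<Sum>y\<in>Y. (u \<bullet> y) ^ 2))"
    and U: "\<And>n. laplacian_rel (U n) (A n) (B n) (F n)" "\<And>n. norm (F n) \<le> K"
  obtains l \<sigma> where "strict_mono (\<sigma> :: nat \<Rightarrow> nat)" "(U \<circ> \<sigma>) \<longlonglongrightarrow> l"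
proof -
  have sS': "subspace S'" using H by (auto intro: subspace_adjoint_rel)
  define C where "C = c * K + 1"
  have K: "K \<ge> 0" using U(2)[of 0] norm_ge_zero order_trans by blast
  have C: "C > 0" unfolding C_def using c_nonneg K by (simp add: add_nonneg_pos)
  have TS: "(U n, A n) \<in> T" "(U n, B n) \<in> S'" for n using U(1) unfolding laplacian_rel_def by auto
  have AB: "norm (A n, B n) \<le> C" for n
  proof -
    have "norm (A n, B n) \<le> c * norm (F n)" by (rule laplacian_rel_bound[OF U(1)])
    also have "\<dots> \<le> c * K" using U(2) c_nonneg by (intro mult_left_mono)
    finally show ?thesis unfolding C_def by simp
  qed
  define P where "P = range U"
  have tb: "\<exists>k. finite k \<and> P \<subseteq> (\<Union>x\<in>k. ball x e)" if e: "e > 0" for e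
  proof -
    \<comment> \<open>Equal to \<open>t^2 * (e^2 / 4)\<close> for the scaling factor
      \<open>t = 1 / (2 * C)\<close> used below.\<close>
    define e' where "e' = e ^ 2 / (16 * C ^ 2)"
    have e': "e' > 0" unfolding e'_def using e C by simp
    obtain Y D where Y: "finite Y" "D \<ge> 0" and
      YD: "\<And>u a b. (u, a) \<in> T \<Longrightarrow> (u, b) \<in> S' \<Longrightarrow> norm (a, b) \<le> 1 \<Longrightarrow> norm u ^ 2 \<le> e' + D * (\<Sum>y\<in>Y. (u \<bullet> y) ^ 2)"
      using est[OF e'] by blast
    have dd: "norm (U i - U j) ^ 2 \<le> e^2/4 + D * (\<Sum>y\<in>Y. ((U i - U j) \<bullet> y) ^ 2)" for i j
    proof -
      \<comment> \<open>A difference of two members has energy at most \<open>2 * C\<close>; scaling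
        by \<open>t\<close> brings it to unit energy.\<close>
      define t where "t = 1 / (2 * C)"
      have t: "t > 0" unfolding t_def using C by simp
      have "norm (A i - A j, B i - B j) \<le> norm (A i, B i) + norm (A j, B j)"
        using norm_triangle_ineq4[of "(A i, B i)" "(A j, B j)"] by simp
      then have "norm (A i - A j, B i - B j) \<le> 2 * C" using AB[of i] AB[of j] by simp
      moreover have "(t *\<^sub>R (A i - A j), t *\<^sub>R (B i - B j)) = t *\<^sub>R (A i - A j, B i - B j)" by simp
      ultimately have 1: "norm (t *\<^sub>R (A i - A j), t *\<^sub>R (B i - B j)) \<le> 1"
        using t C unfolding t_def by (simp only: norm_scaleR) (simp add: field_simps)
      have 2: "(t *\<^sub>R (U i - U j), t *\<^sub>R (A i - A j)) \<in> T" "(t *\<^sub>R (U i - U j), t *\<^sub>R (B i - B j)) \<in> S'"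
        using subspace_scale[OF T(1) subspace_diff[OF T(1) TS(1) TS(1)], of t i j]
          subspace_scale[OF sS' subspace_diff[OF sS' TS(2) TS(2)], of t i j] by auto
      have "t^2 * norm (U i - U j) ^ 2 \<le> e' + D * (\<Sum>y\<in>Y. (t *\<^sub>R (U i - U j) \<bullet> y) ^ 2)"
        using YD[OF 2 1] by (simp add: power_mult_distrib)
      also have "\<dots> = t^2 * (e^2/4 + D * (\<Sum>y\<in>Y. ((U i - U j) \<bullet> y) ^ 2))"
      proof -
        have "(\<Sum>y\<in>Y. (t *\<^sub>R (U i - U j) \<bullet> y) ^ 2) = t^2 * (\<Sum>y\<in>Y. ((U i - U j) \<bullet> y) ^ 2)"
          by (simp only: inner_scaleR_left power_mult_distrib sum_distrib_left)
        moreover have "e' = t^2 * (e^2/4)" unfolding e'_def t_def by (simp add: power_divide power_mult_distrib)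
        ultimately show ?thesis by (simp add: algebra_simps)
      qed
      finally show ?thesis using t by simp
    qed
    \<comment> \<open>The cell width for which \<open>D * card Y * d^2 \<le> e^2 / 4\<close>; the
      \<open>+ 1\<close> keeps the denominator nonzero when \<open>D = 0\<close> or \<open>Y\<close>
      is empty.\<close>
    define d where "d = e / (2 * sqrt (D * card Y + 1))"
    have Dp: "D * card Y + 1 > 0" using Y by (simp add: add_nonneg_pos)
    have d: "d > 0" unfolding d_def using e Dp by simp
    \<comment> \<open>The grid cell of the vector of inner products with \<open>Y\<close>. Two
      indices in one cell differ by at most \<open>d\<close> in each of them.\<close>
    define q where "q n = (\<lambda>y\<in>Y. \<lfloor>(U n \<bullet> y) / d\<rfloor>)" for n
    have Ub: "norm (U n) \<le> c * C" for n
      using estimate[OF TS(1,2)[of n]] AB[of n] c_nonneg by (meson mult_left_mono order_trans)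
    have "range q \<subseteq> (\<Pi>\<^sub>E y\<in>Y. {\<lfloor>- (c * C * norm y) / d\<rfloor>..\<lfloor>(c * C * norm y) / d\<rfloor>})"
    proof (intro image_subsetI PiE_I)
      fix n y assume "y \<in> Y"
      have "\<bar>U n \<bullet> y\<bar> \<le> norm (U n) * norm y" by (rule Cauchy_Schwarz_ineq2)
      also have "\<dots> \<le> c * C * norm y" using Ub by (intro mult_right_mono) auto
      finally have "\<bar>U n \<bullet> y\<bar> \<le> c * C * norm y" .
      then show "q n y \<in> {\<lfloor>- (c * C * norm y) / d\<rfloor>..\<lfloor>(c * C * norm y) / d\<rfloor>}"
      proof -
        assume a: "\<bar>U n \<bullet> y\<bar> \<le> c * C * norm y"
        have "- (c * C * norm y) / d \<le> (U n \<bullet> y) / d" "(U n \<bullet> y) / d \<le> (c * C * norm y) / d"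
          using a d by (intro divide_right_mono; linarith)+
        then show ?thesis using \<open>y \<in> Y\<close> unfolding q_def by (simp add: floor_mono)
      qed
    qed (auto simp: q_def)
    then have fin: "finite (range q)" by (rule finite_subset) (intro finite_PiE Y finite_atLeastAtMost_int)
    define rep where "rep v = U (SOME n. q n = v)" for v
    have "U n \<in> ball (rep (q n)) e" for n
    proof -
      define m where "m = (SOME m. q m = q n)"
      have m: "q m = q n" unfolding m_def by (rule someI[of _ n]) simp
      have "((U m - U n) \<bullet> y) ^ 2 \<le> d ^ 2" if "y \<in> Y" for y
      proof -
        have "\<lfloor>(U m \<bullet> y) / d\<rfloor> = \<lfloor>(U n \<bullet> y) / d\<rfloor>" using fun_cong[OF m, of y] that unfolding q_def by simp
        then have "\<bar>(U m \<bullet> y) / d - (U n \<bullet> y) / d\<bar> \<le> 1" by linarith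
        then have "\<bar>(U m - U n) \<bullet> y\<bar> / d \<le> 1"
          using d by (simp add: inner_diff_left diff_divide_distrib[symmetric] abs_divide)
        then have "\<bar>(U m - U n) \<bullet> y\<bar> \<le> d" using d by simp
        then show ?thesis using abs_le_square_iff[of "(U m - U n) \<bullet> y" d] d by simp
      qed
      then have "(\<Sum>y\<in>Y. ((U m - U n) \<bullet> y) ^ 2) \<le> card Y * d ^ 2"
        using sum_bounded_above[of Y "\<lambda>y. ((U m - U n) \<bullet> y) ^ 2" "d^2"] by simp
      then have "D * (\<Sum>y\<in>Y. ((U m - U n) \<bullet> y) ^ 2) \<le> D * card Y * d ^ 2"
        using Y by (simp add: mult_left_mono mult.assoc)
      then have "norm (U m - U n) ^ 2 \<le> e^2/4 + D * card Y * d ^ 2" using dd[of m n] by linarith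
      also have "D * card Y * d ^ 2 \<le> (D * card Y + 1) * d ^ 2" by (intro mult_right_mono) auto
      also have "(D * card Y + 1) * d ^ 2 = e^2 / 4" unfolding d_def using Dp
        by (simp add: power_divide power_mult_distrib nonzero_divide_eq_eq)
      finally have "norm (U m - U n) ^ 2 < e ^ 2" using e zero_less_power[of e 2] by linarith
      then have "norm (U m - U n) < e" using e by (simp add: power_less_imp_less_base)
      then show ?thesis unfolding rep_def m_def[symmetric] by (simp add: dist_norm)
    qed
    then show ?thesis unfolding P_def by (intro exI[of _ "rep ` range q"] conjI finite_imageI fin) auto
  qed
  have "compact (closure P)" unfolding compact_eq_totally_bounded
  proof (intro conjI allI impI)
    show "complete (closure P)" by (simp add: complete_eq_closed)
    fix e :: real assume e: "0 < e"
    then obtain k where k: "finite k" "P \<subseteq> (\<Union>x\<in>k. ball x (e/2))" using tb[of "e/2"] by auto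
    have "closure P \<subseteq> (\<Union>x\<in>k. ball x e)"
    proof
      fix x assume "x \<in> closure P"
      then obtain y where y: "y \<in> P" "dist y x < e/2" using closure_approachable e half_gt_zero by metis
      then obtain z where "z \<in> k" "dist z y < e/2" using k(2) by auto
      then have "dist z x < e" using y(2) dist_triangle[of z x y] by linarith
      then show "x \<in> (\<Union>x\<in>k. ball x e)" using \<open>z \<in> k\<close> by auto
    qed
    then show "\<exists>k. finite k \<and> closure P \<subseteq> (\<Union>x\<in>k. ball x e)" using k(1) by blast
  qed
  then have "seq_compact (closure P)" by (rule compact_imp_seq_compact)
  moreover have "\<forall>n. U n \<in> closure P" using closure_subset[of P] by (auto simp: P_def)
  ultimately obtain l r where "strict_mono (r :: nat \<Rightarrow> nat)" "(U \<circ> r) \<longlonglongrightarrow> l"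
    by (rule seq_compactE)
  then show thesis by (rule that)
qed

end

section \<open>The Hilbert space of square-integrable functions\<close>

definition sq_int :: "('a::euclidean_space \<Rightarrow> 'b::euclidean_space) \<Rightarrow> bool" where
  "sq_int f \<longleftrightarrow> f \<in> borel_measurable lebesgue \<and> integrable lebesgue (\<lambda>x. (norm (f x))\<^sup>2)"

lemma sq_int_measurable: "sq_int f \<Longrightarrow> f \<in> borel_measurable lebesgue"
  unfolding sq_int_def by simp

lemma sq_int_bound:
  fixes f :: "'a::euclidean_space \<Rightarrow> 'b::euclidean_space"
  assumes "f \<in> borel_measurable lebesgue" "integrable lebesgue g" "\<And>x. (norm (f x))\<^sup>2 \<le> g x"
  shows "sq_int f"
  unfolding sq_int_def
proof
  show "integrable lebesgue (\<lambda>x. (norm (f x))\<^sup>2)"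
    by (rule Bochner_Integration.integrable_bound[OF assms(2)])
      (use assms in \<open>auto intro!: AE_I2 order_trans[OF assms(3)]\<close>)
qed (rule assms)

lemma sq_int_zero: "sq_int (\<lambda>x. 0)"
  unfolding sq_int_def by simp

lemma sq_int_scaleR: "sq_int f \<Longrightarrow> sq_int (\<lambda>x. c *\<^sub>R f x)"
  unfolding sq_int_def by (auto simp: power_mult_distrib intro: borel_measurable_scaleR)

lemma norm_add_sq_le: "(norm (x + y :: 'b::real_inner))\<^sup>2 \<le> 2 * (norm x)\<^sup>2 + 2 * (norm y)\<^sup>2"
proof -
  have "(norm (x + y))\<^sup>2 \<le> (norm x + norm y)\<^sup>2"
    by (intro power_mono norm_triangle_ineq) auto
  then show ?thesis using sum_squares_bound[of "norm x" "norm y"] by (simp add: power2_sum)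
qed

lemma sq_int_add: "sq_int f \<Longrightarrow> sq_int g \<Longrightarrow> sq_int (\<lambda>x. f x + g x)"
  by (rule sq_int_bound[where g = "\<lambda>x. 2 * (norm (f x))\<^sup>2 + 2 * (norm (g x))\<^sup>2"])
    (auto simp: sq_int_def norm_add_sq_le)

lemma sq_int_minus: "sq_int f \<Longrightarrow> sq_int (\<lambda>x. - f x)"
  unfolding sq_int_def by simp

lemma sq_int_diff: "sq_int f \<Longrightarrow> sq_int g \<Longrightarrow> sq_int (\<lambda>x. f x - g x)"
  using sq_int_add[of f "\<lambda>x. - g x"] sq_int_minus[of g] by simp

lemma sq_int_inner_integrable:
  assumes "sq_int f" "sq_int g"
  shows "integrable lebesgue (\<lambda>x. f x \<bullet> g x)"
proof (rule Bochner_Integration.integrable_bound)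
  show "integrable lebesgue (\<lambda>x. (norm (f x))\<^sup>2 + (norm (g x))\<^sup>2)"
    using assms unfolding sq_int_def by simp
  show "(\<lambda>x. f x \<bullet> g x) \<in> borel_measurable lebesgue"
    using assms unfolding sq_int_def by (intro borel_measurable_inner) auto
  have "\<bar>x \<bullet> y\<bar> \<le> (norm x)\<^sup>2 + (norm y)\<^sup>2" for x y :: 'b
  proof -
    have "0 \<le> norm x * norm y" by simp
    then show ?thesis using Cauchy_Schwarz_ineq2[of x y] sum_squares_bound[of "norm x" "norm y"] by linarith
  qed
  then show "AE x in lebesgue. norm (f x \<bullet> g x) \<le> norm ((norm (f x))\<^sup>2 + (norm (g x))\<^sup>2)"
    by (intro AE_I2) auto
qed

lemma sq_int_inner_zero_iff:
  assumes "sq_int f"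
  shows "(LINT x|lebesgue. f x \<bullet> f x) = 0 \<longleftrightarrow> (AE x in lebesgue. f x = 0)"
  using integral_nonneg_eq_0_iff_AE[OF sq_int_inner_integrable[OF assms assms]] by simp

\<comment> \<open>Equality almost everywhere is only a partial equivalence, with the
  square-integrable functions as its domain. The quotient is a type so that it can be an instance of
  \<open>real_inner\<close> and \<open>complete_space\<close> and the abstract results apply to
  it.\<close>
quotient_type (overloaded) ('a, 'b) L2 = "'a::euclidean_space \<Rightarrow> 'b::euclidean_space" /
  partial: "\<lambda>f g. sq_int f \<and> sq_int g \<and> (AE x in lebesgue. f x = g x)"
proof (rule part_equivpI)
  show "\<exists>f :: 'a \<Rightarrow> 'b. sq_int f \<and> sq_int f \<and> (AE x in lebesgue. f x = f x)"
    using sq_int_zero by auto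
  show "symp (\<lambda>f g :: 'a \<Rightarrow> 'b. sq_int f \<and> sq_int g \<and> (AE x in lebesgue. f x = g x))"
    by (rule sympI) (auto elim: eventually_mono)
  show "transp (\<lambda>f g :: 'a \<Rightarrow> 'b. sq_int f \<and> sq_int g \<and> (AE x in lebesgue. f x = g x))"
    by (rule transpI) (auto elim: eventually_elim2)
qed

instantiation L2 :: (euclidean_space, euclidean_space) real_inner
begin

lift_definition zero_L2 :: "('a, 'b) L2" is "\<lambda>x. 0"
  by (simp add: sq_int_zero)

lift_definition plus_L2 :: "('a, 'b) L2 \<Rightarrow> ('a, 'b) L2 \<Rightarrow> ('a, 'b) L2" is "\<lambda>f g x. f x + g x"
  by (auto intro: sq_int_add elim: eventually_elim2)

lift_definition minus_L2 :: "('a, 'b) L2 \<Rightarrow> ('a, 'b) L2 \<Rightarrow> ('a, 'b) L2" is "\<lambda>f g x. f x - g x"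
  by (auto intro: sq_int_diff elim: eventually_elim2)

lift_definition uminus_L2 :: "('a, 'b) L2 \<Rightarrow> ('a, 'b) L2" is "\<lambda>f x. - f x"
  by (auto intro: sq_int_minus elim: eventually_mono)

lift_definition scaleR_L2 :: "real \<Rightarrow> ('a, 'b) L2 \<Rightarrow> ('a, 'b) L2" is "\<lambda>c f x. c *\<^sub>R f x"
  by (auto intro: sq_int_scaleR elim: eventually_mono)

lift_definition inner_L2 :: "('a, 'b) L2 \<Rightarrow> ('a, 'b) L2 \<Rightarrow> real" is "\<lambda>f g. LINT x|lebesgue. f x \<bullet> g x"
  by (intro integral_cong_AE borel_measurable_inner) (auto simp: sq_int_def elim: eventually_elim2)

definition norm_L2 :: "('a, 'b) L2 \<Rightarrow> real" where "norm_L2 x = sqrt (x \<bullet> x)"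
definition dist_L2 :: "('a, 'b) L2 \<Rightarrow> ('a, 'b) L2 \<Rightarrow> real" where "dist_L2 x y = norm (x - y)"
definition sgn_L2 :: "('a, 'b) L2 \<Rightarrow> ('a, 'b) L2" where "sgn_L2 x = scaleR (inverse (norm x)) x"
definition uniformity_L2 :: "(('a, 'b) L2 \<times> ('a, 'b) L2) filter" where
  "uniformity_L2 = (INF e\<in>{0<..}. principal {(x, y). dist x y < e})"
definition open_L2 :: "('a, 'b) L2 set \<Rightarrow> bool" where
  "open_L2 U = (\<forall>x\<in>U. eventually (\<lambda>(x', y). x' = x \<longrightarrow> y \<in> U) uniformity)"

instance
proof
  fix x y z :: "('a, 'b) L2" and r s :: real and U :: "('a, 'b) L2 set"
  show "x + y + z = x + (y + z)" by transfer (auto intro: sq_int_add simp: add.assoc)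
  show "x + y = y + x" by transfer (auto intro: sq_int_add simp: add.commute)
  show "0 + x = x" by transfer auto
  show "- x + x = 0" by transfer (auto simp: sq_int_zero)
  show "x - y = x + - y" by transfer (auto intro: sq_int_add sq_int_diff sq_int_minus)
  show "r *\<^sub>R (x + y) = r *\<^sub>R x + r *\<^sub>R y"
    by transfer (auto intro: sq_int_add sq_int_scaleR simp: scaleR_add_right)
  show "(r + s) *\<^sub>R x = r *\<^sub>R x + s *\<^sub>R x"
    by transfer (auto intro: sq_int_add sq_int_scaleR simp: scaleR_add_left)
  show "r *\<^sub>R s *\<^sub>R x = (r * s) *\<^sub>R x" by transfer (auto intro: sq_int_scaleR)
  show "1 *\<^sub>R x = x" by transfer auto
  show "dist x y = norm (x - y)" by (rule dist_L2_def)
  show "sgn x = scaleR (inverse (norm x)) x" by (rule sgn_L2_def)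
  show "(uniformity :: (('a, 'b) L2 \<times> ('a, 'b) L2) filter) = (INF e\<in>{0<..}. principal {(x, y). dist x y < e})"
    by (rule uniformity_L2_def)
  show "open U = (\<forall>x\<in>U. eventually (\<lambda>(x', y). x' = x \<longrightarrow> y \<in> U) uniformity)" by (rule open_L2_def)
  show "x \<bullet> y = y \<bullet> x" by transfer (simp add: inner_commute)
  show "(x + y) \<bullet> z = x \<bullet> z + y \<bullet> z"
    by transfer (auto simp: inner_add_left sq_int_inner_integrable)
  show "(r *\<^sub>R x) \<bullet> y = r * (x \<bullet> y)" by transfer simp
  show "0 \<le> x \<bullet> x" by transfer simp
  show "(x \<bullet> x = 0) = (x = 0)" by transfer (simp add: sq_int_inner_zero_iff sq_int_zero)
  show "norm x = sqrt (x \<bullet> x)" by (rule norm_L2_def)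
qed

end

definition toL2 :: "('a::euclidean_space \<Rightarrow> 'b::euclidean_space) \<Rightarrow> ('a, 'b) L2" where
  "toL2 f = abs_L2 f"

definition ofL2 :: "('a::euclidean_space, 'b::euclidean_space) L2 \<Rightarrow> 'a \<Rightarrow> 'b" where
  "ofL2 = rep_L2"

lemma sq_int_ofL2: "sq_int (ofL2 X)"
  using Quotient3_rep_reflp[OF Quotient3_L2] unfolding ofL2_def by blast

lemma toL2_ofL2 [simp]: "toL2 (ofL2 X) = X"
  unfolding toL2_def ofL2_def by (rule Quotient3_abs_rep[OF Quotient3_L2])

lemma toL2_eq_iff: "sq_int f \<Longrightarrow> sq_int g \<Longrightarrow> toL2 f = toL2 g \<longleftrightarrow> (AE x in lebesgue. f x = g x)"
  unfolding toL2_def using Quotient3_rel[OF Quotient3_L2, of f g] by auto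

lemma toL2_add: "sq_int f \<Longrightarrow> sq_int g \<Longrightarrow> toL2 (\<lambda>x. f x + g x) = toL2 f + toL2 g"
  unfolding toL2_def by (simp add: plus_L2.abs_eq)

lemma toL2_diff: "sq_int f \<Longrightarrow> sq_int g \<Longrightarrow> toL2 (\<lambda>x. f x - g x) = toL2 f - toL2 g"
  unfolding toL2_def by (simp add: minus_L2.abs_eq)

lemma toL2_scaleR: "sq_int f \<Longrightarrow> toL2 (\<lambda>x. c *\<^sub>R f x) = c *\<^sub>R toL2 f"
  unfolding toL2_def by (simp add: scaleR_L2.abs_eq)

lemma toL2_zero: "toL2 (\<lambda>x. 0) = 0"
  unfolding toL2_def zero_L2_def ..

lemma inner_toL2: "sq_int f \<Longrightarrow> sq_int g \<Longrightarrow> toL2 f \<bullet> toL2 g = (LINT x|lebesgue. f x \<bullet> g x)"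
  unfolding toL2_def by (simp add: inner_L2.abs_eq)

lemma norm_toL2_sq: "sq_int f \<Longrightarrow> norm (toL2 f) ^ 2 = (LINT x|lebesgue. (norm (f x))\<^sup>2)"
  by (simp add: power2_norm_eq_inner inner_toL2)

lemma L2_cases:
  obtains f where "sq_int f" "X = toL2 f"
  using sq_int_ofL2[of X] toL2_ofL2[of X] by metis

text \<open>Riesz-Fischer: along a subsequence with \<open>\<parallel>f\<^sub>k\<^sub>+\<^sub>1 - f\<^sub>k\<parallel> \<le> 2\<^sup>-\<^sup>k\<close> the function
  \<open>\<Sum>\<^sub>k 2\<^sup>k |f\<^sub>k\<^sub>+\<^sub>1 - f\<^sub>k|\<^sup>2\<close> is integrable, hence finite almost everywhere.\<close>

lemma L2_rapid_limit:
  fixes f :: "nat \<Rightarrow> 'a::euclidean_space \<Rightarrow> 'b::euclidean_space"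
  assumes f: "\<And>k. sq_int (f k)"
    and rapid: "\<And>k. (LINT x|lebesgue. (norm (f (Suc k) x - f k x))\<^sup>2) \<le> (1/4) ^ k"
  obtains g where "g \<in> borel_measurable lebesgue" "AE x in lebesgue. (\<lambda>k. f k x) \<longlonglongrightarrow> g x"
proof -
  \<comment> \<open>With this weight the integrals are still at most \<open>(1/2) ^ k\<close>, while
    a bound on all \<open>d k x\<close> forces geometric decay of the differences at
    \<open>x\<close>.\<close>
  define d where "d k x = 2 ^ k * (norm (f (Suc k) x - f k x))\<^sup>2" for k x
  have [measurable]: "f k \<in> borel_measurable lebesgue" for k using f unfolding sq_int_def by simp
  have d: "integrable lebesgue (d k)" for k
    using sq_int_diff[OF f[of "Suc k"] f[of k]] unfolding d_def sq_int_def by simp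
  have "(\<integral>\<^sup>+x. (\<Sum>k. ennreal (d k x)) \<partial>lebesgue) = (\<Sum>k. (\<integral>\<^sup>+x. ennreal (d k x) \<partial>lebesgue))"
    by (intro nn_integral_suminf) (simp add: d_def)
  also have "\<dots> \<le> (\<Sum>k. ennreal ((1/2) ^ k))"
  proof (intro suminf_le allI)
    fix k
    have "(\<integral>\<^sup>+x. ennreal (d k x) \<partial>lebesgue) = ennreal (LINT x|lebesgue. d k x)"
      by (intro nn_integral_eq_integral d) (auto simp: d_def)
    also have "(LINT x|lebesgue. d k x) \<le> 2 ^ k * (1/4) ^ k"
      unfolding d_def using rapid[of k] by (simp add: mult_left_mono)
    also have "(2::real) ^ k * (1/4) ^ k = (1/2) ^ k" by (simp flip: power_mult_distrib)
    finally show "(\<integral>\<^sup>+x. ennreal (d k x) \<partial>lebesgue) \<le> ennreal ((1/2) ^ k)" by (simp add: ennreal_leI)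
  qed auto
  also have "\<dots> < \<infinity>"
    by (subst suminf_ennreal2) (auto simp: summable_geometric)
  finally have "(\<integral>\<^sup>+x. (\<Sum>k. ennreal (d k x)) \<partial>lebesgue) \<noteq> \<infinity>" by simp
  then have "AE x in lebesgue. (\<Sum>k. ennreal (d k x)) \<noteq> \<infinity>"
    by (intro nn_integral_PInf_AE) (simp_all add: d_def)
  then have conv: "AE x in lebesgue. convergent (\<lambda>k. f k x)"
  proof (rule eventually_mono)
    fix x assume "(\<Sum>k. ennreal (d k x)) \<noteq> \<infinity>"
    then obtain S where S: "(\<Sum>k. ennreal (d k x)) = ennreal S" "S \<ge> 0" by (cases "(\<Sum>k. ennreal (d k x))") auto
    have dS: "d k x \<le> S" for k
    proof -
      have "ennreal (d k x) \<le> (\<Sum>k. ennreal (d k x))"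
        using sum_le_suminf[of "\<lambda>k. ennreal (d k x)" "{k}"] by simp
      then show ?thesis using S by simp
    qed
    have "norm (f (Suc k) x - f k x) \<le> sqrt S * (1 / sqrt 2) ^ k" for k
    proof -
      have "(norm (f (Suc k) x - f k x))\<^sup>2 \<le> S / 2 ^ k"
        using dS[of k] unfolding d_def by (simp add: field_simps)
      then have "norm (f (Suc k) x - f k x) \<le> sqrt (S / 2 ^ k)" by (rule real_le_rsqrt)
      then show ?thesis by (simp add: real_sqrt_divide real_sqrt_power power_divide)
    qed
    moreover have "summable (\<lambda>k. sqrt S * (1 / sqrt 2) ^ k)"
      by (intro summable_mult summable_geometric) auto
    ultimately have "summable (\<lambda>k. f (Suc k) x - f k x)"
      by (rule summable_comparison_test'[rotated])
    then have "convergent (\<lambda>n. \<Sum>k<n. f (Suc k) x - f k x)" by (simp add: summable_iff_convergent)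
    then have "convergent (\<lambda>n. f n x - f 0 x)" using sum_lessThan_telescope[of "\<lambda>k. f k x"] by simp
    then have "convergent (\<lambda>n. (f n x - f 0 x) + f 0 x)" by (intro convergent_add convergent_const)
    then show "convergent (\<lambda>k. f k x)" by simp
  qed
  show thesis
  proof (rule that)
    show "(\<lambda>x. lim (\<lambda>k. f k x)) \<in> borel_measurable lebesgue" by measurable
    show "AE x in lebesgue. (\<lambda>k. f k x) \<longlonglongrightarrow> lim (\<lambda>k. f k x)"
      using conv by (simp add: convergent_LIMSEQ_iff)
  qed
qed

text \<open>A subsequence is rapid enough to converge almost everywhere, and Fatou's lemma turns the
  pointwise limit into a limit in norm.\<close>

instance L2 :: (euclidean_space, euclidean_space) complete_space
proof
  fix X :: "nat \<Rightarrow> ('a, 'b) L2" assume X: "Cauchy X"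
  have "\<exists>\<sigma>. \<forall>k. (\<forall>n\<ge>\<sigma> k. norm (X n - X (\<sigma> k)) < (1/2) ^ k) \<and> \<sigma> k < \<sigma> (Suc k)"
  proof (rule dependent_nat_choice)
    have *: "\<exists>N. \<forall>n\<ge>N. \<forall>m\<ge>N. norm (X n - X m) < (1/2) ^ k" for k
      using metric_CauchyD[OF X, of "(1/2)^k"] by (simp add: dist_norm)
    show "\<exists>s. \<forall>n\<ge>s. norm (X n - X s) < (1/2) ^ 0" using *[of 0] by (meson order_refl)
    fix s k
    obtain N where "\<forall>n\<ge>N. \<forall>m\<ge>N. norm (X n - X m) < (1/2) ^ Suc k" using * by blast
    then show "\<exists>t. (\<forall>n\<ge>t. norm (X n - X t) < (1/2) ^ Suc k) \<and> s < t"
      by (intro exI[of _ "max N (Suc s)"]) auto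
  qed
  then obtain \<sigma> where \<sigma>: "\<And>k n. n \<ge> \<sigma> k \<Longrightarrow> norm (X n - X (\<sigma> k)) < (1/2) ^ k" "strict_mono \<sigma>"
    unfolding strict_mono_Suc_iff by blast
  define f where "f k = ofL2 (X (\<sigma> k))" for k
  have f: "sq_int (f k)" "toL2 (f k) = X (\<sigma> k)" for k unfolding f_def by (simp_all add: sq_int_ofL2)
  have [measurable]: "f k \<in> borel_measurable lebesgue" for k using f unfolding sq_int_def by simp
  have nrm: "(LINT x|lebesgue. (norm (f j x - f k x))\<^sup>2) = norm (X (\<sigma> j) - X (\<sigma> k)) ^ 2" for j k
    using norm_toL2_sq[OF sq_int_diff[OF f(1)[of j] f(1)[of k]]] by (simp add: toL2_diff f)
  have le: "norm (X (\<sigma> j) - X (\<sigma> k)) ^ 2 \<le> (1/4) ^ k" if "j \<ge> k" for j k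
  proof -
    have "\<sigma> j \<ge> \<sigma> k" using \<sigma>(2) that by (simp add: strict_mono_less_eq)
    then have "norm (X (\<sigma> j) - X (\<sigma> k)) ^ 2 \<le> ((1/2) ^ k) ^ 2"
      using \<sigma>(1) by (intro power_mono) (auto intro: less_imp_le)
    then show ?thesis by (simp add: power2_eq_square flip: power_mult_distrib)
  qed
  obtain g where g[measurable]: "g \<in> borel_measurable lebesgue" and lim: "AE x in lebesgue. (\<lambda>k. f k x) \<longlonglongrightarrow> g x"
  proof (rule L2_rapid_limit[of f])
    show "(LINT x|lebesgue. (norm (f (Suc k) x - f k x))\<^sup>2) \<le> (1/4) ^ k" for k
      unfolding nrm by (rule le) simp
  qed (auto simp: f)
  have fatou: "(\<integral>\<^sup>+x. ennreal ((norm (g x - f k x))\<^sup>2) \<partial>lebesgue) \<le> ennreal ((1/4) ^ k)" for k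
  proof -
    have "(\<integral>\<^sup>+x. ennreal ((norm (g x - f k x))\<^sup>2) \<partial>lebesgue)
        = (\<integral>\<^sup>+x. liminf (\<lambda>j. ennreal ((norm (f j x - f k x))\<^sup>2)) \<partial>lebesgue)"
    proof (rule nn_integral_cong_AE, use lim in eventually_elim)
      fix x assume "(\<lambda>j. f j x) \<longlonglongrightarrow> g x"
      then have "(\<lambda>j. ennreal ((norm (f j x - f k x))\<^sup>2)) \<longlonglongrightarrow> ennreal ((norm (g x - f k x))\<^sup>2)"
        by (intro tendsto_intros)
      then show "ennreal ((norm (g x - f k x))\<^sup>2) = liminf (\<lambda>j. ennreal ((norm (f j x - f k x))\<^sup>2))"
        by (intro lim_imp_Liminf[symmetric]) auto
    qed
    also have "\<dots> \<le> liminf (\<lambda>j. \<integral>\<^sup>+x. ennreal ((norm (f j x - f k x))\<^sup>2) \<partial>lebesgue)"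
      by (intro nn_integral_liminf) measurable
    also have "\<dots> \<le> ennreal ((1/4) ^ k)"
    proof (rule Liminf_le)
      show "\<forall>\<^sub>F j in sequentially. (\<integral>\<^sup>+x. ennreal ((norm (f j x - f k x))\<^sup>2) \<partial>lebesgue) \<le> ennreal ((1/4) ^ k)"
        using eventually_ge_at_top[of k]
      proof eventually_elim
        case (elim j)
        have "(\<integral>\<^sup>+x. ennreal ((norm (f j x - f k x))\<^sup>2) \<partial>lebesgue) = ennreal (norm (X (\<sigma> j) - X (\<sigma> k)) ^ 2)"
          unfolding nrm[symmetric]
          by (intro nn_integral_eq_integral) (use sq_int_diff[OF f(1)[of j] f(1)[of k]] in \<open>auto simp: sq_int_def\<close>)
        then show ?case using le[OF elim] by (simp add: ennreal_leI)
      qed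
    qed simp
    finally show ?thesis .
  qed
  \<comment> \<open>The Fatou bound for a single \<open>k\<close> already shows that
    \<open>g\<close> is square integrable, because \<open>f k\<close> is.\<close>
  have gf: "sq_int (\<lambda>x. g x - f k x)" for k
    unfolding sq_int_def
    by (intro conjI integrableI_bounded) (use fatou[of k] in \<open>auto intro: le_less_trans\<close>)
  have g': "sq_int g" using sq_int_add[OF gf[of 0] f(1)[of 0]] by simp
  have "norm (toL2 g - X (\<sigma> k)) ^ 2 \<le> (1/4) ^ k" for k
  proof -
    have "ennreal (norm (toL2 g - X (\<sigma> k)) ^ 2) = (\<integral>\<^sup>+x. ennreal ((norm (g x - f k x))\<^sup>2) \<partial>lebesgue)"
      unfolding f(2)[symmetric] toL2_diff[OF g' f(1), symmetric] norm_toL2_sq[OF gf]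
      by (intro nn_integral_eq_integral[symmetric]) (use gf[of k] in \<open>auto simp: sq_int_def\<close>)
    also have "\<dots> \<le> ennreal ((1/4) ^ k)" by (rule fatou)
    finally show ?thesis by (simp add: ennreal_le_iff)
  qed
  then have *: "norm (norm (X (\<sigma> k) - toL2 g) ^ 2) \<le> (1/4) ^ k" for k by (simp add: norm_minus_commute)
  have "(\<lambda>k. (1/4) ^ k :: real) \<longlonglongrightarrow> 0" by (rule LIMSEQ_power_zero) simp
  from Lim_null_comparison[OF always_eventually[OF allI, OF *] this]
  have "(\<lambda>k. norm (X (\<sigma> k) - toL2 g) ^ 2) \<longlonglongrightarrow> 0" .
  then have "(\<lambda>k. sqrt (norm (X (\<sigma> k) - toL2 g) ^ 2)) \<longlonglongrightarrow> sqrt 0" by (intro tendsto_real_sqrt)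
  then have "(X \<circ> \<sigma>) \<longlonglongrightarrow> toL2 g"
    unfolding o_def by - (rule LIM_zero_cancel, rule tendsto_norm_zero_cancel, simp)
  then have "X \<longlonglongrightarrow> toL2 g" by (rule Cauchy_converges_subseq[OF X \<sigma>(2)])
  then show "convergent X" by (auto simp: convergent_def)
qed

section \<open>Test functions\<close>

subsection \<open>An algebra of smooth functions\<close>

text \<open>For \<open>n = 0\<close> this is the function \<open>exp (-1/t)\<close>; the factors \<open>t\<^sup>-\<^sup>n\<close> arise from its derivatives.\<close>

definition flat :: "nat \<Rightarrow> real \<Rightarrow> real" where
  "flat n t = (if t \<le> 0 then 0 else inverse t ^ n * exp (- inverse t))"

lemma flat_nonneg: "0 \<le> flat n t"
  unfolding flat_def by simp

lemma flat_0_le: "flat 0 t \<le> 1"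
  unfolding flat_def by simp

text \<open>For \<open>s = 1 / t\<close> and \<open>m = n + 2\<close> this is
  \<open>(s / m)^m \<le> (1 + s / m)^m \<le> exp s\<close>. Quadratic decay is enough for the
  difference quotient at \<open>0\<close> to vanish.\<close>

lemma flat_le_square: "flat n t \<le> real (n + 2) ^ (n + 2) * t\<^sup>2"
proof (cases "t \<le> 0")
  case False
  then have t: "t > 0" by simp
  define s where "s = inverse t"
  have s: "s > 0" "t = inverse s" using t unfolding s_def by auto
  have "(s / real (n + 2)) ^ (n + 2) \<le> (1 + s / real (n + 2)) ^ (n + 2)"
    using s by (intro power_mono) auto
  also have "\<dots> \<le> exp s"
    using s by (intro exp_ge_one_plus_x_over_n_power_n) auto
  finally have "s ^ (n + 2) \<le> real (n + 2) ^ (n + 2) * exp s"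
    unfolding power_divide by (simp add: pos_divide_le_eq mult.commute del: power_Suc of_nat_add)
  then have "s ^ (n + 2) * exp (- s) \<le> real (n + 2) ^ (n + 2) * exp s * exp (- s)"
    by (rule mult_right_mono) simp
  also have "real (n + 2) ^ (n + 2) * exp s * exp (- s) = real (n + 2) ^ (n + 2)"
    by (simp add: exp_minus del: power_Suc of_nat_add)
  also have "s ^ (n + 2) * exp (- s) = (s ^ n * exp (- s)) * s\<^sup>2"
    by (simp only: power_add ac_simps)
  finally have "(s ^ n * exp (- s)) * s\<^sup>2 \<le> real (n + 2) ^ (n + 2)" .
  then have "s ^ n * exp (- s) \<le> real (n + 2) ^ (n + 2) / s\<^sup>2"
    using s by (subst pos_le_divide_eq) auto
  then show ?thesis using t s unfolding flat_def
    by (simp add: power_inverse divide_inverse del: power_Suc of_nat_add)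
qed (simp add: flat_def)

lemma flat_has_real_derivative:
  "(flat n has_real_derivative flat (n + 2) t - real n * flat (n + 1) t) (at t)"
proof (cases t "0 :: real" rule: linorder_cases)
  case less
  have "((\<lambda>t. 0) has_real_derivative 0) (at t)" by simp
  then have "(flat n has_real_derivative 0) (at t)"
    by (rule has_field_derivative_transform_within_open[of _ _ _ "{..<0}"]) (use less in \<open>auto simp: flat_def\<close>)
  then show ?thesis using less by (simp add: flat_def)
next
  case equal
  define C where "C = real (n + 2) ^ (n + 2)"
  have "((\<lambda>h. flat n h / h) \<longlongrightarrow> 0) (at 0)"
  proof (rule Lim_null_comparison)
    show "\<forall>\<^sub>F h in at 0. norm (flat n h / h) \<le> C * \<bar>h\<bar>"
    proof (rule always_eventually, rule allI)
      fix h :: real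
      have "norm (flat n h / h) \<le> (C * h\<^sup>2) / \<bar>h\<bar>"
        using flat_le_square[of n h] flat_nonneg[of n h] unfolding C_def by (simp add: divide_right_mono)
      also have "\<dots> = C * \<bar>h\<bar>" by (cases "h = 0") (auto simp: power2_eq_square abs_if)
      finally show "norm (flat n h / h) \<le> C * \<bar>h\<bar>" .
    qed
    have "((\<lambda>h. C * \<bar>h\<bar>) \<longlongrightarrow> C * \<bar>0\<bar>) (at 0)" by (intro tendsto_intros)
    then show "((\<lambda>h. C * \<bar>h\<bar>) \<longlongrightarrow> 0) (at 0)" by simp
  qed
  then show ?thesis using equal by (simp add: DERIV_def flat_def)
next
  case greater
  have "((\<lambda>t. inverse t ^ n * exp (- inverse t)) has_real_derivative
      inverse t ^ (n + 2) * exp (- inverse t) - real n * (inverse t ^ (n + 1) * exp (- inverse t))) (at t)"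
  proof -
    define s where "s = inverse t"
    have "((\<lambda>s. s ^ n * exp (- s)) has_real_derivative real n * s ^ (n - 1) * exp (- s) - s ^ n * exp (- s)) (at s)"
      by (auto intro!: derivative_eq_intros)
    then have "((\<lambda>t. inverse t ^ n * exp (- inverse t)) has_real_derivative
        (real n * s ^ (n - 1) * exp (- s) - s ^ n * exp (- s)) * - (s ^ 2)) (at t)"
      using DERIV_inverse[of t] greater unfolding s_def
      by (intro DERIV_chain2[where g = inverse]) (auto simp: numeral_2_eq_2)
    moreover have "(real n * s ^ (n - 1) * exp (- s) - s ^ n * exp (- s)) * - (s ^ 2)
        = s ^ (n + 2) * exp (- s) - real n * (s ^ (n + 1) * exp (- s))"
      by (cases n) (auto simp: algebra_simps power2_eq_square)
    ultimately show ?thesis unfolding s_def by simp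
  qed
  then have "(flat n has_real_derivative
      inverse t ^ (n + 2) * exp (- inverse t) - real n * (inverse t ^ (n + 1) * exp (- inverse t))) (at t)"
    by (rule has_field_derivative_transform_within_open[of _ _ _ "{0<..}"]) (use greater in \<open>auto simp: flat_def\<close>)
  then show ?thesis using greater by (simp add: flat_def)
qed

text \<open>A class closed under differentiation, so that membership alone yields derivatives of all
  orders and only first order rules are needed. Its generators suffice to build cutoffs and to
  multiply them by exponentials.\<close>

inductive smooth_alg :: "('a::euclidean_space \<Rightarrow> complex) \<Rightarrow> bool" where
  flat: "smooth_alg (\<lambda>x. complex_of_real (flat n (x \<bullet> v + d)))"
| cis: "smooth_alg (\<lambda>x. cis (x \<bullet> v))"
| const: "smooth_alg (\<lambda>x. c)"
| add: "smooth_alg f \<Longrightarrow> smooth_alg g \<Longrightarrow> smooth_alg (\<lambda>x. f x + g x)"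
| mult: "smooth_alg f \<Longrightarrow> smooth_alg g \<Longrightarrow> smooth_alg (\<lambda>x. f x * g x)"

lemma smooth_alg_prod:
  "finite I \<Longrightarrow> (\<And>i. i \<in> I \<Longrightarrow> smooth_alg (f i)) \<Longrightarrow> smooth_alg (\<lambda>x. \<Prod>i\<in>I. f i x)"
  by (induction I rule: finite_induct) (auto intro: smooth_alg.intros)

lemma smooth_alg_deriv:
  assumes "smooth_alg f"
  shows "\<exists>f'. (\<forall>x. (f has_derivative f' x) (at x)) \<and> (\<forall>v. smooth_alg (\<lambda>x. f' x v))"
  using assms
proof induction
  case (flat n w d)
  define D where "D t = flat (n + 2) t - real n * flat (n + 1) t" for t
  have "((\<lambda>x. complex_of_real (flat n (x \<bullet> w + d))) has_derivative
      (\<lambda>v. complex_of_real (D (x \<bullet> w + d) * (v \<bullet> w)))) (at x)" for x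
  proof -
    have "((\<lambda>x. flat n (x \<bullet> w + d)) has_derivative (\<lambda>v. D (x \<bullet> w + d) * (v \<bullet> w))) (at x)"
      by (rule has_derivative_compose[of "\<lambda>x. x \<bullet> w + d" "\<lambda>v. v \<bullet> w" x UNIV "flat n" "(*) (D (x \<bullet> w + d))"])
        (use flat_has_real_derivative[of n "x \<bullet> w + d"] in
          \<open>auto intro!: derivative_eq_intros simp: has_field_derivative_def D_def\<close>)
    then show ?thesis by (rule has_derivative_of_real)
  qed
  moreover have "smooth_alg (\<lambda>x. complex_of_real (D (x \<bullet> w + d) * (v \<bullet> w)))" for v
  proof -
    have "smooth_alg (\<lambda>x. (complex_of_real (flat (n + 2) (x \<bullet> w + d)) +
        (- complex_of_real (real n)) * complex_of_real (flat (n + 1) (x \<bullet> w + d))) * complex_of_real (v \<bullet> w))"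
      by (intro smooth_alg.intros)
    then show ?thesis unfolding D_def by simp
  qed
  ultimately show ?case
    by (intro exI[of _ "\<lambda>x v. complex_of_real (D (x \<bullet> w + d) * (v \<bullet> w))"] conjI allI)
next
  case (cis w)
  have "((\<lambda>x. cis (x \<bullet> w)) has_derivative (\<lambda>v. cis (x \<bullet> w) * (\<i> * complex_of_real (v \<bullet> w)))) (at x)" for x
  proof -
    have "((\<lambda>x. \<i> * complex_of_real (x \<bullet> w)) has_derivative (\<lambda>v. \<i> * complex_of_real (v \<bullet> w))) (at x)"
      by (auto intro!: derivative_eq_intros)
    from has_derivative_compose[OF this DERIV_exp[unfolded has_field_derivative_def]]
    have "((\<lambda>x. exp (\<i> * complex_of_real (x \<bullet> w))) has_derivative
        (\<lambda>v. exp (\<i> * complex_of_real (x \<bullet> w)) * (\<i> * complex_of_real (v \<bullet> w)))) (at x)" .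
    then show ?thesis by (simp add: cis_conv_exp)
  qed
  moreover have "smooth_alg (\<lambda>x. cis (x \<bullet> w) * (\<i> * complex_of_real (v \<bullet> w)))" for v
    by (intro smooth_alg.intros)
  ultimately show ?case
    by (intro exI[of _ "\<lambda>x v. cis (x \<bullet> w) * (\<i> * complex_of_real (v \<bullet> w))"]) auto
next
  case (const c)
  then show ?case by (intro exI[of _ "\<lambda>x v. 0"]) (auto intro: smooth_alg.intros)
next
  case (add f g)
  then obtain f' g' where "\<And>x. (f has_derivative f' x) (at x)" "\<And>v. smooth_alg (\<lambda>x. f' x v)"
      "\<And>x. (g has_derivative g' x) (at x)" "\<And>v. smooth_alg (\<lambda>x. g' x v)" by blast
  then show ?case
    by (intro exI[of _ "\<lambda>x v. f' x v + g' x v"]) (auto intro: smooth_alg.intros has_derivative_add)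
next
  case (mult f g)
  then obtain f' g' where "\<And>x. (f has_derivative f' x) (at x)" "\<And>v. smooth_alg (\<lambda>x. f' x v)"
      "\<And>x. (g has_derivative g' x) (at x)" "\<And>v. smooth_alg (\<lambda>x. g' x v)" by blast
  then show ?case using mult.hyps
    by (intro exI[of _ "\<lambda>x v. f x * g' x v + f' x v * g x"]) (auto intro!: smooth_alg.intros has_derivative_mult)
qed

lemma smooth_alg_Ck_on: "smooth_alg f \<Longrightarrow> Ck_on k f UNIV"
proof (induction k arbitrary: f)
  case 0
  then obtain f' where "\<And>x. (f has_derivative f' x) (at x)" using smooth_alg_deriv by blast
  then show ?case by (auto intro!: continuous_at_imp_continuous_on intro: has_derivative_continuous)
next
  case (Suc k)
  obtain f' where f': "\<And>x. (f has_derivative f' x) (at x)" "\<And>v. smooth_alg (\<lambda>x. f' x v)"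
    using smooth_alg_deriv[OF Suc.prems] by blast
  have "frechet_derivative f (at x) = f' x" for x using frechet_derivative_at[OF f'(1)] by simp
  then show ?case using Suc.IH[OF f'(2)] f'(1) by (auto simp: differentiable_def)
qed

lemma smooth_alg_smooth_on: "smooth_alg f \<Longrightarrow> smooth_on f UNIV"
  unfolding smooth_on_def by (simp add: smooth_alg_Ck_on)

subsection \<open>Calculus of smooth functions\<close>

lemma smooth_on_differentiable: "smooth_on f UNIV \<Longrightarrow> f differentiable (at x)"
  unfolding smooth_on_def by (metis Ck_on.simps(2) UNIV_I)

lemma smooth_on_continuous: "smooth_on f UNIV \<Longrightarrow> continuous_on A f"
  unfolding smooth_on_def by (metis Ck_on.simps(1) continuous_on_subset subset_UNIV)

lemma smooth_on_frechet: "smooth_on f UNIV \<Longrightarrow> v \<in> Basis \<Longrightarrow> smooth_on (\<lambda>x. frechet_derivative f (at x) v) UNIV"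
  unfolding smooth_on_def using Ck_on.simps(2) by blast

lemma Ck_on_add: "Ck_on k f UNIV \<Longrightarrow> Ck_on k g UNIV \<Longrightarrow> Ck_on k (\<lambda>x. f x + g x) UNIV"
proof (induction k arbitrary: f g)
  case (Suc k)
  have "((\<lambda>x. f x + g x) has_derivative (\<lambda>v. frechet_derivative f (at x) v + frechet_derivative g (at x) v)) (at x)" for x
    using Suc.prems by (auto intro!: has_derivative_add simp flip: frechet_derivative_works)
  then have "(\<lambda>x. f x + g x) differentiable (at x)"
    "frechet_derivative (\<lambda>x. f x + g x) (at x) = (\<lambda>v. frechet_derivative f (at x) v + frechet_derivative g (at x) v)" for x
    by (auto simp: differentiable_def dest: frechet_derivative_at[symmetric])
  then show ?case using Suc by simp
qed (auto intro: continuous_on_add)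

lemma Ck_on_mult_const:
  fixes f :: "'a::euclidean_space \<Rightarrow> complex"
  shows "Ck_on k f UNIV \<Longrightarrow> Ck_on k (\<lambda>x. c * f x) UNIV"
proof (induction k arbitrary: f)
  case (Suc k)
  have "((\<lambda>x. c * f x) has_derivative (\<lambda>v. c * frechet_derivative f (at x) v)) (at x)" for x
    using Suc.prems by (auto intro!: has_derivative_mult_right simp flip: frechet_derivative_works)
  then have "(\<lambda>x. c * f x) differentiable (at x)" 
    "frechet_derivative (\<lambda>x. c * f x) (at x) = (\<lambda>v. c * frechet_derivative f (at x) v)" for x
    by (auto simp: differentiable_def dest: frechet_derivative_at[symmetric])
  then show ?case using Suc by simp
qed (auto intro: continuous_on_mult_left)

lemma smooth_on_add: "smooth_on f UNIV \<Longrightarrow> smooth_on g UNIV \<Longrightarrow> smooth_on (\<lambda>x. f x + g x) UNIV"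
  unfolding smooth_on_def by (simp add: Ck_on_add)

lemma smooth_on_mult_const:
  fixes f :: "'a::euclidean_space \<Rightarrow> complex"
  shows "smooth_on f UNIV \<Longrightarrow> smooth_on (\<lambda>x. c * f x) UNIV"
  unfolding smooth_on_def by (simp add: Ck_on_mult_const)

text \<open>Differentiating under the integral sign, the integral of one mixed derivative along
  \<open>v\<close> becomes a difference of first derivatives in direction \<open>w\<close>.
  Differentiating this in the length of the segment exchanges the order.\<close>

lemma frechet_derivative_symmetric:
  fixes f :: "'a::euclidean_space \<Rightarrow> complex"
  assumes f: "smooth_on f UNIV" and v: "v \<in> Basis" and w: "w \<in> Basis"
  shows "frechet_derivative (\<lambda>y. frechet_derivative f (at y) v) (at x) w
       = frechet_derivative (\<lambda>y. frechet_derivative f (at y) w) (at x) v"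
proof -
  define D where "D v y = frechet_derivative f (at y) v" for v y
  define DD where "DD v w y = frechet_derivative (D v) (at y) w" for v w y
  have sm: "smooth_on (D v) UNIV" if "v \<in> Basis" for v
    unfolding D_def using smooth_on_frechet[OF f that] .
  have smm: "smooth_on (DD v w) UNIV" if "v \<in> Basis" "w \<in> Basis" for v w
    unfolding DD_def using smooth_on_frechet[OF sm[OF that(1)] that(2)] .
  have line: "((\<lambda>t. g (p + t *\<^sub>R z)) has_vector_derivative frechet_derivative g (at (p + t *\<^sub>R z)) z) (at t within S)"
    if "smooth_on g UNIV" for g :: "'a \<Rightarrow> complex" and p z t S
  proof -
    have "(g has_derivative frechet_derivative g (at (p + t *\<^sub>R z))) (at (p + t *\<^sub>R z))"
      using smooth_on_differentiable[OF that] frechet_derivative_works by blast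
    moreover have "((\<lambda>t. p + t *\<^sub>R z) has_derivative (\<lambda>s. s *\<^sub>R z)) (at t within S)"
      by (auto intro!: derivative_eq_intros)
    ultimately have "((\<lambda>t. g (p + t *\<^sub>R z)) has_derivative (\<lambda>s. frechet_derivative g (at (p + t *\<^sub>R z)) (s *\<^sub>R z))) (at t within S)"
      by (rule has_derivative_compose[rotated])
    then show ?thesis unfolding has_vector_derivative_def
      using linear_frechet_derivative[OF smooth_on_differentiable[OF that]] by (simp add: linear_scale)
  qed
  have key: "integral {0..s} (\<lambda>r. DD v w (x + r *\<^sub>R v)) = D w (x + s *\<^sub>R v) - D w x" if s: "0 \<le> s" for s
  proof -
    \<comment> \<open>By the fundamental theorem \<open>F\<close> is a difference of values of
      \<open>f\<close>. Its derivative at \<open>0\<close> is computed from this and, independently,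
      under the integral.\<close>
    define F where "F t = integral (cbox 0 s) (\<lambda>r. D v (x + t *\<^sub>R w + r *\<^sub>R v))" for t
    have F: "F t = f (x + t *\<^sub>R w + s *\<^sub>R v) - f (x + t *\<^sub>R w)" for t
    proof -
      have "((\<lambda>r. D v (x + t *\<^sub>R w + r *\<^sub>R v)) has_integral
          f (x + t *\<^sub>R w + s *\<^sub>R v) - f (x + t *\<^sub>R w + 0 *\<^sub>R v)) {0..s}"
        using s line[OF f] unfolding D_def by (intro fundamental_theorem_of_calculus) auto
      then show ?thesis unfolding F_def by (simp add: integral_unique)
    qed
    have "((\<lambda>t. integral (cbox 0 s) (\<lambda>r. D v (x + t *\<^sub>R w + r *\<^sub>R v))) has_vector_derivative
        integral (cbox 0 s) (\<lambda>r. DD v w (x + 0 *\<^sub>R w + r *\<^sub>R v))) (at 0 within UNIV)"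
    proof (rule leibniz_rule_vector_derivative[where fx = "\<lambda>t r. DD v w (x + t *\<^sub>R w + r *\<^sub>R v)"])
      show "((\<lambda>t. D v (x + t *\<^sub>R w + r *\<^sub>R v)) has_vector_derivative DD v w (x + t *\<^sub>R w + r *\<^sub>R v)) (at t within UNIV)" for t r
        using line[OF sm[OF v], of "x + r *\<^sub>R v" w t] unfolding DD_def by (simp add: add_ac)
      show "(\<lambda>r. D v (x + t *\<^sub>R w + r *\<^sub>R v)) integrable_on cbox 0 s" for t
        by (intro integrable_continuous continuous_on_compose2[OF smooth_on_continuous[OF sm[OF v], of UNIV]])
          (auto intro!: continuous_intros)
      show "continuous_on (UNIV \<times> cbox 0 s) (\<lambda>(t, r). DD v w (x + t *\<^sub>R w + r *\<^sub>R v))"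
        unfolding split_beta
        by (intro continuous_on_compose2[OF smooth_on_continuous[OF smm[OF v w], of UNIV]])
          (auto intro!: continuous_intros)
    qed auto
    then have "(F has_vector_derivative integral {0..s} (\<lambda>r. DD v w (x + r *\<^sub>R v))) (at 0)"
      unfolding F_def by simp
    moreover have "(F has_vector_derivative (D w (x + s *\<^sub>R v) - D w x)) (at 0)"
    proof -
      have "((\<lambda>t. f ((x + s *\<^sub>R v) + t *\<^sub>R w) - f (x + t *\<^sub>R w)) has_vector_derivative
          (D w ((x + s *\<^sub>R v) + 0 *\<^sub>R w) - D w (x + 0 *\<^sub>R w))) (at 0)"
        unfolding D_def by (intro has_vector_derivative_diff line[OF f])
      then show ?thesis unfolding F by (simp add: add_ac)
    qed
    ultimately show ?thesis by (rule vector_derivative_unique_at)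
  qed
  have "((\<lambda>s. integral {0..s} (\<lambda>r. DD v w (x + r *\<^sub>R v))) has_vector_derivative DD v w (x + 0 *\<^sub>R v)) (at 0 within {0..1})"
    by (intro integral_has_vector_derivative continuous_on_compose2[OF smooth_on_continuous[OF smm[OF v w], of UNIV]])
      (auto intro!: continuous_intros)
  moreover have "((\<lambda>s. D w (x + s *\<^sub>R v) - D w x) has_vector_derivative (DD w v (x + 0 *\<^sub>R v) - 0)) (at 0 within {0..1})"
    unfolding DD_def by (intro has_vector_derivative_diff line[OF sm[OF w]] has_vector_derivative_const)
  then have "((\<lambda>s. integral {0..s} (\<lambda>r. DD v w (x + r *\<^sub>R v))) has_vector_derivative (DD w v (x + 0 *\<^sub>R v) - 0)) (at 0 within {0..1})"
    by (rule has_vector_derivative_transform[rotated 2]) (auto simp: key)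
  ultimately have "DD v w (x + 0 *\<^sub>R v) = DD w v (x + 0 *\<^sub>R v) - 0"
    by (intro vector_derivative_unique_within[of 0 "{0..1}"]) (auto simp: trivial_limit_within islimpt_greaterThanLessThan1)
  then show ?thesis unfolding DD_def D_def by simp
qed

text \<open>Translation does not change the integral of \<open>g\<close>, so every difference
  quotient has integral zero; dominated convergence passes to the derivative.\<close>

lemma integral_directional_derivative:
  fixes g :: "'a::euclidean_space \<Rightarrow> complex"
  assumes diff: "\<And>x. g differentiable (at x)"
    and cont: "continuous_on UNIV (\<lambda>x. frechet_derivative g (at x) v)"
    and supp: "compact K" "\<And>x. x \<notin> K \<Longrightarrow> g x = 0"
  shows "(LINT x|lborel. frechet_derivative g (at x) v) = 0"
proof -
  define D where "D x = frechet_derivative g (at x) v" for x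
  have gc: "continuous_on UNIV g"
    using diff differentiable_imp_continuous_within by (auto simp: continuous_on_eq_continuous_within)
  have gm[measurable]: "g \<in> borel_measurable borel" by (rule borel_measurable_continuous_onI[OF gc])
  have line: "((\<lambda>t. g (p + t *\<^sub>R v)) has_vector_derivative D (p + t *\<^sub>R v)) (at t within S)" for p t S
  proof -
    have "(g has_derivative frechet_derivative g (at (p + t *\<^sub>R v))) (at (p + t *\<^sub>R v))"
      using diff frechet_derivative_works by blast
    moreover have "((\<lambda>t. p + t *\<^sub>R v) has_derivative (\<lambda>s. s *\<^sub>R v)) (at t within S)"
      by (auto intro!: derivative_eq_intros)
    ultimately have "((\<lambda>t. g (p + t *\<^sub>R v)) has_derivative (\<lambda>s. frechet_derivative g (at (p + t *\<^sub>R v)) (s *\<^sub>R v))) (at t within S)"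
      by (rule has_derivative_compose[rotated])
    then show ?thesis unfolding has_vector_derivative_def D_def
      using linear_frechet_derivative[OF diff] by (simp add: linear_scale)
  qed
  \<comment> \<open>All points from which a step of length at most \<open>1\<close> along
    \<open>v\<close> can reach \<open>K\<close>. Off this set the difference quotients
    vanish.\<close>
  define K' where "K' = (\<lambda>(x, t). x - t *\<^sub>R v) ` (K \<times> {0..1::real})"
  have K': "compact K'" unfolding K'_def
    by (intro compact_continuous_image compact_Times supp(1)) (auto simp: split_beta intro!: continuous_intros)
  have KK': "x + t *\<^sub>R v \<notin> K" if "x \<notin> K'" "0 \<le> t" "t \<le> 1" for x t
  proof
    assume "x + t *\<^sub>R v \<in> K"
    then have "x \<in> K'" unfolding K'_def using that by (intro image_eqI[of _ _ "(x + t *\<^sub>R v, t)"]) auto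
    then show False using that by simp
  qed
  define q where "q m x = real (Suc m) *\<^sub>R (g (x + (1 / real (Suc m)) *\<^sub>R v) - g x)" for m x
  \<comment> \<open>The region swept by such steps; the bound \<open>M\<close> of the derivative on
    it dominates the difference quotients by the mean value inequality.\<close>
  define L where "L = (\<lambda>(x, t). x + t *\<^sub>R v) ` (K' \<times> {0..1::real})"
  have "compact L" unfolding L_def
    by (intro compact_continuous_image compact_Times K') (auto simp: split_beta intro!: continuous_intros)
  then have "bounded (D ` L)" 
    by (intro compact_imp_bounded compact_continuous_image continuous_on_subset[OF cont[folded D_def]]) auto
  then obtain M where M: "\<And>y. y \<in> L \<Longrightarrow> norm (D y) \<le> M" by (auto simp: bounded_iff)
  have gint: "integrable lborel g"
  proof -
    have "integrable lborel (\<lambda>x. indicator K x *\<^sub>R g x)"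
      by (rule borel_integrable_compact[OF supp(1)]) (rule continuous_on_subset[OF gc], simp)
    moreover have "(\<lambda>x. indicator K x *\<^sub>R g x) = g" using supp(2) by (auto simp: indicator_def)
    ultimately show ?thesis by simp
  qed
  have tr: "(LINT x|lborel. g (x + w)) = (LINT x|lborel. g x)" and ti: "integrable lborel (\<lambda>x. g (x + w))" for w
  proof -
    have "(LINT x|distr lborel borel ((+) w). g x) = (LINT x|lborel. g (w + x))"
      by (rule integral_distr) auto
    then show "(LINT x|lborel. g (x + w)) = (LINT x|lborel. g x)"
      by (simp add: lborel_distr_plus add.commute)
    have "integrable (distr lborel borel ((+) w)) g = integrable lborel (\<lambda>x. g (w + x))"
      by (rule integrable_distr_eq) auto
    then show "integrable lborel (\<lambda>x. g (x + w))" using gint by (simp add: lborel_distr_plus add.commute)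
  qed
  have q0: "(LINT x|lborel. q m x) = 0" for m
    unfolding q_def using tr ti gint by simp
  have "(\<lambda>m. LINT x|lborel. q m x) \<longlonglongrightarrow> (LINT x|lborel. D x)"
  proof (rule integral_dominated_convergence[where w = "\<lambda>x. M * indicator K' x"])
    show "D \<in> borel_measurable lborel" using borel_measurable_continuous_onI[OF cont] by (simp add: D_def[abs_def])
    show "q m \<in> borel_measurable lborel" for m unfolding q_def by measurable
    show "integrable lborel (\<lambda>x. M * indicator K' x)"
      using K' by (intro integrable_mult_right integrable_real_indicator)
        (use emeasure_bounded_finite[OF compact_imp_bounded[OF K']] in \<open>auto simp: compact_imp_closed intro: borel_closed\<close>)
    show "AE x in lborel. (\<lambda>m. q m x) \<longlonglongrightarrow> D x"
    proof (rule AE_I2)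
      fix x
      have "((\<lambda>t. g (x + t *\<^sub>R v)) has_vector_derivative D x) (at 0)" using line[of x 0 UNIV] by simp
      then have "((\<lambda>h. norm (g (x + h *\<^sub>R v) - g x - h *\<^sub>R D x) / norm h) \<longlongrightarrow> 0) (at 0)"
        unfolding has_vector_derivative_def has_derivative_at by simp
      moreover have "norm (g (x + h *\<^sub>R v) - g x - h *\<^sub>R D x) / norm h
          = norm ((1 / h) *\<^sub>R (g (x + h *\<^sub>R v) - g x) - D x)" if "h \<noteq> 0" for h
      proof -
        have "(1 / h) *\<^sub>R (g (x + h *\<^sub>R v) - g x) - D x = (1 / h) *\<^sub>R (g (x + h *\<^sub>R v) - g x - h *\<^sub>R D x)"
          using that by (simp add: scaleR_diff_right)
        then show ?thesis by (simp only: norm_scaleR) (simp add: divide_simps)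
      qed
      ultimately have "((\<lambda>h. norm ((1 / h) *\<^sub>R (g (x + h *\<^sub>R v) - g x) - D x)) \<longlongrightarrow> 0) (at 0)"
        by (elim Lim_transform_eventually) (auto simp: eventually_at intro!: exI[of _ 1])
      then have "((\<lambda>h. (1 / h) *\<^sub>R (g (x + h *\<^sub>R v) - g x)) \<longlongrightarrow> D x) (at 0)"
        by - (rule LIM_zero_cancel, rule tendsto_norm_zero_cancel)
      moreover have "filterlim (\<lambda>m. 1 / real (Suc m)) (at 0) sequentially"
        unfolding filterlim_at using LIMSEQ_inverse_real_of_nat by (auto simp: inverse_eq_divide)
      ultimately have "(\<lambda>m. (1 / (1 / real (Suc m))) *\<^sub>R (g (x + (1 / real (Suc m)) *\<^sub>R v) - g x)) \<longlonglongrightarrow> D x"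
        by (rule filterlim_compose)
      then show "(\<lambda>m. q m x) \<longlonglongrightarrow> D x" unfolding q_def by simp
    qed
    show "AE x in lborel. norm (q m x) \<le> M * indicator K' x" for m
    proof (rule AE_I2)
      fix x
      define h where "h = 1 / real (Suc m)"
      have h: "h > 0" "h \<le> 1" "real (Suc m) = 1 / h" unfolding h_def by auto
      show "norm (q m x) \<le> M * indicator K' x"
      proof (cases "x \<in> K'")
        case False
        then have "g (x + h *\<^sub>R v) = 0" "g x = 0"
          using KK'[OF False, of h] KK'[OF False, of 0] h supp(2) by auto
        then show ?thesis using False unfolding q_def h_def by simp
      next
        case True
        have "norm (g (x + h *\<^sub>R v) - g (x + 0 *\<^sub>R v)) \<le> M * norm (h - 0)"
        proof (rule differentiable_bound[where f' = "\<lambda>t s. s *\<^sub>R D (x + t *\<^sub>R v)" and S = "{0..h}"])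
          show "((\<lambda>t. g (x + t *\<^sub>R v)) has_derivative (\<lambda>s. s *\<^sub>R D (x + t *\<^sub>R v))) (at t within {0..h})" for t
            using line[of x t "{0..h}"] unfolding has_vector_derivative_def .
          show "onorm (\<lambda>s. s *\<^sub>R D (x + t *\<^sub>R v)) \<le> M" if "t \<in> {0..h}" for t
          proof (rule onorm_le)
            have "norm (D (x + t *\<^sub>R v)) \<le> M"
              using that True h by (intro M) (auto simp: L_def intro!: image_eqI[of _ _ "(x, t)"])
            then show "norm (s *\<^sub>R D (x + t *\<^sub>R v)) \<le> M * norm s" for s
              by (simp add: mult.commute[of M] mult_left_mono)
          qed
        qed (use h in auto)
        then have "norm (g (x + h *\<^sub>R v) - g x) \<le> M * h" using h by simp
        then show ?thesis using True h unfolding q_def h_def[symmetric] h(3) norm_scaleR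
          by (simp add: pos_divide_le_eq)
      qed
    qed
  qed
  then show ?thesis unfolding q0 D_def by (simp add: LIMSEQ_const_iff)
qed

subsection \<open>Cutoff functions\<close>

text \<open>\<open>m * t - 1\<close> is positive only at distance \<open>t > 1 / m\<close> from a
  face, so the support stays inside the open box, while the values tend to \<open>1\<close> there as
  \<open>m\<close> grows. For \<open>m = 0\<close> the function vanishes.\<close>

definition box_bump :: "'a::euclidean_space \<Rightarrow> 'a \<Rightarrow> nat \<Rightarrow> 'a \<Rightarrow> real" where
  "box_bump a b m x = (\<Prod>i\<in>Basis. flat 0 (real m * ((x - a) \<bullet> i) - 1) * flat 0 (real m * ((b - x) \<bullet> i) - 1))"

lemma box_bump_nonneg: "0 \<le> box_bump a b m x"
  unfolding box_bump_def by (intro prod_nonneg mult_nonneg_nonneg flat_nonneg)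

lemma box_bump_le: "box_bump a b m x \<le> 1"
  unfolding box_bump_def
  by (intro prod_le_1 conjI mult_nonneg_nonneg flat_nonneg mult_le_one flat_0_le)

lemma smooth_alg_box_bump: "smooth_alg (\<lambda>x. complex_of_real (box_bump a b m x))"
proof -
  have "smooth_alg (\<lambda>x. \<Prod>i\<in>Basis. complex_of_real (flat 0 (x \<bullet> (real m *\<^sub>R i) + (- (real m * (a \<bullet> i)) - 1))) *
      complex_of_real (flat 0 (x \<bullet> (- real m *\<^sub>R i) + (real m * (b \<bullet> i) - 1))))"
    by (intro smooth_alg_prod smooth_alg.intros finite_Basis)
  then show ?thesis unfolding box_bump_def
    by (simp add: inner_diff_left right_diff_distrib algebra_simps)
qed

lemma box_bump_support:
  assumes "box_bump a b m x \<noteq> 0"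
  shows "x \<in> cbox (a + (1 / real m) *\<^sub>R One) (b - (1 / real m) *\<^sub>R One)" and "m > 0"
proof -
  have *: "real m * ((x - a) \<bullet> i) - 1 > 0" "real m * ((b - x) \<bullet> i) - 1 > 0" if "i \<in> Basis" for i
  proof -
    have "flat 0 (real m * ((x - a) \<bullet> i) - 1) \<noteq> 0" "flat 0 (real m * ((b - x) \<bullet> i) - 1) \<noteq> 0"
      using assms that unfolding box_bump_def by auto
    then show "real m * ((x - a) \<bullet> i) - 1 > 0" "real m * ((b - x) \<bullet> i) - 1 > 0"
      unfolding flat_def by (auto split: if_splits)
  qed
  show m: "m > 0" using *(1)[OF SOME_Basis] by (cases m) auto
  show "x \<in> cbox (a + (1 / real m) *\<^sub>R One) (b - (1 / real m) *\<^sub>R One)"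
    unfolding mem_box
  proof (intro ballI conjI)
    fix i :: 'a assume i: "i \<in> Basis"
    show "(a + (1 / real m) *\<^sub>R One) \<bullet> i \<le> x \<bullet> i" "x \<bullet> i \<le> (b - (1 / real m) *\<^sub>R One) \<bullet> i"
      using *[OF i] m i by (auto simp: inner_diff_left inner_add_left field_simps)
  qed
qed

lemma box_bump_tendsto:
  assumes "x \<in> box a b"
  shows "(\<lambda>m. box_bump a b m x) \<longlonglongrightarrow> 1"
proof -
  have 1: "(\<lambda>m. flat 0 (real m * t - 1)) \<longlonglongrightarrow> 1" if "t > 0" for t
  proof -
    have lim: "filterlim (\<lambda>m. real m * t - 1) at_top sequentially"
      unfolding filterlim_at_top
    proof
      fix Z :: real
      have "Z \<le> real m * t - 1" if "m \<ge> nat \<lceil>(Z + 1) / t\<rceil>" for m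
      proof -
        have "(Z + 1) / t \<le> real m" using that by linarith
        then show ?thesis using \<open>t > 0\<close> by (simp add: pos_divide_le_eq)
      qed
      then show "\<forall>\<^sub>F m in sequentially. Z \<le> real m * t - 1"
        unfolding eventually_sequentially by blast
    qed
    have "((\<lambda>s. exp (- inverse s)) \<longlongrightarrow> exp (- 0)) (at_top :: real filter)"
      by (intro tendsto_exp tendsto_minus tendsto_inverse_0_at_top filterlim_ident)
    then have "((\<lambda>s. exp (- inverse s)) \<longlongrightarrow> 1) (at_top :: real filter)" by simp
    then have "(flat 0 \<longlongrightarrow> 1) at_top"
      by (rule Lim_transform_eventually) (auto simp: flat_def intro!: eventually_mono[OF eventually_gt_at_top[of 0]])
    then show ?thesis using lim by (rule filterlim_compose)
  qed
  have "(\<lambda>m. box_bump a b m x) \<longlonglongrightarrow> (\<Prod>i\<in>(Basis :: 'a set). 1 * 1)"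
    unfolding box_bump_def
  proof (rule tendsto_prod)
    fix i :: 'a assume "i \<in> Basis"
    then show "(\<lambda>m. flat 0 (real m * ((x - a) \<bullet> i) - 1) * flat 0 (real m * ((b - x) \<bullet> i) - 1)) \<longlonglongrightarrow> 1 * 1"
      by (intro tendsto_mult 1) (use assms in \<open>auto simp: mem_box inner_diff_left\<close>)
  qed
  then show ?thesis by simp
qed

lemma open_as_boxes:
  fixes U :: "'a::euclidean_space set"
  assumes "open U"
  obtains a b :: "nat \<Rightarrow> 'a" where "U = (\<Union>i. box (a i) (b i))"
proof -
  obtain \<D> where D: "countable \<D>" "\<D> \<subseteq> Pow U" "\<And>X. X \<in> \<D> \<Longrightarrow> \<exists>a b. X = box a b" "\<Union>\<D> = U"
    using open_countable_Union_open_box[OF assms] by metis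
  \<comment> \<open>The empty box is added so that the enumerated family is nonempty even when
    \<open>U\<close> is empty.\<close>
  define f where "f = from_nat_into (insert {} \<D>)"
  have f: "range f = insert {} \<D>" unfolding f_def using D(1) by (intro range_from_nat_into) auto
  have "\<exists>a b. f i = box a b" for i
  proof (cases "f i = {}")
    case True
    then show ?thesis by (intro exI[of _ 0]) simp
  next
    case False
    then show ?thesis using D(3) f by (metis insertE rangeI)
  qed
  then obtain a b where "\<And>i. f i = box (a i) (b i)" by metis
  then have "U = (\<Union>i. box (a i) (b i))" using D(4) f by auto
  then show thesis by (rule that)
qed

text \<open>\<open>1 - \<Prod>(1 - bump)\<close> is a smooth union of bumps: it vanishes where all
  of them do and is near \<open>1\<close> where one of them is. Only sums and products occur, so it
  stays in \<open>smooth_alg\<close>.\<close>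

lemma cutoff_exists:
  fixes U :: "'a::euclidean_space set"
  assumes "open U"
  obtains \<eta> :: "nat \<Rightarrow> 'a \<Rightarrow> real" and K :: "nat \<Rightarrow> 'a set" where
    "\<And>m. smooth_alg (\<lambda>x. complex_of_real (\<eta> m x))" "\<And>m x. 0 \<le> \<eta> m x" "\<And>m x. \<eta> m x \<le> 1"
    "\<And>m. compact (K m)" "\<And>m. K m \<subseteq> U" "\<And>m x. x \<notin> K m \<Longrightarrow> \<eta> m x = 0"
    "\<And>x. x \<in> U \<Longrightarrow> (\<lambda>m. \<eta> m x) \<longlonglongrightarrow> 1"
proof -
  obtain a b :: "nat \<Rightarrow> 'a" where U: "U = (\<Union>i. box (a i) (b i))" by (rule open_as_boxes[OF assms])
  define \<eta> where "\<eta> m x = 1 - (\<Prod>i<m. 1 - box_bump (a i) (b i) m x)" for m x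
  define c where "c i m = cbox (a i + (1 / real m) *\<^sub>R One) (b i - (1 / real m) *\<^sub>R One)" for i m
  define K where "K m = (if m = 0 then {} else \<Union>i<m. c i m)" for m
  have pr: "0 \<le> (\<Prod>i\<in>I. 1 - box_bump (a i) (b i) m x)" "(\<Prod>i\<in>I. 1 - box_bump (a i) (b i) m x) \<le> 1" for I m x
    using box_bump_nonneg box_bump_le by (auto intro!: prod_nonneg prod_le_1)
  show thesis
  proof (rule that)
    show "smooth_alg (\<lambda>x. complex_of_real (\<eta> m x))" for m
    proof -
      have "smooth_alg (\<lambda>x. 1 + (- 1) * (\<Prod>i<m. 1 + (- 1) * complex_of_real (box_bump (a i) (b i) m x)))"
        by (intro smooth_alg_prod smooth_alg.add smooth_alg.mult smooth_alg.const smooth_alg_box_bump finite_lessThan)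
      then show ?thesis unfolding \<eta>_def by simp
    qed
    show "0 \<le> \<eta> m x" "\<eta> m x \<le> 1" for m x unfolding \<eta>_def using pr by auto
    show "compact (K m)" for m unfolding K_def c_def by (auto intro!: compact_UN)
    show "K m \<subseteq> U" for m
    proof
      fix x assume "x \<in> K m"
      then obtain i where i: "x \<in> c i m" "m > 0" unfolding K_def by (auto split: if_splits)
      have "x \<in> box (a i) (b i)" unfolding mem_box
      proof
        fix k :: 'a assume k: "k \<in> Basis"
        then have "(a i + (1 / real m) *\<^sub>R One) \<bullet> k \<le> x \<bullet> k" "x \<bullet> k \<le> (b i - (1 / real m) *\<^sub>R One) \<bullet> k"
          using i(1) unfolding c_def mem_box by auto
        then have "a i \<bullet> k + 1 / real m \<le> x \<bullet> k" "x \<bullet> k \<le> b i \<bullet> k - 1 / real m"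
          using k by (simp_all add: inner_diff_left inner_add_left)
        moreover have "1 / real m > 0" using \<open>m > 0\<close> by simp
        ultimately show "a i \<bullet> k < x \<bullet> k \<and> x \<bullet> k < b i \<bullet> k" by linarith
      qed
      then show "x \<in> U" unfolding U by blast
    qed
    show "\<eta> m x = 0" if "x \<notin> K m" for m x
    proof -
      have "box_bump (a i) (b i) m x = 0" if "i < m" for i
        using box_bump_support[of "a i" "b i" m x] \<open>x \<notin> K m\<close> that unfolding K_def c_def by auto
      then show ?thesis unfolding \<eta>_def by simp
    qed
    show "(\<lambda>m. \<eta> m x) \<longlonglongrightarrow> 1" if "x \<in> U" for x
    proof -
      obtain i where i: "x \<in> box (a i) (b i)" using \<open>x \<in> U\<close> unfolding U by blast
      have le: "norm (\<eta> m x - 1) \<le> 1 - box_bump (a i) (b i) m x" if "m > i" for m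
      proof -
        have "(\<Prod>j<m. 1 - box_bump (a j) (b j) m x)
            = (1 - box_bump (a i) (b i) m x) * (\<Prod>j\<in>{..<m} - {i}. 1 - box_bump (a j) (b j) m x)"
          using that by (intro prod.remove) auto
        also have "\<dots> \<le> (1 - box_bump (a i) (b i) m x) * 1"
          using box_bump_le[of "a i" "b i" m x] pr by (intro mult_left_mono) auto
        finally show ?thesis unfolding \<eta>_def using pr(1)[of m x "{..<m}"] by simp
      qed
      have ev: "\<forall>\<^sub>F m in sequentially. norm (\<eta> m x - 1) \<le> 1 - box_bump (a i) (b i) m x"
        by (rule eventually_mono[OF eventually_gt_at_top[of i]]) (rule le)
      have "(\<lambda>m. 1 - box_bump (a i) (b i) m x) \<longlonglongrightarrow> 1 - 1"
        by (intro tendsto_intros box_bump_tendsto i)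
      then show ?thesis
        using Lim_null_comparison[OF ev] by - (rule LIM_zero_cancel, simp)
    qed
  qed
qed

section \<open>Functions determined by their integrals over open sets\<close>

lemma sigma_finite_lebesgue: "sigma_finite_measure (lebesgue :: 'a::euclidean_space measure)"
proof
  obtain A :: "'a set set" where A: "countable A" "A \<subseteq> sets lborel" "\<Union>A = space lborel" "\<forall>a\<in>A. emeasure lborel a \<noteq> \<infinity>"
    using lborel.sigma_finite_countable by blast
  then show "\<exists>A. countable A \<and> A \<subseteq> sets lebesgue \<and> \<Union>A = space (lebesgue :: 'a measure) \<and> (\<forall>a\<in>A. emeasure lebesgue a \<noteq> \<infinity>)"
    by (intro exI[of _ A]) (auto simp: emeasure_completion)
qed

text \<open>The open subsets of \<open>\<Omega>\<close> are stable under intersection and generate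
  its Borel sets, so the countably additive set function with density \<open>w\<close> vanishes on
  all of these; a density with vanishing integrals is zero.\<close>

lemma AE_zero_of_open:
  fixes w :: "'a::euclidean_space \<Rightarrow> 'b::{second_countable_topology, banach}"
  assumes w: "integrable lebesgue w" and \<Omega>: "open \<Omega>" and off: "\<And>x. x \<notin> \<Omega> \<Longrightarrow> w x = 0"
    and zero: "\<And>U. open U \<Longrightarrow> U \<subseteq> \<Omega> \<Longrightarrow> (LINT x:U|lebesgue. w x) = 0"
  shows "AE x in lebesgue. w x = 0"
proof (rule sigma_finite_measure.density_zero[OF sigma_finite_lebesgue w])
  define G where "G = {U. open U \<and> U \<subseteq> \<Omega>}"
  have si: "set_integrable lebesgue A w" if "A \<in> sets lebesgue" for A
    unfolding set_integrable_def using integrable_mult_indicator[OF that w] .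
  have G: "A \<in> sets borel \<and> A \<subseteq> \<Omega> \<and> (LINT x:A|lebesgue. w x) = 0" if "A \<in> sigma_sets \<Omega> G" for A
  proof (rule sigma_sets_induct_disjoint[of G \<Omega> A])
    show "Int_stable G" unfolding G_def Int_stable_def by auto
    show "G \<subseteq> Pow \<Omega>" unfolding G_def by auto
    show "A \<in> sigma_sets \<Omega> G" by fact
    show "B \<in> sets borel \<and> B \<subseteq> \<Omega> \<and> (LINT x:B|lebesgue. w x) = 0" if "B \<in> G" for B
      using that zero unfolding G_def by auto
    show "{} \<in> sets borel \<and> {} \<subseteq> \<Omega> \<and> (LINT x:{}|lebesgue. w x) = 0" by (simp add: set_lebesgue_integral_def)
  next
    fix B assume B: "B \<in> sets borel \<and> B \<subseteq> \<Omega> \<and> (LINT x:B|lebesgue. w x) = 0"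
    have O: "\<Omega> \<in> sets borel" using \<Omega> by simp
    have "(LINT x:(\<Omega> - B) \<union> B|lebesgue. w x) = (LINT x:\<Omega> - B|lebesgue. w x) + (LINT x:B|lebesgue. w x)"
      using B O by (intro set_integral_Un si) auto
    moreover have "(\<Omega> - B) \<union> B = \<Omega>" using B by auto
    ultimately show "\<Omega> - B \<in> sets borel \<and> \<Omega> - B \<subseteq> \<Omega> \<and> (LINT x:\<Omega> - B|lebesgue. w x) = 0"
      using B O zero[OF \<Omega>] by auto
  next
    fix B :: "nat \<Rightarrow> 'a set"
    assume B: "disjoint_family B" "\<And>i. B i \<in> sets borel \<and> B i \<subseteq> \<Omega> \<and> (LINT x:B i|lebesgue. w x) = 0"
    then have "(\<Union>i. B i) \<in> sets borel" by auto
    moreover have "(LINT x:(\<Union>i. B i)|lebesgue. w x) = (\<Sum>i. LINT x:B i|lebesgue. w x)"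
      using B \<open>(\<Union>i. B i) \<in> sets borel\<close> by (intro lebesgue_integral_countable_add si) (auto simp: disjoint_family_on_def)
    ultimately show "(\<Union>i. B i) \<in> sets borel \<and> (\<Union>i. B i) \<subseteq> \<Omega> \<and> (LINT x:(\<Union>i. B i)|lebesgue. w x) = 0"
      using B by auto
  qed
  have sig: "B \<inter> \<Omega> \<in> sigma_sets \<Omega> G" if "B \<in> sets borel" for B
  proof -
    have "B \<in> sigma_sets UNIV {S. open S}" using that unfolding borel_def by simp
    then show ?thesis
    proof induction
      case (Basic a)
      then show ?case using \<Omega> unfolding G_def by (intro sigma_sets.Basic) auto
    next
      case Empty
      then show ?case by (simp add: sigma_sets.Empty)
    next
      case (Compl a)
      have "(UNIV - a) \<inter> \<Omega> = \<Omega> - a \<inter> \<Omega>" by auto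
      then show ?case using sigma_sets.Compl[OF Compl.IH] by simp
    next
      case (Union a)
      have "(\<Union>i. a i) \<inter> \<Omega> = (\<Union>i. a i \<inter> \<Omega>)" by auto
      then show ?case using sigma_sets.Union[of "\<lambda>i. a i \<inter> \<Omega>" \<Omega> G] Union.IH by simp
    qed
  qed
  fix A :: "'a set" assume "A \<in> sets lebesgue"
  then obtain S N N' where A: "A = S \<union> N" "N \<subseteq> N'" "N' \<in> null_sets lborel" "S \<in> sets lborel"
    by (rule sets_completionE)
  \<comment> \<open>A Lebesgue set is Borel up to a null set, and \<open>w\<close> vanishes off
    \<open>\<Omega>\<close>.\<close>
  have "(LINT x:A|lebesgue. w x) = (LINT x:S \<inter> \<Omega>|lebesgue. w x)"
    unfolding set_lebesgue_integral_def
  proof (rule integral_cong_AE)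
    show "(\<lambda>x. indicat_real A x *\<^sub>R w x) \<in> borel_measurable lebesgue"
      using si[OF \<open>A \<in> sets lebesgue\<close>] unfolding set_integrable_def by simp
    show "(\<lambda>x. indicat_real (S \<inter> \<Omega>) x *\<^sub>R w x) \<in> borel_measurable lebesgue"
      using si[of "S \<inter> \<Omega>"] A(4) \<Omega> unfolding set_integrable_def by auto
    have "AE x in lebesgue. x \<notin> N'"
      using A(3) by (intro AE_not_in) (rule null_sets_completionI)
    then show "AE x in lebesgue. indicat_real A x *\<^sub>R w x = indicat_real (S \<inter> \<Omega>) x *\<^sub>R w x"
      by eventually_elim (use A(1,2) off in \<open>auto simp: indicator_def\<close>)
  qed
  also have "\<dots> = 0" using G[OF sig] A(4) by simp
  finally show "(LINT x:A|lebesgue. w x) = 0" .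
qed

subsection \<open>Test functions on a domain\<close>

lemma axis_Basis_complex: "axis j 1 \<in> (Basis :: (complex^'n) set)" "axis j \<i> \<in> (Basis :: (complex^'n) set)"
  by (auto simp: Basis_vec_def Basis_complex_def)

lemma test_functionsI:
  assumes "smooth_on \<phi> UNIV" "compact K" "K \<subseteq> \<Omega>" "\<And>x. x \<notin> K \<Longrightarrow> \<phi> x = 0"
  shows "\<phi> \<in> test_functions \<Omega>"
proof -
  have "closure {z. \<phi> z \<noteq> 0} \<subseteq> K"
    using assms by (intro closure_minimal compact_imp_closed) auto
  then show ?thesis using assms unfolding test_functions_def
    using compact_Int_closed[of K "closure {z. \<phi> z \<noteq> 0}"] by (auto simp: Int_absorb1)
qed

lemma test_functionsE:
  assumes "\<phi> \<in> test_functions \<Omega>"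
  obtains K where "smooth_on \<phi> UNIV" "compact K" "K \<subseteq> \<Omega>" "\<forall>x. x \<notin> K \<longrightarrow> \<phi> x = 0"
    "\<forall>x v. x \<notin> K \<longrightarrow> frechet_derivative \<phi> (at x) v = 0"
proof (rule that[of "closure {z. \<phi> z \<noteq> 0}"])
  have 0: "\<phi> x = 0" if "x \<notin> closure {z. \<phi> z \<noteq> 0}" for x
    using that closure_subset[of "{z. \<phi> z \<noteq> 0}"] by auto
  then show "\<forall>x. x \<notin> closure {z. \<phi> z \<noteq> 0} \<longrightarrow> \<phi> x = 0" by blast
  have "frechet_derivative \<phi> (at x) v = 0" if x: "x \<notin> closure {z. \<phi> z \<noteq> 0}" for x v
  proof -
    have "((\<lambda>x. 0) has_derivative (\<lambda>v. 0)) (at x)" by simp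
    then have "(\<phi> has_derivative (\<lambda>v. 0)) (at x)"
    proof (rule has_derivative_transform_within_open)
      show "open (- closure {z. \<phi> z \<noteq> 0})" "x \<in> - closure {z. \<phi> z \<noteq> 0}" using x by auto
      show "0 = \<phi> y" if "y \<in> - closure {z. \<phi> z \<noteq> 0}" for y using 0[of y] that by simp
    qed
    from frechet_derivative_at[OF this, symmetric] show ?thesis by simp
  qed
  then show "\<forall>x v. x \<notin> closure {z. \<phi> z \<noteq> 0} \<longrightarrow> frechet_derivative \<phi> (at x) v = 0" by blast
qed (use assms in \<open>auto simp: test_functions_def\<close>)

lemma test_functions_smooth: "\<phi> \<in> test_functions \<Omega> \<Longrightarrow> smooth_on \<phi> UNIV"
  unfolding test_functions_def by simp

lemma dzbar_smooth: "smooth_on \<phi> UNIV \<Longrightarrow> smooth_on (dzbar j \<phi>) UNIV"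
proof -
  assume \<phi>: "smooth_on \<phi> UNIV"
  have "smooth_on (\<lambda>p. (1/2) * frechet_derivative \<phi> (at p) (axis j 1) + (\<i>/2) * frechet_derivative \<phi> (at p) (axis j \<i>)) UNIV"
    by (intro smooth_on_add smooth_on_mult_const smooth_on_frechet \<phi> axis_Basis_complex)
  then show ?thesis by (simp add: dzbar_def[abs_def] field_simps)
qed

lemma test_functions_dzbar: "\<phi> \<in> test_functions \<Omega> \<Longrightarrow> dzbar j \<phi> \<in> test_functions \<Omega>"
  by (erule test_functionsE, rule test_functionsI) (auto simp: dzbar_smooth dzbar_def[of j \<phi>])

lemma test_functions_cmult: "\<phi> \<in> test_functions \<Omega> \<Longrightarrow> (\<lambda>z. c * \<phi> z) \<in> test_functions \<Omega>"
  by (erule test_functionsE, rule test_functionsI) (auto simp: smooth_on_mult_const)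

lemma test_functions_measurable: "\<phi> \<in> test_functions \<Omega> \<Longrightarrow> \<phi> \<in> borel_measurable borel"
  by (intro borel_measurable_continuous_onI smooth_on_continuous test_functions_smooth)

lemma test_functions_bounded:
  assumes "\<phi> \<in> test_functions \<Omega>"
  obtains B where "B \<ge> 0" "\<And>x. norm (\<phi> x) \<le> B"
proof -
  obtain K where "smooth_on \<phi> UNIV" "compact K" "K \<subseteq> \<Omega>" "\<forall>x. x \<notin> K \<longrightarrow> \<phi> x = 0"
    "\<forall>x v. x \<notin> K \<longrightarrow> frechet_derivative \<phi> (at x) v = 0"
    using assms by (rule test_functionsE)
  note K = this(1,2,4)
  have "bounded (\<phi> ` K)" by (intro compact_imp_bounded compact_continuous_image smooth_on_continuous K)
  then obtain B where B: "\<And>x. x \<in> K \<Longrightarrow> norm (\<phi> x) \<le> B" by (auto simp: bounded_iff)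
  show thesis
  proof (rule that)
    show "norm (\<phi> x) \<le> \<bar>B\<bar>" for x
      using B[of x] K(3)[rule_format, of x] by (cases "x \<in> K") auto
  qed simp
qed

lemma test_functions_integrable:
  assumes "\<phi> \<in> test_functions \<Omega>"
  shows "integrable lebesgue \<phi>"
proof -
  obtain K where "smooth_on \<phi> UNIV" "compact K" "K \<subseteq> \<Omega>" "\<forall>x. x \<notin> K \<longrightarrow> \<phi> x = 0"
    "\<forall>x v. x \<notin> K \<longrightarrow> frechet_derivative \<phi> (at x) v = 0"
    using assms by (rule test_functionsE)
  note K = this(1,2,4)
  have "integrable lborel (\<lambda>x. indicator K x *\<^sub>R \<phi> x)"
    by (intro borel_integrable_compact smooth_on_continuous K)
  moreover have "(\<lambda>x. indicator K x *\<^sub>R \<phi> x) = \<phi>" using K(3) by (auto simp: indicator_def)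
  ultimately show ?thesis using test_functions_measurable[OF assms] by (simp add: integrable_completion)
qed

lemma test_functions_sq_int:
  assumes "\<phi> \<in> test_functions \<Omega>"
  shows "sq_int \<phi>"
proof -
  obtain B where B: "B \<ge> 0" "\<And>x. norm (\<phi> x) \<le> B" using test_functions_bounded[OF assms] by blast
  show ?thesis
  proof (rule sq_int_bound)
    show "\<phi> \<in> borel_measurable lebesgue"
      using test_functions_measurable[OF assms] by (intro measurable_completion) simp
    show "integrable lebesgue (\<lambda>x. B * norm (\<phi> x))"
      using test_functions_integrable[OF assms] by simp
    show "(norm (\<phi> x))\<^sup>2 \<le> B * norm (\<phi> x)" for x
      using B by (simp add: power2_eq_square mult_right_mono)
  qed
qed

lemma frechet_derivative_mult_at:
  fixes f g :: "'a::euclidean_space \<Rightarrow> complex"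
  assumes "f differentiable (at x)" "g differentiable (at x)"
  shows "frechet_derivative (\<lambda>z. f z * g z) (at x) v = f x * frechet_derivative g (at x) v + frechet_derivative f (at x) v * g x"
proof -
  have "((\<lambda>z. f z * g z) has_derivative (\<lambda>v. f x * frechet_derivative g (at x) v + frechet_derivative f (at x) v * g x)) (at x)"
    by (intro has_derivative_mult assms[unfolded frechet_derivative_works])
  from frechet_derivative_at[OF this, symmetric] show ?thesis by simp
qed

lemma dzbar_mult:
  assumes "f differentiable (at x)" "g differentiable (at x)"
  shows "dzbar j (\<lambda>z. f z * g z) x = dzbar j f x * g x + f x * dzbar j g x"
  unfolding dzbar_def frechet_derivative_mult_at[OF assms] by (simp add: field_simps)

text \<open>\<open>\<phi>\<close> alone makes the product compactly supported, and the real
  directional derivatives of the product integrate to zero.\<close>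

lemma integral_dzbar_by_parts:
  assumes \<psi>: "smooth_on \<psi> UNIV" and \<phi>: "\<phi> \<in> test_functions \<Omega>"
  shows "(LINT z|lebesgue. \<psi> z * dzbar j \<phi> z) = - (LINT z|lebesgue. dzbar j \<psi> z * \<phi> z)"
proof -
  obtain K where K: "smooth_on \<phi> UNIV" "compact K" "K \<subseteq> \<Omega>" "\<forall>x. x \<notin> K \<longrightarrow> \<phi> x = 0"
    "\<forall>x v. x \<notin> K \<longrightarrow> frechet_derivative \<phi> (at x) v = 0"
    using \<phi> by (rule test_functionsE)
  have diff: "\<psi> differentiable (at x)" "\<phi> differentiable (at x)" for x
    using smooth_on_differentiable \<psi> K(1) by auto
  define g where "g z = \<psi> z * \<phi> z" for z
  have fg: "frechet_derivative g (at x) v = \<psi> x * frechet_derivative \<phi> (at x) v + frechet_derivative \<psi> (at x) v * \<phi> x" for x v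
    unfolding g_def by (rule frechet_derivative_mult_at[OF diff])
  have cf: "continuous_on UNIV (\<lambda>x. frechet_derivative f (at x) v)" if "smooth_on f UNIV" "v \<in> Basis" for f :: "complex^'a \<Rightarrow> complex" and v
    using smooth_on_continuous[OF smooth_on_frechet[OF that]] .
  have cg: "continuous_on UNIV (\<lambda>x. frechet_derivative g (at x) v)" if "v \<in> Basis" for v
    unfolding fg by (intro continuous_intros cf smooth_on_continuous \<psi> K(1) that)
  have zero: "(LINT x|lborel. frechet_derivative g (at x) v) = 0" if "v \<in> Basis" for v
    by (rule integral_directional_derivative[OF _ cg[OF that] K(2)])
      (use diff K(4) in \<open>auto simp: g_def[abs_def] intro!: differentiable_mult\<close>)
  have int: "integrable lborel h" if "continuous_on UNIV h" "\<And>x. x \<notin> K \<Longrightarrow> h x = 0" for h :: "complex^'a \<Rightarrow> complex"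
  proof -
    have "integrable lborel (\<lambda>x. indicator K x *\<^sub>R h x)"
      by (rule borel_integrable_compact[OF K(2)]) (rule continuous_on_subset[OF that(1)], simp)
    moreover have "(\<lambda>x. indicator K x *\<^sub>R h x) = h" using that(2) by (auto simp: indicator_def)
    ultimately show ?thesis by simp
  qed
  have c1: "continuous_on UNIV (\<lambda>z. \<psi> z * dzbar j \<phi> z)" "continuous_on UNIV (\<lambda>z. dzbar j \<psi> z * \<phi> z)"
    by (intro continuous_intros smooth_on_continuous dzbar_smooth \<psi> K(1))+
  have i1: "integrable lborel (\<lambda>z. \<psi> z * dzbar j \<phi> z)" "integrable lborel (\<lambda>z. dzbar j \<psi> z * \<phi> z)"
    by (intro int c1; simp add: K(4,5) dzbar_def[of j \<phi>])+
  have i2: "integrable lborel (\<lambda>x. frechet_derivative g (at x) v)" if "v \<in> Basis" for v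
    by (intro int cg that) (simp add: fg K(4,5))
  have "(LINT z|lborel. \<psi> z * dzbar j \<phi> z) + (LINT z|lborel. dzbar j \<psi> z * \<phi> z)
      = (LINT z|lborel. dzbar j g z)"
    using i1 unfolding g_def dzbar_mult[OF diff] by (simp add: add.commute)
  also have "\<dots> = 0"
    unfolding dzbar_def using zero i2 axis_Basis_complex by simp
  finally have "(LINT z|lborel. \<psi> z * dzbar j \<phi> z) = - (LINT z|lborel. dzbar j \<psi> z * \<phi> z)"
    by (simp add: eq_neg_iff_add_eq_0)
  then show ?thesis
    using c1[THEN borel_measurable_continuous_onI] by (simp add: integral_completion)
qed

text \<open>Cutoffs of an open subset \<open>U\<close> are test functions tending boundedly to its
  indicator, so the integral of \<open>w\<close> over \<open>U\<close> vanishes.\<close>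

lemma test_functions_separate:
  fixes w :: "complex^'n::finite \<Rightarrow> complex"
  assumes w: "integrable lebesgue w" and \<Omega>: "open \<Omega>" and off: "\<And>x. x \<notin> \<Omega> \<Longrightarrow> w x = 0"
    and zero: "\<And>\<phi>. \<phi> \<in> test_functions \<Omega> \<Longrightarrow> (LINT x|lebesgue. w x * \<phi> x) = 0"
  shows "AE x in lebesgue. w x = 0"
proof (rule AE_zero_of_open[OF w \<Omega> off])
  fix U :: "(complex^'n) set" assume U: "open U" "U \<subseteq> \<Omega>"
  obtain \<eta> K where \<eta>: "\<And>m. smooth_alg (\<lambda>x. complex_of_real (\<eta> m x))" "\<And>m x. 0 \<le> \<eta> m x" "\<And>m x. \<eta> m x \<le> 1"
    "\<And>m. compact (K m)" "\<And>m. K m \<subseteq> U" "\<And>m x. x \<notin> K m \<Longrightarrow> \<eta> m x = 0"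
    "\<And>x. x \<in> U \<Longrightarrow> (\<lambda>m. \<eta> m x) \<longlonglongrightarrow> 1"
    using cutoff_exists[OF U(1)] by metis
  have test: "(\<lambda>x. complex_of_real (\<eta> m x)) \<in> test_functions \<Omega>" for m
    by (rule test_functionsI[OF smooth_alg_smooth_on[OF \<eta>(1)] \<eta>(4)[of m] subset_trans[OF \<eta>(5) U(2)]])
      (simp add: \<eta>(6))
  have [measurable]: "w \<in> borel_measurable lebesgue" using w by simp
  have [measurable]: "(\<lambda>x. complex_of_real (\<eta> m x)) \<in> borel_measurable lebesgue" for m
    using test_functions_sq_int[OF test] by (rule sq_int_measurable)
  have "(\<lambda>m. LINT x|lebesgue. w x * complex_of_real (\<eta> m x)) \<longlonglongrightarrow> (LINT x|lebesgue. indicator U x *\<^sub>R w x)"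
  proof (rule integral_dominated_convergence[where w = "\<lambda>x. norm (w x)"])
    show "AE x in lebesgue. (\<lambda>m. w x * complex_of_real (\<eta> m x)) \<longlonglongrightarrow> indicator U x *\<^sub>R w x"
    proof (rule AE_I2)
      fix x
      have "(\<lambda>m. \<eta> m x) \<longlonglongrightarrow> indicator U x"
      proof (cases "x \<in> U")
        case False
        then have "\<eta> m x = 0" for m using subsetD[OF \<eta>(5)[of m], of x] \<eta>(6)[of x m] by fast
        then show ?thesis using False by simp
      qed (use \<eta>(7) in simp)
      then have "(\<lambda>m. w x * complex_of_real (\<eta> m x)) \<longlonglongrightarrow> w x * complex_of_real (indicator U x)"
        by (intro tendsto_intros)
      then show "(\<lambda>m. w x * complex_of_real (\<eta> m x)) \<longlonglongrightarrow> indicator U x *\<^sub>R w x"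
        by (simp add: scaleR_conv_of_real mult.commute)
    qed
    show "AE x in lebesgue. norm (w x * complex_of_real (\<eta> m x)) \<le> norm (w x)" for m
      using \<eta>(2,3) by (intro AE_I2) (simp add: norm_mult mult_left_le)
    show "(\<lambda>x. indicator U x *\<^sub>R w x) \<in> borel_measurable lebesgue"
      using U(1) by (intro borel_measurable_scaleR borel_measurable_indicator) auto
  qed (use w in auto)
  then show "(LINT x:U|lebesgue. w x) = 0"
    unfolding set_lebesgue_integral_def zero[OF test] by (simp add: LIMSEQ_const_iff)
qed

lemma dzbar_symmetric:
  assumes "smooth_on \<phi> UNIV"
  shows "dzbar j (dzbar k \<phi>) x = dzbar k (dzbar j \<phi>) x"
proof -
  define D where "D v y = frechet_derivative \<phi> (at y) v" for v y
  have sm: "(D v has_derivative frechet_derivative (D v) (at x)) (at x)" if "v \<in> Basis" for v x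
    unfolding D_def frechet_derivative_works[symmetric]
    using smooth_on_differentiable[OF smooth_on_frechet[OF assms that]] .
  have d: "frechet_derivative (dzbar k \<phi>) (at x) v = (frechet_derivative (D (axis k 1)) (at x) v + \<i> * frechet_derivative (D (axis k \<i>)) (at x) v) / 2" for k v
  proof -
    have "(dzbar k \<phi> has_derivative (\<lambda>v. (frechet_derivative (D (axis k 1)) (at x) v + \<i> * frechet_derivative (D (axis k \<i>)) (at x) v) / 2)) (at x)"
      unfolding dzbar_def[abs_def] D_def[symmetric]
      by (rule derivative_eq_intros sm axis_Basis_complex refl)+ (auto simp: field_simps)
    from frechet_derivative_at[OF this, symmetric] show ?thesis by simp
  qed
  have s: "frechet_derivative (D v) (at x) w = frechet_derivative (D w) (at x) v" if "v \<in> Basis" "w \<in> Basis" for v w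
    unfolding D_def by (rule frechet_derivative_symmetric[OF assms that])
  show ?thesis
    unfolding dzbar_def[of j "dzbar k \<phi>"] dzbar_def[of k "dzbar j \<phi>"] d
    using s[of "axis j 1" "axis k 1"] s[of "axis j \<i>" "axis k 1"] s[of "axis j 1" "axis k \<i>"] s[of "axis j \<i>" "axis k \<i>"]
    by (simp add: axis_Basis_complex field_simps)
qed

lemma frechet_derivative_cis: "frechet_derivative (\<lambda>x. cis (x \<bullet> w)) (at x) v = cis (x \<bullet> w) * (\<i> * complex_of_real (v \<bullet> w))"
proof -
  have "((\<lambda>x. \<i> * complex_of_real (x \<bullet> w)) has_derivative (\<lambda>v. \<i> * complex_of_real (v \<bullet> w))) (at x)"
    by (auto intro!: derivative_eq_intros)
  from has_derivative_compose[OF this DERIV_exp[unfolded has_field_derivative_def]]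
  have "((\<lambda>x. cis (x \<bullet> w)) has_derivative (\<lambda>v. cis (x \<bullet> w) * (\<i> * complex_of_real (v \<bullet> w)))) (at x)"
    by (simp add: cis_conv_exp)
  from frechet_derivative_at[OF this, symmetric] show ?thesis by simp
qed

text \<open>The directions \<open>1\<close> and \<open>\<i>\<close> of the \<open>j\<close>-th
  coordinate see the real and imaginary part of \<open>w $ j\<close>, which recombine to
  \<open>w $ j\<close>. The factor \<open>1/2\<close> is the origin of the quarter in the
  symbol.\<close>

lemma dzbar_cis: "dzbar j (\<lambda>x. cis (x \<bullet> w)) x = \<i> * (w $ j) / 2 * cis (x \<bullet> w)"
proof -
  have "complex_of_real (axis j 1 \<bullet> w) + \<i> * complex_of_real (axis j \<i> \<bullet> w) = w $ j"
    by (simp add: inner_axis' inner_complex_def complex_eq_iff)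
  then show ?thesis unfolding dzbar_def frechet_derivative_cis by (simp add: field_simps flip: \<open>_ = w $ j\<close>)
qed

section \<open>Closed subspaces given by pointwise projections\<close>

text \<open>One construction for two closed subspaces of L^2: functions supported in the cube, and
  forms of degree \<open>q\<close> on \<open>\<Omega>\<close>. In both cases membership is a
  condition in each fibre, given by an orthogonal projection.\<close>

locale pointwise_projection =
  fixes P :: "'a::euclidean_space \<Rightarrow> 'b::euclidean_space \<Rightarrow> 'b"
  assumes P_add: "P x (a + b) = P x a + P x b"
    and P_scaleR: "P x (c *\<^sub>R a) = c *\<^sub>R P x a"
    and P_idem: "P x (P x a) = P x a"
    and P_sym: "P x a \<bullet> b = a \<bullet> P x b"
    and P_measurable: "f \<in> borel_measurable lebesgue \<Longrightarrow> (\<lambda>x. P x (f x)) \<in> borel_measurable lebesgue"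
begin

definition range_L2 :: "('a, 'b) L2 set" where
  "range_L2 = {toL2 f |f. sq_int f \<and> (\<forall>x. P x (f x) = f x)}"

lemma P_diff: "P x (a - b) = P x a - P x b"
  using P_add[of x a "- 1 *\<^sub>R b"] P_scaleR[of x "- 1" b] by simp

lemma P_norm: "norm (P x a) \<le> norm a"
proof (cases "P x a = 0")
  case False
  have "norm (P x a) ^ 2 = P x a \<bullet> a"
    using P_sym[of x a "P x a"] P_sym[of x a a] by (simp add: power2_norm_eq_inner P_idem)
  also have "\<dots> \<le> norm (P x a) * norm a" by (rule norm_cauchy_schwarz)
  finally show ?thesis using False by (simp add: power2_eq_square)
qed simp

lemma sq_int_P:
  assumes "sq_int f"
  shows "sq_int (\<lambda>x. P x (f x))"
  by (rule sq_int_bound[where g = "\<lambda>x. (norm (f x))\<^sup>2"])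
    (use assms in \<open>auto simp: sq_int_def P_measurable P_norm intro!: power_mono\<close>)

lemma range_L2I: "sq_int f \<Longrightarrow> (\<And>x. P x (f x) = f x) \<Longrightarrow> toL2 f \<in> range_L2"
  unfolding range_L2_def by blast

lemma range_L2E:
  assumes "X \<in> range_L2"
  obtains f where "sq_int f" "\<forall>x. P x (f x) = f x" "X = toL2 f"
  using assms unfolding range_L2_def by blast

lemma subspace_range_L2: "subspace range_L2"
proof (rule subspaceI)
  have "P x 0 = 0" for x using P_scaleR[of x 0 0] by simp
  then show "0 \<in> range_L2" using range_L2I[of "\<lambda>x. 0"] by (simp add: sq_int_zero toL2_zero)
next
  fix X Y assume "X \<in> range_L2" "Y \<in> range_L2"
  then obtain f g where "sq_int f" "\<forall>x. P x (f x) = f x" "X = toL2 f" "sq_int g" "\<forall>x. P x (g x) = g x" "Y = toL2 g"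
    by (elim range_L2E)
  then show "X + Y \<in> range_L2"
    using range_L2I[of "\<lambda>x. f x + g x"] by (simp add: sq_int_add toL2_add P_add)
next
  fix c X assume "X \<in> range_L2"
  then obtain f where "sq_int f" "\<forall>x. P x (f x) = f x" "X = toL2 f" by (rule range_L2E)
  then show "c *\<^sub>R X \<in> range_L2"
    using range_L2I[of "\<lambda>x. c *\<^sub>R f x"] by (simp add: sq_int_scaleR toL2_scaleR P_scaleR)
qed

text \<open>The residual \<open>g = f - P f\<close> of a limit is orthogonal to the range, hence to
  the limit itself; but \<open>f \<bullet> g = g \<bullet> g\<close> in each fibre, so
  \<open>g = 0\<close>.\<close>

lemma closed_range_L2: "closed range_L2"
  unfolding closed_sequential_limits
proof (intro allI impI, elim conjE)
  fix X l assume X: "\<forall>n. X n \<in> range_L2" and lim: "X \<longlonglongrightarrow> l"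
  obtain f where f: "sq_int f" "l = toL2 f" by (rule L2_cases)
  define g where "g x = f x - P x (f x)" for x
  have g: "sq_int g" unfolding g_def using f sq_int_P by (intro sq_int_diff)
  have "X n \<bullet> toL2 g = 0" for n
  proof -
    obtain h where h: "sq_int h" "\<forall>x. P x (h x) = h x" "X n = toL2 h" using X by (meson range_L2E)
    have "h x \<bullet> g x = 0" for x
      using P_sym[of x "h x" "f x"] h(2) unfolding g_def by (simp add: inner_diff_right)
    then show ?thesis using h(1,3) g by (simp add: inner_toL2)
  qed
  moreover have "(\<lambda>n. X n \<bullet> toL2 g) \<longlonglongrightarrow> l \<bullet> toL2 g" by (intro tendsto_intros lim)
  ultimately have "l \<bullet> toL2 g = 0" by (simp add: LIMSEQ_const_iff)
  moreover have "f x \<bullet> g x = g x \<bullet> g x" for x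
    using P_sym[of x "f x" "f x - P x (f x)"] unfolding g_def by (simp add: P_diff P_idem inner_diff_left)
  ultimately have "toL2 g \<bullet> toL2 g = 0" using f g by (simp add: inner_toL2)
  then have "toL2 g = 0" by simp
  then have "l = toL2 (\<lambda>x. P x (f x))"
    using toL2_diff[OF f(1) sq_int_P[OF f(1)]] f(2) unfolding g_def by simp
  then show "l \<in> range_L2" using range_L2I[OF sq_int_P[OF f(1)]] P_idem by simp
qed

end

section \<open>Fourier series on a cube\<close>

lemma lborel_integral_prod_Basis:
  fixes g :: "'a::euclidean_space \<Rightarrow> real \<Rightarrow> complex"
  assumes g: "\<And>b. b \<in> Basis \<Longrightarrow> integrable lborel (g b)"
  shows "(LINT x|lborel. (\<Prod>b\<in>Basis. g b (x \<bullet> b))) = (\<Prod>b\<in>(Basis :: 'a set). LINT t|lborel. g b t)"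
proof -
  interpret product_sigma_finite "\<lambda>b :: 'a. lborel :: real measure" by standard
  have m: "(\<lambda>f. \<Sum>b\<in>Basis. f b *\<^sub>R b) \<in> (\<Pi>\<^sub>M b\<in>(Basis :: 'a set). lborel :: real measure) \<rightarrow>\<^sub>M borel"
    by measurable
  have gm: "g b \<in> borel_measurable borel" if "b \<in> Basis" for b
    using borel_measurable_integrable[OF g[OF that]] by simp
  have pm: "(\<lambda>x. \<Prod>b\<in>Basis. g b (x \<bullet> b)) \<in> borel_measurable borel"
    by (intro borel_measurable_prod measurable_compose[OF _ gm]) auto
  have "(LINT x|lborel. (\<Prod>b\<in>Basis. g b (x \<bullet> b)))
      = (LINT f|(\<Pi>\<^sub>M b\<in>(Basis :: 'a set). lborel). (\<Prod>b\<in>Basis. g b ((\<Sum>b\<in>Basis. f b *\<^sub>R b) \<bullet> b)))"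
    unfolding lborel_eq[where 'a = 'a] by (rule integral_distr[OF m pm])
  also have "\<dots> = (LINT f|(\<Pi>\<^sub>M b\<in>(Basis :: 'a set). lborel). (\<Prod>b\<in>Basis. g b (f b)))"
    by (intro Bochner_Integration.integral_cong prod.cong refl) simp
  also have "\<dots> = (\<Prod>b\<in>(Basis :: 'a set). LINT t|lborel. g b t)"
    by (rule product_integral_prod[OF finite_Basis g])
  finally show ?thesis .
qed

text \<open>The cube has side \<open>2 * pi * L\<close>, and the frequencies in \<open>1 / L\<close>
  times the integer lattice are those whose exponentials are periodic with respect to it.
  \<open>L\<close> is free so that a given bounded domain fits; \<open>dummy\<close> only fixes the
  space.\<close>

locale fourier_cube =
  fixes L :: real and dummy :: "'a::euclidean_space itself"
  assumes L: "L > 0"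
begin

definition cube :: "'a set" where "cube = box (- (pi * L) *\<^sub>R One) ((pi * L) *\<^sub>R One)"

definition lattice :: "'a set" where "lattice = {\<mu>. \<forall>i\<in>Basis. L * (\<mu> \<bullet> i) \<in> \<int>}"

definition vol :: real where "vol = (2 * pi * L) ^ DIM('a)"

definition coeff :: "('a \<Rightarrow> complex) \<Rightarrow> 'a \<Rightarrow> complex" where
  "coeff f \<mu> = (LINT x|lebesgue. f x * cis (- (x \<bullet> \<mu>)))"

lemma mem_cube: "x \<in> cube \<longleftrightarrow> (\<forall>i\<in>Basis. - (pi * L) < x \<bullet> i \<and> x \<bullet> i < pi * L)"
  unfolding cube_def mem_box by simp

lemma vol_pos: "vol > 0"
  unfolding vol_def using L by simp

lemma cube_meas [measurable]: "cube \<in> sets lebesgue" "cube \<in> sets borel"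
  unfolding cube_def by auto

lemma cube_finite: "emeasure lebesgue cube < \<infinity>"
proof -
  have "emeasure lebesgue cube = emeasure lborel cube" using cube_meas by (simp add: emeasure_completion)
  also have "\<dots> < \<infinity>" unfolding cube_def by (intro emeasure_bounded_finite bounded_box)
  finally show ?thesis .
qed

lemma lattice_diff: "\<mu> \<in> lattice \<Longrightarrow> \<nu> \<in> lattice \<Longrightarrow> \<mu> - \<nu> \<in> lattice"
  unfolding lattice_def by (auto simp: inner_diff_left right_diff_distrib)

lemma lattice_add: "\<mu> \<in> lattice \<Longrightarrow> \<nu> \<in> lattice \<Longrightarrow> \<mu> + \<nu> \<in> lattice"
  unfolding lattice_def by (auto simp: inner_add_left distrib_left)

lemma lattice_0: "0 \<in> lattice"
  unfolding lattice_def by auto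

lemma lattice_minus: "\<mu> \<in> lattice \<Longrightarrow> - \<mu> \<in> lattice"
  using lattice_diff[OF lattice_0] by simp

text \<open>The source of compactness: below a frequency bound there are only finitely many
  coefficients.\<close>

lemma finite_lattice_ball: "finite {\<mu> \<in> lattice. norm \<mu> \<le> R}"
proof -
  define f where "f \<mu> = (\<lambda>i\<in>Basis. L * (\<mu> \<bullet> i))" for \<mu> :: 'a
  have "f ` {\<mu> \<in> lattice. norm \<mu> \<le> R} \<subseteq> (\<Pi>\<^sub>E i\<in>Basis. {x \<in> \<int>. \<bar>x\<bar> \<le> L * R})"
  proof (intro image_subsetI PiE_I)
    fix \<mu> i :: 'a assume \<mu>: "\<mu> \<in> {\<mu> \<in> lattice. norm \<mu> \<le> R}" and i: "i \<in> Basis"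
    have "\<bar>\<mu> \<bullet> i\<bar> \<le> R" using Basis_le_norm[OF i, of \<mu>] \<mu> by simp
    then have "\<bar>L * (\<mu> \<bullet> i)\<bar> \<le> L * R" using L by (simp add: abs_mult)
    then show "f \<mu> i \<in> {x \<in> \<int>. \<bar>x\<bar> \<le> L * R}" using \<mu> i unfolding f_def lattice_def by auto
  qed (auto simp: f_def)
  moreover have "finite {x :: real. x \<in> \<int> \<and> \<bar>x\<bar> \<le> L * R}"
    using finite_int_segment[of "- (L * R)" "L * R"]
    by (rule rev_finite_subset) (auto simp: abs_le_iff)
  ultimately have "finite (f ` {\<mu> \<in> lattice. norm \<mu> \<le> R})"
    by (elim finite_subset) (intro finite_PiE finite_Basis)
  moreover have "inj f"
  proof (rule injI)
    fix \<mu> \<nu> assume eq: "f \<mu> = f \<nu>"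
    have "L * (\<mu> \<bullet> i) = L * (\<nu> \<bullet> i)" if "i \<in> Basis" for i
      using fun_cong[OF eq, of i] that L unfolding f_def by simp
    then show "\<mu> = \<nu>" using L by (auto intro: euclidean_eqI)
  qed
  ultimately show ?thesis using finite_imageD inj_on_subset by blast
qed

lemma integral_cis_interval:
  assumes "L * c \<in> \<int>"
  shows "(LINT t|lborel. indicator {- (pi * L)<..<pi * L} t *\<^sub>R cis (t * c)) = (if c = 0 then complex_of_real (2 * pi * L) else 0)"
proof -
  define a where "a = pi * L"
  have a: "a > 0" unfolding a_def using L by simp
  have "(LINT t|lborel. indicator {- a<..<a} t *\<^sub>R cis (t * c)) = (LINT t|lborel. indicator {- a..a} t *\<^sub>R cis (t * c))"
  proof (rule integral_cong_AE)
    have "AE t in lborel. t \<noteq> a" "AE t in lborel. t \<noteq> - a" by (rule AE_lborel_singleton)+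
    then show "AE t in lborel. indicator {- a<..<a} t *\<^sub>R cis (t * c) = indicator {- a..a} t *\<^sub>R cis (t * c)"
      by eventually_elim (auto simp: indicator_def)
    have [measurable]: "(\<lambda>t. cis (t * c)) \<in> borel_measurable borel"
      by (intro borel_measurable_continuous_onI continuous_intros)
    show "(\<lambda>t. indicator {- a<..<a} t *\<^sub>R cis (t * c)) \<in> borel_measurable lborel"
      "(\<lambda>t. indicator {- a..a} t *\<^sub>R cis (t * c)) \<in> borel_measurable lborel" by measurable
  qed
  also have "\<dots> = (if c = 0 then complex_of_real (2 * a) else 0)"
  proof (cases "c = 0")
    case True
    then show ?thesis using a by (simp add: scaleR_conv_of_real)
  next
    case False
    define F where "F t = cis (t * c) / (\<i> * complex_of_real c)" for t
    have der: "(F has_vector_derivative cis (t * c)) (at t within S)" for t S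
    proof -
      have "((\<lambda>t. cis (t * c)) has_vector_derivative (c *\<^sub>R (\<i> * cis (t * c)))) (at t within S)"
        unfolding has_vector_derivative_def
        using has_derivative_cis[of "\<lambda>t. t * c" "\<lambda>h. h * c" t S]
        by (auto intro!: derivative_eq_intros simp: algebra_simps scaleR_conv_of_real)
      then have "(F has_vector_derivative (c *\<^sub>R (\<i> * cis (t * c))) / (\<i> * complex_of_real c)) (at t within S)"
        unfolding F_def by (rule has_vector_derivative_divide)
      then show ?thesis using False by (simp add: scaleR_conv_of_real)
    qed
    have "(LINT t|lborel. indicator {- a..a} t *\<^sub>R cis (t * c)) = F a - F (- a)"
      by (intro integral_FTC_Icc der continuous_intros) (use a in auto)
    also have "\<dots> = 0"
    proof -
      \<comment> \<open>\<open>a * c\<close> is a multiple of \<pi>, so the antiderivative has equal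
        values at both ends.\<close>
      obtain k where "L * c = of_int k" using assms by (auto simp: Ints_def)
      then have "a * c = pi * of_int k" unfolding a_def by (simp add: mult.assoc)
      then have "sin (a * c) = 0" using sin_zero_iff_int2 by (auto simp: mult.commute)
      then have "cis (a * c) = cis (- (a * c))" by (simp add: complex_eq_iff)
      then show ?thesis unfolding F_def by simp
    qed
    finally show ?thesis using False by simp
  qed
  finally show ?thesis unfolding a_def by simp
qed

lemma cis_sum: "finite I \<Longrightarrow> cis (\<Sum>i\<in>I. f i) = (\<Prod>i\<in>I. cis (f i))"
  by (induction I rule: finite_induct) (auto simp: cis_mult[symmetric])

text \<open>The integrand is a product of functions of one coordinate, so the integral factors, and
  a nonzero frequency has a coordinate whose factor vanishes.\<close>

lemma integral_cis_cube:
  assumes \<nu>: "\<nu> \<in> lattice"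
  shows "(LINT x|lebesgue. indicator cube x *\<^sub>R cis (x \<bullet> \<nu>)) = (if \<nu> = 0 then complex_of_real vol else 0)"
proof -
  define g where "g b t = indicator {- (pi * L)<..<pi * L} t *\<^sub>R cis (t * (\<nu> \<bullet> b))" for b :: 'a and t
  have eq: "indicator cube x *\<^sub>R cis (x \<bullet> \<nu>) = (\<Prod>b\<in>Basis. g b (x \<bullet> b))" for x
  proof (cases "x \<in> cube")
    case True
    have "(\<Prod>b\<in>Basis. g b (x \<bullet> b)) = (\<Prod>b\<in>Basis. cis ((x \<bullet> b) * (\<nu> \<bullet> b)))"
      using True unfolding g_def mem_cube by (intro prod.cong) auto
    also have "\<dots> = cis (x \<bullet> \<nu>)" by (subst euclidean_inner) (simp add: cis_sum)
    finally show ?thesis using True by simp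
  next
    case False
    then obtain b where "b \<in> Basis" "\<not> (- (pi * L) < x \<bullet> b \<and> x \<bullet> b < pi * L)" unfolding mem_cube by blast
    then have "\<exists>b\<in>Basis. g b (x \<bullet> b) = 0" unfolding g_def by (intro bexI[of _ b]) auto
    then have "(\<Prod>b\<in>Basis. g b (x \<bullet> b)) = 0" by (intro prod_zero) auto
    then show ?thesis using False by simp
  qed
  have int: "integrable lborel (g b)" for b
    unfolding g_def
  proof (rule integrableI_bounded_set[where A = "{- (pi * L)<..<pi * L}" and B = 1])
    have [measurable]: "(\<lambda>t. cis (t * (\<nu> \<bullet> b))) \<in> borel_measurable borel"
      by (intro borel_measurable_continuous_onI continuous_intros)
    show "(\<lambda>t. indicator {- (pi * L)<..<pi * L} t *\<^sub>R cis (t * (\<nu> \<bullet> b))) \<in> borel_measurable lborel" by measurable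
  qed (use L in \<open>auto simp: indicator_def\<close>)
  have "(\<lambda>x. cis (x \<bullet> \<nu>)) \<in> borel_measurable borel"
    by (intro borel_measurable_continuous_onI continuous_intros)
  then have "(LINT x|lebesgue. indicator cube x *\<^sub>R cis (x \<bullet> \<nu>)) = (LINT x|lborel. indicator cube x *\<^sub>R cis (x \<bullet> \<nu>))"
    by (intro integral_completion) measurable
  also have "\<dots> = (\<Prod>b\<in>(Basis :: 'a set). LINT t|lborel. g b t)"
    unfolding eq by (rule lborel_integral_prod_Basis[OF int])
  also have "\<dots> = (\<Prod>b\<in>(Basis :: 'a set). if \<nu> \<bullet> b = 0 then complex_of_real (2 * pi * L) else 0)"
    unfolding g_def by (intro prod.cong refl integral_cis_interval) (use \<nu> in \<open>auto simp: lattice_def\<close>)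
  also have "\<dots> = (if \<nu> = 0 then complex_of_real vol else 0)"
  proof (cases "\<nu> = 0")
    case False
    then obtain b where "b \<in> Basis" "\<nu> \<bullet> b \<noteq> 0" using euclidean_all_zero_iff by blast
    then have "(\<Prod>b\<in>(Basis :: 'a set). if \<nu> \<bullet> b = 0 then complex_of_real (2 * pi * L) else 0) = 0"
      by (intro prod_zero) auto
    then show ?thesis using False by simp
  qed (simp add: vol_def)
  finally show ?thesis .
qed

subsection \<open>Completeness of the characters\<close>

inductive trig_poly :: "('a \<Rightarrow> complex) \<Rightarrow> bool" where
  cis: "\<mu> \<in> lattice \<Longrightarrow> trig_poly (\<lambda>x. c * cis (x \<bullet> \<mu>))"
| add: "trig_poly f \<Longrightarrow> trig_poly g \<Longrightarrow> trig_poly (\<lambda>x. f x + g x)"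

lemma trig_poly_const: "trig_poly (\<lambda>x. c)"
  using trig_poly.cis[OF lattice_0, of c] by simp

lemma trig_poly_mult:
  assumes "trig_poly f" "trig_poly g"
  shows "trig_poly (\<lambda>x. f x * g x)"
  using assms(1)
proof induction
  case (cis \<mu> c)
  show ?case using assms(2)
  proof induction
    case (cis \<nu> d)
    have "trig_poly (\<lambda>x. (c * d) * cis (x \<bullet> (\<mu> + \<nu>)))"
      by (intro trig_poly.cis lattice_add \<open>\<mu> \<in> lattice\<close> cis)
    then show ?case by (simp add: inner_add_right cis_mult[symmetric] mult_ac)
  next
    case (add g h)
    from trig_poly.add[OF add.IH] show ?case by (simp add: distrib_left)
  qed
next
  case (add g h)
  from trig_poly.add[OF add.IH] show ?case by (simp add: distrib_right)
qed

lemma trig_poly_sum: "finite I \<Longrightarrow> (\<And>i. i \<in> I \<Longrightarrow> trig_poly (f i)) \<Longrightarrow> trig_poly (\<lambda>x. \<Sum>i\<in>I. f i x)"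
  by (induction I rule: finite_induct) (auto intro: trig_poly.add trig_poly_const)

text \<open>Wraps each coordinate around a circle, gluing opposite faces of the cube. Polynomials in
  the image coordinates are trigonometric polynomials, which brings in the Stone-Weierstrass
  theorem.\<close>

definition torus :: "'a \<Rightarrow> 'a \<times> 'a" where
  "torus x = (\<Sum>i\<in>Basis. cos (x \<bullet> i / L) *\<^sub>R i, \<Sum>i\<in>Basis. sin (x \<bullet> i / L) *\<^sub>R i)"

lemma continuous_torus: "continuous_on S torus"
  unfolding torus_def by (intro continuous_intros) (use L in auto)

text \<open>Coordinates with equal images differ by a multiple of \<open>2 * pi * L\<close>. One
  point in the open and the other in the closed cube makes the difference smaller than that.\<close>

lemma torus_inj:
  assumes "x \<in> cube" "y \<in> closure cube" "torus x = torus y"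
  shows "x = y"
proof (rule euclidean_eqI)
  fix i :: 'a assume i: "i \<in> Basis"
  have cl: "closure cube \<subseteq> cbox (- (pi * L) *\<^sub>R One) ((pi * L) *\<^sub>R One)"
    unfolding cube_def by (intro closure_minimal box_subset_cbox closed_cbox)
  have "cos (x \<bullet> i / L) = cos (y \<bullet> i / L)" "sin (x \<bullet> i / L) = sin (y \<bullet> i / L)"
    using arg_cong[OF assms(3), of "\<lambda>p. fst p \<bullet> i"] arg_cong[OF assms(3), of "\<lambda>p. snd p \<bullet> i"] i
    unfolding torus_def by simp_all
  then obtain n :: int where n: "y \<bullet> i / L = x \<bullet> i / L + 2 * pi * real_of_int n"
    using sin_cos_eq_iff by metis
  then have n': "y \<bullet> i - x \<bullet> i = (2 * pi * L) * real_of_int n" using L by (simp add: field_simps)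
  have "\<bar>y \<bullet> i - x \<bullet> i\<bar> < 2 * pi * L"
    using assms(1) subsetD[OF cl assms(2)] i unfolding mem_cube mem_box by (auto simp: abs_less_iff dest!: bspec[OF _ i])
  then have "(2 * pi * L) * \<bar>real_of_int n\<bar> < (2 * pi * L) * 1" unfolding n' using L by (simp add: abs_mult)
  then have "\<bar>real_of_int n\<bar> < 1" using L by (subst (asm) mult_less_cancel_left_pos) auto
  then have "n = 0" by linarith
  then show "x \<bullet> i = y \<bullet> i" using n' by simp
qed

text \<open>Cosine and sine are combinations of two exponentials with opposite frequencies, which
  settles the linear functions; the class is closed under sums and products.\<close>

lemma trig_poly_torus:
  "real_polynomial_function g \<Longrightarrow> trig_poly (\<lambda>x. complex_of_real (g (torus x)))"
proof (induction rule: real_polynomial_function.induct)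
  case (linear f)
  interpret bounded_linear f by fact
  have mem: "(1 / L) *\<^sub>R i \<in> lattice" if "i \<in> Basis" for i
    using that L unfolding lattice_def by (auto simp: inner_Basis)
  have "trig_poly (\<lambda>x. (\<Sum>i\<in>Basis. complex_of_real (f (i, 0)) / 2 * cis (x \<bullet> ((1/L) *\<^sub>R i)) + complex_of_real (f (i, 0)) / 2 * cis (x \<bullet> (- ((1/L) *\<^sub>R i))))
     + (\<Sum>i\<in>Basis. complex_of_real (f (0, i)) / (2 * \<i>) * cis (x \<bullet> ((1/L) *\<^sub>R i)) + (- complex_of_real (f (0, i)) / (2 * \<i>)) * cis (x \<bullet> (- ((1/L) *\<^sub>R i)))))"
    by (intro trig_poly.add trig_poly_sum finite_Basis trig_poly.cis mem lattice_minus)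
  moreover have "complex_of_real (f (torus x)) = (\<Sum>i\<in>Basis. complex_of_real (f (i, 0)) / 2 * cis (x \<bullet> ((1/L) *\<^sub>R i)) + complex_of_real (f (i, 0)) / 2 * cis (x \<bullet> (- ((1/L) *\<^sub>R i))))
     + (\<Sum>i\<in>Basis. complex_of_real (f (0, i)) / (2 * \<i>) * cis (x \<bullet> ((1/L) *\<^sub>R i)) + (- complex_of_real (f (0, i)) / (2 * \<i>)) * cis (x \<bullet> (- ((1/L) *\<^sub>R i))))" for x
  proof -
    have "torus x = (\<Sum>i\<in>Basis. cos (x \<bullet> i / L) *\<^sub>R (i, 0)) + (\<Sum>i\<in>Basis. sin (x \<bullet> i / L) *\<^sub>R (0, i))"
      unfolding torus_def by (simp add: prod_eq_iff fst_sum snd_sum)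
    then have "f (torus x) = (\<Sum>i\<in>Basis. cos (x \<bullet> i / L) * f (i, 0)) + (\<Sum>i\<in>Basis. sin (x \<bullet> i / L) * f (0, i))"
      by (simp only: add sum scaleR real_scaleR_def)
    moreover have "complex_of_real (cos (x \<bullet> i / L) * f (i, 0)) = complex_of_real (f (i, 0)) / 2 * cis (x \<bullet> ((1/L) *\<^sub>R i)) + complex_of_real (f (i, 0)) / 2 * cis (x \<bullet> (- ((1/L) *\<^sub>R i)))" for i
      by (simp add: complex_eq_iff)
    moreover have "complex_of_real (sin (x \<bullet> i / L) * f (0, i)) = complex_of_real (f (0, i)) / (2 * \<i>) * cis (x \<bullet> ((1/L) *\<^sub>R i)) + (- complex_of_real (f (0, i)) / (2 * \<i>)) * cis (x \<bullet> (- ((1/L) *\<^sub>R i)))" for i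
      by (simp add: complex_eq_iff Re_divide Im_divide power2_eq_square)
    ultimately show ?thesis by simp
  qed
  ultimately show ?case by simp
next
  case (const c)
  then show ?case by (rule trig_poly_const)
next
  case (add f g)
  then show ?case using trig_poly.add by simp
next
  case (mult f g)
  then show ?case using trig_poly_mult by simp
qed

lemma sq_int_cube_integrable:
  fixes w :: "'a \<Rightarrow> complex"
  assumes w: "sq_int w" "\<And>x. x \<notin> cube \<Longrightarrow> w x = 0"
  shows "integrable lebesgue w"
proof (rule Bochner_Integration.integrable_bound)
  show "integrable lebesgue (\<lambda>x. indicator cube x + (norm (w x))\<^sup>2)"
    using w(1) cube_finite unfolding sq_int_def by (intro Bochner_Integration.integrable_add integrable_real_indicator) auto
  have "norm (w x) \<le> indicator cube x + (norm (w x))\<^sup>2" for x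
  proof (cases "x \<in> cube")
    case True
    have "2 * norm (w x) \<le> 1 + (norm (w x))\<^sup>2" using sum_squares_bound[of 1 "norm (w x)"] by simp
    then show ?thesis using True norm_ge_zero[of "w x"] by (simp only: indicator_simps)
  qed (simp add: w)
  then show "AE x in lebesgue. norm (w x) \<le> norm (indicator cube x + (norm (w x))\<^sup>2)"
    by (auto intro!: AE_I2 order_trans[OF _ abs_ge_self])
qed (use w in \<open>simp add: sq_int_def\<close>)

lemma integrable_mult_bounded:
  fixes w p :: "'a \<Rightarrow> complex"
  assumes w: "integrable lebesgue w" and p: "p \<in> borel_measurable lebesgue" "\<And>x. norm (p x) \<le> B"
  shows "integrable lebesgue (\<lambda>x. w x * p x)"
proof (rule Bochner_Integration.integrable_bound)
  show "integrable lebesgue (\<lambda>x. B * norm (w x))" using w by simp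
  have "B \<ge> 0" using p(2)[of 0] norm_ge_zero order_trans by blast
  then show "AE x in lebesgue. norm (w x * p x) \<le> norm (B * norm (w x))"
    using p(2) by (intro AE_I2) (simp add: norm_mult mult.commute[of "norm (w _)"] mult_right_mono)
qed (use w p in simp)

lemma cis_measurable: "(\<lambda>x :: 'a. cis (x \<bullet> \<mu>)) \<in> borel_measurable lebesgue"
proof -
  have "(\<lambda>x :: 'a. cis (x \<bullet> \<mu>)) \<in> borel_measurable borel"
    by (intro borel_measurable_continuous_onI continuous_intros)
  then show ?thesis by (intro measurable_completion) simp
qed

lemma trig_poly_orthogonal:
  assumes w: "integrable lebesgue w" and zero: "\<And>\<mu>. \<mu> \<in> lattice \<Longrightarrow> coeff w \<mu> = 0"
    and p: "trig_poly p"
  shows "integrable lebesgue (\<lambda>x. w x * p x) \<and> p \<in> borel_measurable lebesgue \<and> (LINT x|lebesgue. w x * p x) = 0"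
  using p
proof induction
  case (cis \<mu> c)
  have "integrable lebesgue (\<lambda>x. w x * cis (x \<bullet> \<mu>))"
    by (rule integrable_mult_bounded[OF w cis_measurable, of _ 1]) simp
  moreover have "(LINT x|lebesgue. w x * cis (x \<bullet> \<mu>)) = 0"
    using zero[OF lattice_minus[OF cis]] unfolding coeff_def by simp
  moreover have "(\<lambda>x. w x * (c * cis (x \<bullet> \<mu>))) = (\<lambda>x. c * (w x * cis (x \<bullet> \<mu>)))" by (simp add: mult_ac)
  ultimately show ?case using cis_measurable[of \<mu>] by simp
next
  case (add f g)
  then show ?case by (auto simp: distrib_left intro: borel_measurable_add)
qed

text \<open>Trigonometric polynomials approximate the indicator of any open \<open>U\<close> in the
  cube boundedly and pointwise: Stone-Weierstrass is applied on the torus to truncated distances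
  from the image of the complement of \<open>U\<close>.\<close>

theorem characters_complete:
  fixes w :: "'a \<Rightarrow> complex"
  assumes w: "integrable lebesgue w" and off: "\<And>x. x \<notin> cube \<Longrightarrow> w x = 0"
    and zero: "\<And>\<mu>. \<mu> \<in> lattice \<Longrightarrow> coeff w \<mu> = 0"
  shows "AE x in lebesgue. w x = 0"
proof (rule AE_zero_of_open[OF w _ off])
  show "open cube" unfolding cube_def by (rule open_box)
  fix U :: "'a set" assume U: "open U" "U \<subseteq> cube"
  define K where "K = cbox (- (pi * L) *\<^sub>R One) ((pi * L) *\<^sub>R One :: 'a)"
  have cK: "closure cube \<subseteq> K" "cube \<subseteq> K" "compact K"
    unfolding cube_def K_def by (intro closure_minimal box_subset_cbox closed_cbox compact_cbox)+
  have Kc: "K \<subseteq> closure cube"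
    unfolding K_def cube_def using L by (subst closure_box) (auto simp: box_ne_empty)
  \<comment> \<open>The boundary of the cube, where \<open>torus\<close> identifies points, belongs
    to \<open>K - U\<close>; it suffices that points of \<open>U\<close> are separated from the
    rest.\<close>
  define Z where "Z = torus ` (K - U)"
  have Z: "compact Z" unfolding Z_def
    using compact_diff[OF cK(3) U(1)] by (intro compact_continuous_image continuous_torus)
  \<comment> \<open>A corner of the cube shows that \<open>Z\<close> is nonempty; the distance
    \<open>infdist\<close> to an empty set would be \<open>0\<close>.\<close>
  have "(pi * L) *\<^sub>R One \<in> K - U"
  proof -
    obtain i :: 'a where "i \<in> Basis" using SOME_Basis by blast
    then have "(pi * L) *\<^sub>R One \<notin> cube" unfolding mem_cube by auto
    moreover have "pi * L > 0" using L by simp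
    then have "(pi * L) *\<^sub>R One \<in> K" unfolding K_def mem_box by simp
    ultimately show ?thesis using U by blast
  qed
  then have Zne: "Z \<noteq> {}" unfolding Z_def by blast
  \<comment> \<open>Continuous functions between \<open>0\<close> and \<open>1\<close> that vanish
    on \<open>Z\<close> and increase to \<open>1\<close> off it.\<close>
  define k where "k N y = min 1 (real N * infdist y Z)" for N :: nat and y
  have k01: "0 \<le> k N y" "k N y \<le> 1" for N y unfolding k_def by (auto simp: infdist_nonneg)
  define S where "S = torus ` K"
  have S: "compact S" unfolding S_def using cK(3) by (intro compact_continuous_image continuous_torus)
  have "\<exists>g. real_polynomial_function g \<and> (\<forall>y\<in>S. \<bar>k N y - g y\<bar> < inverse (real (Suc N)))" for N
  proof -
    have "continuous_on S (k N)" unfolding k_def by (intro continuous_intros)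
    then show ?thesis using Stone_Weierstrass_real_polynomial_function[OF S, of "k N" "inverse (real (Suc N))"]
      by (metis inverse_positive_iff_positive of_nat_0_less_iff zero_less_Suc)
  qed
  then obtain g where g: "\<And>N. real_polynomial_function (g N)"
    "\<And>N y. y \<in> S \<Longrightarrow> \<bar>k N y - g N y\<bar> < inverse (real (Suc N))" by metis
  define p where "p N x = complex_of_real (g N (torus x))" for N x
  have p: "integrable lebesgue (\<lambda>x. w x * p N x)" "(LINT x|lebesgue. w x * p N x) = 0" for N
    using trig_poly_orthogonal[OF w zero trig_poly_torus[OF g(1)]] unfolding p_def by auto
  have "(\<lambda>N. LINT x|lebesgue. w x * p N x) \<longlonglongrightarrow> (LINT x|lebesgue. indicator U x *\<^sub>R w x)"
  proof (rule integral_dominated_convergence[where w = "\<lambda>x. 2 * norm (w x)"])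
    show "AE x in lebesgue. norm (w x * p N x) \<le> 2 * norm (w x)" for N
    proof (rule AE_I2)
      fix x
      show "norm (w x * p N x) \<le> 2 * norm (w x)"
      proof (cases "x \<in> cube")
        case True
        then have "torus x \<in> S" unfolding S_def using cK by blast
        then have "\<bar>k N (torus x) - g N (torus x)\<bar> < inverse (real (Suc N))" by (rule g)
        moreover have "inverse (real (Suc N)) \<le> 1" by (simp add: inverse_le_1_iff)
        ultimately have "\<bar>g N (torus x)\<bar> \<le> 2" using k01[of N "torus x"] by linarith
        then show ?thesis unfolding p_def by (simp add: norm_mult mult.commute[of 2] mult_left_mono)
      qed (simp add: off)
    qed
    show "AE x in lebesgue. (\<lambda>N. w x * p N x) \<longlonglongrightarrow> indicator U x *\<^sub>R w x"
    proof (rule AE_I2)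
      fix x
      show "(\<lambda>N. w x * p N x) \<longlonglongrightarrow> indicator U x *\<^sub>R w x"
      proof (cases "x \<in> cube")
        case True
        then have xS: "torus x \<in> S" unfolding S_def using cK by blast
        have lk: "(\<lambda>N. k N (torus x)) \<longlonglongrightarrow> indicator U x"
        proof (cases "x \<in> U")
          case False
          then have "torus x \<in> Z" using True cK unfolding Z_def by blast
          then show ?thesis using False unfolding k_def by simp
        next
          case True
          have "torus x \<notin> Z"
          proof
            assume "torus x \<in> Z"
            then obtain y where y: "y \<in> K - U" "torus x = torus y" unfolding Z_def by blast
            then have "x = y" using torus_inj[of x y] True U(2) Kc by blast
            then show False using y True by blast
          qed
          then have pos: "infdist (torus x) Z > 0"
            using infdist_pos_not_in_closed[OF compact_imp_closed[OF Z] Zne] by simp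
          have "k N (torus x) = 1" if "N \<ge> nat \<lceil>1 / infdist (torus x) Z\<rceil>" for N
          proof -
            have "1 / infdist (torus x) Z \<le> real N" using that by linarith
            then show ?thesis unfolding k_def using pos by (simp add: pos_divide_le_eq)
          qed
          then have "\<forall>\<^sub>F N in sequentially. k N (torus x) = 1" unfolding eventually_sequentially by blast
          then show ?thesis using True by (simp add: tendsto_eventually)
        qed
        have le: "norm (g N (torus x) - k N (torus x)) \<le> inverse (real (Suc N))" for N
          using g(2)[OF xS, of N] by (simp add: abs_minus_commute less_imp_le)
        have "(\<lambda>N. g N (torus x) - k N (torus x)) \<longlonglongrightarrow> 0"
          by (rule Lim_null_comparison[OF _ LIMSEQ_inverse_real_of_nat]) (intro always_eventually allI le)
        from tendsto_add[OF this lk] have "(\<lambda>N. g N (torus x)) \<longlonglongrightarrow> indicator U x" by simp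
        then have "(\<lambda>N. w x * p N x) \<longlonglongrightarrow> w x * complex_of_real (indicator U x)"
          unfolding p_def by (intro tendsto_intros)
        then show ?thesis by (simp add: scaleR_conv_of_real mult.commute)
      qed (simp add: off)
    qed
    show "(\<lambda>x. indicator U x *\<^sub>R w x) \<in> borel_measurable lebesgue"
      using U(1) w by (intro borel_measurable_scaleR borel_measurable_indicator) auto
  qed (use w p in auto)
  then show "(LINT x:U|lebesgue. w x) = 0"
    unfolding set_lebesgue_integral_def p by (simp add: LIMSEQ_const_iff)
qed

subsection \<open>The inequalities of Bessel and Parseval\<close>

definition char_fun :: "'a \<Rightarrow> complex \<Rightarrow> 'a \<Rightarrow> complex" where
  "char_fun \<mu> \<sigma> x = (if x \<in> cube then \<sigma> * cis (x \<bullet> \<mu>) else 0)"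

lemma sq_int_char_fun: "sq_int (char_fun \<mu> \<sigma>)"
proof (rule sq_int_bound)
  have "char_fun \<mu> \<sigma> = (\<lambda>x. indicator cube x *\<^sub>R (\<sigma> * cis (x \<bullet> \<mu>)))"
    by (auto simp: char_fun_def indicator_def)
  then show "char_fun \<mu> \<sigma> \<in> borel_measurable lebesgue" using cis_measurable[of \<mu>] by simp
  show "integrable lebesgue (\<lambda>x. (norm \<sigma>)\<^sup>2 * indicator cube x)"
    using cube_finite by (intro integrable_mult_right integrable_real_indicator) auto
  show "(norm (char_fun \<mu> \<sigma> x))\<^sup>2 \<le> (norm \<sigma>)\<^sup>2 * indicator cube x" for x
    by (simp add: char_fun_def norm_mult)
qed

lemma inner_char_fun:
  assumes f: "sq_int f" "\<And>x. x \<notin> cube \<Longrightarrow> f x = 0"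
  shows "toL2 f \<bullet> toL2 (char_fun \<mu> \<sigma>) = Re (cnj \<sigma> * coeff f \<mu>)"
proof -
  have int: "integrable lebesgue (\<lambda>x. f x * cis (- (x \<bullet> \<mu>)))"
    using integrable_mult_bounded[OF sq_int_cube_integrable[OF f] cis_measurable[of "- \<mu>"], of 1] by simp
  have "z \<bullet> (\<sigma> * cis t) = Re (cnj \<sigma> * (z * cis (- t)))" for z t
    by (simp add: inner_complex_def algebra_simps)
  then have "f x \<bullet> char_fun \<mu> \<sigma> x = Re (cnj \<sigma> * (f x * cis (- (x \<bullet> \<mu>))))" for x
    using f(2)[of x] by (auto simp: char_fun_def)
  then have "toL2 f \<bullet> toL2 (char_fun \<mu> \<sigma>) = (LINT x|lebesgue. Re (cnj \<sigma> * (f x * cis (- (x \<bullet> \<mu>)))))"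
    using f sq_int_char_fun by (simp add: inner_toL2)
  also have "\<dots> = Re (LINT x|lebesgue. cnj \<sigma> * (f x * cis (- (x \<bullet> \<mu>))))"
    using int by (intro integral_Re integrable_mult_right)
  also have "(LINT x|lebesgue. cnj \<sigma> * (f x * cis (- (x \<bullet> \<mu>)))) = cnj \<sigma> * coeff f \<mu>"
    unfolding coeff_def by (rule integral_mult_right_zero)
  finally show ?thesis .
qed

lemma coeff_char_fun:
  assumes "\<mu> \<in> lattice" "\<nu> \<in> lattice"
  shows "coeff (char_fun \<mu> \<sigma>) \<nu> = (if \<mu> = \<nu> then \<sigma> * complex_of_real vol else 0)"
proof -
  have "char_fun \<mu> \<sigma> x * cis (- (x \<bullet> \<nu>)) = \<sigma> * (indicator cube x *\<^sub>R cis (x \<bullet> (\<mu> - \<nu>)))" for x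
    by (simp add: char_fun_def cis_mult inner_diff_right indicator_def mult.assoc)
  then have "coeff (char_fun \<mu> \<sigma>) \<nu> = \<sigma> * (LINT x|lebesgue. indicator cube x *\<^sub>R cis (x \<bullet> (\<mu> - \<nu>)))"
    unfolding coeff_def by (simp only: integral_mult_right_zero)
  then show ?thesis using integral_cis_cube[OF lattice_diff[OF assms]] by simp
qed

text \<open>A real inner product sees only a real part. The multiples by \<open>1\<close> and
  \<open>\<i>\<close> of an exponential together give both parts of its Fourier coefficient.\<close>

definition characters :: "('a, complex) L2 set" where
  "characters = (\<lambda>(\<mu>, \<sigma>). toL2 (char_fun \<mu> \<sigma>)) ` (lattice \<times> {1, \<i>})"

lemma inner_characters:
  assumes "\<mu> \<in> lattice" "\<nu> \<in> lattice" "\<sigma> \<in> {1, \<i>}" "\<tau> \<in> {1, \<i>}"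
  shows "toL2 (char_fun \<mu> \<sigma>) \<bullet> toL2 (char_fun \<nu> \<tau>) = (if \<mu> = \<nu> \<and> \<sigma> = \<tau> then vol else 0)"
proof -
  have "toL2 (char_fun \<mu> \<sigma>) \<bullet> toL2 (char_fun \<nu> \<tau>) = Re (cnj \<tau> * coeff (char_fun \<mu> \<sigma>) \<nu>)"
    by (rule inner_char_fun[OF sq_int_char_fun]) (simp add: char_fun_def)
  then show ?thesis using assms by (auto simp: coeff_char_fun)
qed

lemma characters_orthogonal:
  "x \<in> characters \<Longrightarrow> y \<in> characters \<Longrightarrow> x \<noteq> y \<Longrightarrow> x \<bullet> y = 0"
  "x \<in> characters \<Longrightarrow> x \<bullet> x = vol"
  unfolding characters_def by (auto simp: inner_characters split: if_splits)

lemma inj_on_characters: "inj_on (\<lambda>(\<mu>, \<sigma>). toL2 (char_fun \<mu> \<sigma>)) (lattice \<times> {1, \<i>})"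
proof (rule inj_onI, clarify)
  fix \<mu> \<sigma> \<nu> \<tau> assume *: "\<mu> \<in> lattice" "\<nu> \<in> lattice" "\<sigma> \<in> {1, \<i>}" "\<tau> \<in> {1, \<i>}" and "toL2 (char_fun \<mu> \<sigma>) = toL2 (char_fun \<nu> \<tau>)"
  then have "toL2 (char_fun \<mu> \<sigma>) \<bullet> toL2 (char_fun \<nu> \<tau>) = vol" using inner_characters[of \<mu> \<mu> \<sigma> \<sigma>] by simp
  then show "\<mu> = \<nu> \<and> \<sigma> = \<tau>" using inner_characters[OF *] vol_pos by (auto split: if_splits)
qed

lemma sum_characters:
  assumes f: "sq_int f" "\<And>x. x \<notin> cube \<Longrightarrow> f x = 0" and M: "finite M" "M \<subseteq> lattice"
  shows "(\<Sum>x\<in>(\<lambda>(\<mu>, \<sigma>). toL2 (char_fun \<mu> \<sigma>)) ` (M \<times> {1, \<i>}). (toL2 f \<bullet> x)\<^sup>2) = (\<Sum>\<mu>\<in>M. (norm (coeff f \<mu>))\<^sup>2)"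
proof -
  have "(\<Sum>x\<in>(\<lambda>(\<mu>, \<sigma>). toL2 (char_fun \<mu> \<sigma>)) ` (M \<times> {1, \<i>}). (toL2 f \<bullet> x)\<^sup>2)
      = (\<Sum>(\<mu>, \<sigma>)\<in>M \<times> {1, \<i>}. (toL2 f \<bullet> toL2 (char_fun \<mu> \<sigma>))\<^sup>2)"
    using inj_on_subset[OF inj_on_characters, of "M \<times> {1, \<i>}"] M
    by (subst sum.reindex) (auto simp: o_def split_beta)
  also have "\<dots> = (\<Sum>\<mu>\<in>M. \<Sum>\<sigma>\<in>{1, \<i>}. (toL2 f \<bullet> toL2 (char_fun \<mu> \<sigma>))\<^sup>2)"
    by (rule sum.cartesian_product[symmetric])
  also have "\<dots> = (\<Sum>\<mu>\<in>M. (norm (coeff f \<mu>))\<^sup>2)"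
    by (intro sum.cong refl) (simp add: inner_char_fun[OF f] cmod_power2)
  finally show ?thesis .
qed

theorem bessel:
  assumes f: "sq_int f" "\<And>x. x \<notin> cube \<Longrightarrow> f x = 0" and M: "finite M" "M \<subseteq> lattice"
  shows "(\<Sum>\<mu>\<in>M. (norm (coeff f \<mu>))\<^sup>2) \<le> vol * (LINT x|lebesgue. (norm (f x))\<^sup>2)"
proof -
  have "(\<lambda>(\<mu>, \<sigma>). toL2 (char_fun \<mu> \<sigma>)) ` (M \<times> {1, \<i>}) \<subseteq> characters"
    using M(2) unfolding characters_def by (intro image_mono) auto
  from bessel_inequality[OF characters_orthogonal(1) vol_pos characters_orthogonal(2) _ this, of "toL2 f"]
  show ?thesis using M(1) by (simp add: sum_characters[OF assms] norm_toL2_sq[OF f(1)] del: finite_SigmaI2)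
qed

sublocale P: pointwise_projection "\<lambda>x a. if x \<in> cube then a else 0 :: complex"
  by unfold_locales (auto intro!: measurable_If_set)

text \<open>By \<open>characters_complete\<close> the exponentials, cut off to the cube, are total
  in the space of functions supported there, so the abstract approximation applies.\<close>

theorem parseval:
  assumes f: "sq_int f" "\<And>x. x \<notin> cube \<Longrightarrow> f x = 0" and e: "e > 0"
  obtains M where "finite M" "M \<subseteq> lattice"
    "vol * (LINT x|lebesgue. (norm (f x))\<^sup>2) \<le> (\<Sum>\<mu>\<in>M. (norm (coeff f \<mu>))\<^sup>2) + e"
proof -
  have "toL2 f \<in> closure (span characters)"
  proof (rule mem_closure_span[OF P.subspace_range_L2 P.closed_range_L2])
    show "characters \<subseteq> P.range_L2"
      unfolding characters_def using sq_int_char_fun by (auto intro!: P.range_L2I simp: char_fun_def)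
    show "toL2 f \<in> P.range_L2" using f by (intro P.range_L2I) auto
    fix w assume "w \<in> P.range_L2" and orth: "\<And>x. x \<in> characters \<Longrightarrow> x \<bullet> w = 0"
    then obtain g where g: "sq_int g" "\<forall>x. (if x \<in> cube then g x else 0) = g x" "w = toL2 g"
      by (elim P.range_L2E)
    then have g0: "g x = 0" if "x \<notin> cube" for x using that by metis
    have "coeff g \<mu> = 0" if "\<mu> \<in> lattice" for \<mu>
    proof -
      have mem: "toL2 (char_fun \<mu> \<sigma>) \<in> characters" if "\<sigma> \<in> {1, \<i>}" for \<sigma>
        using that \<open>\<mu> \<in> lattice\<close> unfolding characters_def by (intro image_eqI[of _ _ "(\<mu>, \<sigma>)"]) auto
      have "toL2 g \<bullet> toL2 (char_fun \<mu> 1) = 0" "toL2 g \<bullet> toL2 (char_fun \<mu> \<i>) = 0"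
        using orth[OF mem[of 1]] orth[OF mem[of "\<i>"]] g(3) by (simp_all add: inner_commute)
      then show ?thesis using inner_char_fun[OF g(1) g0] by (simp add: complex_eq_iff)
    qed
    then have "AE x in lebesgue. g x = 0"
      using characters_complete[OF sq_int_cube_integrable[OF g(1) g0] g0] by blast
    then show "w = 0" unfolding g(3) using toL2_eq_iff[OF g(1) sq_int_zero] toL2_zero by metis
  qed
  from parseval_approx[OF characters_orthogonal(1) vol_pos characters_orthogonal(2) this e]
  obtain F where F: "finite F" "F \<subseteq> characters" "vol * norm (toL2 f) ^ 2 \<le> (\<Sum>x\<in>F. (toL2 f \<bullet> x) ^ 2) + e"
    by blast
  obtain C where C: "C \<subseteq> lattice \<times> {1, \<i>}" "finite C" "F = (\<lambda>(\<mu>, \<sigma>). toL2 (char_fun \<mu> \<sigma>)) ` C"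
    using finite_subset_image[OF F(1) F(2)[unfolded characters_def]] by blast
  \<comment> \<open>Completing \<open>C\<close> to all pairs over its frequencies only adds squares
    and turns the sum into one over complex coefficients.\<close>
  define M where "M = fst ` C"
  have M: "finite M" "M \<subseteq> lattice" unfolding M_def using C by auto
  have "C \<subseteq> M \<times> {1, \<i>}" unfolding M_def using C(1) by force
  then have "(\<Sum>x\<in>F. (toL2 f \<bullet> x) ^ 2) \<le> (\<Sum>x\<in>(\<lambda>(\<mu>, \<sigma>). toL2 (char_fun \<mu> \<sigma>)) ` (M \<times> {1, \<i>}). (toL2 f \<bullet> x)\<^sup>2)"
    unfolding C(3) using M by (intro sum_mono2) auto
  then show thesis
    using that[OF M] F(3) sum_characters[OF f M] norm_toL2_sq[OF f(1)] by simp
qed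

end

section \<open>Signs of wedge products\<close>

text \<open>The sign in \<open>wedge_coeff\<close> as a real number, so that it can be a scalar in
  the real Hilbert space.\<close>

definition wsgn :: "'n::{finite,linorder} \<Rightarrow> 'n set \<Rightarrow> real" where
  "wsgn j J = (-1) ^ card {k\<in>J. k < j}"

lemma wsgn_sq: "wsgn j J * wsgn j J = 1"
  unfolding wsgn_def by (simp flip: power_add power_mult_distrib)

lemma wedge_coeff_eq: "wedge_coeff j J K = complex_of_real (if j \<notin> J \<and> K = insert j J then wsgn j J else 0)"
  unfolding wedge_coeff_def wsgn_def by simp

lemma wsgn_insert:
  assumes "k \<notin> J" "k \<noteq> j"
  shows "wsgn j (insert k J) = (if k < j then - wsgn j J else wsgn j J)"
proof -
  have "{l \<in> insert k J. l < j} = (if k < j then insert k {l \<in> J. l < j} else {l \<in> J. l < j})" by auto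
  then show ?thesis unfolding wsgn_def using assms by simp
qed

text \<open>Of \<open>j\<close> and \<open>k\<close> exactly one is smaller, and inserting it flips
  the sign of the other. This is the cancellation behind \<open>D D = 0\<close>.\<close>

lemma wsgn_antisym:
  assumes "j \<notin> I" "k \<notin> I" "j \<noteq> k"
  shows "wsgn j (insert k I) * wsgn k I = - (wsgn k (insert j I) * wsgn j I)"
  using assms by (auto simp: wsgn_insert)

text \<open>The same single flip; here it makes the mixed terms of wedge and interior multiplication
  cancel in \<open>symbol_identity\<close>.\<close>

lemma wsgn_exchange:
  assumes "j \<notin> I" "k \<notin> I" "j \<noteq> k"
  shows "wsgn j (insert k I) * wsgn k (insert j I) = - (wsgn j I * wsgn k I)"
  using assms wsgn_sq[of j I] wsgn_sq[of k I] by (auto simp: wsgn_insert)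

lemma sum_wedge_coeff:
  fixes F :: "'n::{finite,linorder} set \<Rightarrow> complex"
  assumes "card K = Suc q"
  shows "(\<Sum>J | card J = q. wedge_coeff j J K * F J)
    = (if j \<in> K then complex_of_real (wsgn j (K - {j})) * F (K - {j}) else 0)"
proof (cases "j \<in> K")
  case True
  have "(\<Sum>J | card J = q. wedge_coeff j J K * F J) = (\<Sum>J | card J = q. if J = K - {j} then complex_of_real (wsgn j (K - {j})) * F (K - {j}) else 0)"
  proof (rule sum.cong)
    show "wedge_coeff j J K * F J = (if J = K - {j} then complex_of_real (wsgn j (K - {j})) * F (K - {j}) else 0)" for J
      using True by (auto simp: wedge_coeff_eq)
  qed simp
  then show ?thesis using True assms by (simp add: card_Diff_singleton)
qed (auto simp: wedge_coeff_eq intro!: sum.neutral)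

section \<open>Square-integrable forms as elements of a Hilbert space\<close>

locale form_domain =
  fixes \<Omega> :: "(complex^'n::{finite,linorder}) set"
  assumes open_domain: "open \<Omega>" and bounded_domain: "bounded \<Omega>"
begin

abbreviation forms :: "nat \<Rightarrow> 'n form set" where "forms \<equiv> L2_forms \<Omega>"

text \<open>Extension by zero transfers the integrals to the whole space and normalises the values
  off \<open>\<Omega>\<close>, which a form leaves arbitrary.\<close>

definition ext :: "((complex, 'n) vec \<Rightarrow> 'b::zero) \<Rightarrow> (complex, 'n) vec \<Rightarrow> 'b" where
  "ext u z = (if z \<in> \<Omega> then u z else 0)"

definition emb :: "'n form \<Rightarrow> ((complex, 'n) vec, (complex, 'n set) vec) L2" where "emb u = toL2 (ext u)"

lemma domain_meas [measurable]: "\<Omega> \<in> sets lebesgue"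
  using open_domain by simp

lemma domain_finite: "emeasure lebesgue \<Omega> < \<infinity>"
proof -
  have "emeasure lebesgue \<Omega> = emeasure lborel \<Omega>" using open_domain by (simp add: emeasure_completion)
  then show ?thesis using emeasure_bounded_finite[OF bounded_domain] by simp
qed

lemma integral_on_domain:
  fixes g :: "(complex, 'n) vec \<Rightarrow> 'b::{banach, second_countable_topology}"
  shows "(LINT z|lebesgue_on \<Omega>. g z) = (LINT z|lebesgue. ext g z)"
proof -
  have "(LINT z|lebesgue_on \<Omega>. g z) = (LINT z|lebesgue. indicator \<Omega> z *\<^sub>R g z)"
    by (rule integral_restrict_space) simp
  also have "(\<lambda>z. indicator \<Omega> z *\<^sub>R g z) = ext g" by (auto simp: ext_def indicator_def)
  finally show ?thesis .
qed

lemma integrable_on_domain: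
  fixes g :: "(complex, 'n) vec \<Rightarrow> 'b::{banach, second_countable_topology}"
  shows "integrable (lebesgue_on \<Omega>) g \<longleftrightarrow> integrable lebesgue (ext g)"
proof -
  have "integrable (lebesgue_on \<Omega>) g \<longleftrightarrow> integrable lebesgue (\<lambda>z. indicator \<Omega> z *\<^sub>R g z)"
    by (rule integrable_restrict_space) simp
  also have "(\<lambda>z. indicator \<Omega> z *\<^sub>R g z) = ext g" by (auto simp: ext_def indicator_def)
  finally show ?thesis .
qed

lemma AE_on_domain: "(AE z in lebesgue_on \<Omega>. Q z) \<longleftrightarrow> (AE z in lebesgue. z \<in> \<Omega> \<longrightarrow> Q z)"
  by (rule AE_restrict_space_iff) simp

lemma measurable_on_domain:
  fixes g :: "(complex, 'n) vec \<Rightarrow> 'b::euclidean_space"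
  shows "g \<in> borel_measurable (lebesgue_on \<Omega>) \<longleftrightarrow> ext g \<in> borel_measurable lebesgue"
  using borel_measurable_if[of \<Omega> g] by (simp add: ext_def[abs_def])

lemma sq_int_ext:
  assumes "u \<in> forms q"
  shows "sq_int (ext u)"
proof -
  have "ext (\<lambda>z. (norm (u z))\<^sup>2) = (\<lambda>z. (norm (ext u z))\<^sup>2)" by (auto simp: ext_def)
  then show ?thesis using assms unfolding sq_int_def L2_forms_def
    by (simp add: measurable_on_domain integrable_on_domain)
qed

lemma forms_iff: "u \<in> forms q \<longleftrightarrow> sq_int (ext u) \<and> (\<forall>z\<in>\<Omega>. \<forall>J. card J \<noteq> q \<longrightarrow> u z $ J = 0)"
proof -
  have "ext (\<lambda>z. (norm (u z))\<^sup>2) = (\<lambda>z. (norm (ext u z))\<^sup>2)" by (auto simp: ext_def)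
  then show ?thesis unfolding sq_int_def L2_forms_def
    by (simp add: measurable_on_domain integrable_on_domain)
qed

lemma ext_add: "ext (\<lambda>z. u z + v z) = (\<lambda>z. ext u z + ext v z)" for u v :: "(complex, 'n) vec \<Rightarrow> 'b::monoid_add"
  by (auto simp: ext_def)

lemma ext_diff: "ext (\<lambda>z. u z - v z) = (\<lambda>z. ext u z - ext v z)" for u v :: "(complex, 'n) vec \<Rightarrow> 'b::group_add"
  by (auto simp: ext_def)

lemma ext_smult: "ext (\<lambda>z. c *s u z) = (\<lambda>z. c *s ext u z)" for u :: "'n form"
  by (auto simp: ext_def)

lemma norm_smult: "norm (c *s x) = norm c * norm x" for x :: "complex^'m::finite"
  by (simp add: norm_vec_def L2_set_def norm_mult power_mult_distrib real_sqrt_mult flip: sum_distrib_left)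

lemma sq_int_smult:
  fixes u :: "'n form"
  assumes "sq_int u"
  shows "sq_int (\<lambda>z. c *s u z)"
proof -
  have "continuous_on UNIV (\<lambda>x :: (complex, 'n set) vec. c *s x)"
    unfolding vector_scalar_mult_def by (intro continuous_intros)
  from measurable_compose[OF sq_int_measurable[OF assms] borel_measurable_continuous_onI[OF this]]
  have "(\<lambda>z. c *s u z) \<in> borel_measurable lebesgue" .
  then show ?thesis using assms unfolding sq_int_def by (simp add: norm_smult power_mult_distrib)
qed

lemma sq_int_nth:
  fixes u :: "'n form"
  assumes "sq_int u"
  shows "sq_int (\<lambda>z. u z $ J)"
proof (rule sq_int_bound)
  have "continuous_on UNIV (\<lambda>x :: (complex, 'n set) vec. x $ J)" by (intro continuous_intros)
  from measurable_compose[OF sq_int_measurable[OF assms] borel_measurable_continuous_onI[OF this]]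
  show "(\<lambda>z. u z $ J) \<in> borel_measurable lebesgue" .
  show "integrable lebesgue (\<lambda>z. (norm (u z))\<^sup>2)" using assms unfolding sq_int_def by simp
  show "(norm (u z $ J))\<^sup>2 \<le> (norm (u z))\<^sup>2" for z by (intro power_mono Finite_Cartesian_Product.norm_nth_le norm_ge_zero)
qed

lemma sq_int_axis:
  fixes f :: "(complex, 'n) vec \<Rightarrow> complex"
  assumes "sq_int f"
  shows "sq_int (\<lambda>z. axis J (f z) :: (complex, 'n set) vec)"
proof (rule sq_int_bound)
  have "continuous_on UNIV (\<lambda>x. axis J x :: (complex, 'n set) vec)"
    unfolding axis_def
  proof (rule continuous_on_vec_lambda)
    show "continuous_on UNIV (\<lambda>x. if i = J then x else 0)" for i :: "'n set"
      by (cases "i = J") (auto intro: continuous_intros)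
  qed
  from measurable_compose[OF sq_int_measurable[OF assms] borel_measurable_continuous_onI[OF this]]
  show "(\<lambda>z. axis J (f z) :: (complex, 'n set) vec) \<in> borel_measurable lebesgue" .
  show "integrable lebesgue (\<lambda>z. (norm (f z))\<^sup>2)" using assms unfolding sq_int_def by simp
  show "(norm (axis J (f z) :: (complex, 'n set) vec))\<^sup>2 \<le> (norm (f z))\<^sup>2" for z
    by (simp add: power2_norm_eq_inner inner_axis_axis)
qed

lemma sq_int_cnj: "sq_int f \<Longrightarrow> sq_int (\<lambda>z. cnj (f z))" for f :: "(complex, 'n) vec \<Rightarrow> complex"
proof -
  assume f: "sq_int f"
  have "continuous_on UNIV cnj" by (intro continuous_intros)
  from measurable_compose[OF sq_int_measurable[OF f] borel_measurable_continuous_onI[OF this]]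
  show ?thesis using f unfolding sq_int_def by simp
qed

section \<open>Linear operations, norms and inner products of forms\<close>

lemma forms_add: "u \<in> forms q \<Longrightarrow> v \<in> forms q \<Longrightarrow> (\<lambda>z. u z + v z) \<in> forms q"
  unfolding forms_iff by (auto simp: ext_add intro: sq_int_add)

lemma forms_diff: "u \<in> forms q \<Longrightarrow> v \<in> forms q \<Longrightarrow> (\<lambda>z. u z - v z) \<in> forms q"
  unfolding forms_iff by (auto simp: ext_diff intro: sq_int_diff)

lemma forms_smult: "u \<in> forms q \<Longrightarrow> (\<lambda>z. c *s u z) \<in> forms q"
  unfolding forms_iff by (auto simp: ext_smult intro: sq_int_smult)

lemma emb_add: "u \<in> forms q \<Longrightarrow> v \<in> forms q \<Longrightarrow> emb (\<lambda>z. u z + v z) = emb u + emb v"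
  unfolding emb_def ext_add by (intro toL2_add sq_int_ext)

lemma emb_diff: "u \<in> forms q \<Longrightarrow> v \<in> forms q \<Longrightarrow> emb (\<lambda>z. u z - v z) = emb u - emb v"
  unfolding emb_def ext_diff by (intro toL2_diff sq_int_ext)

lemma emb_eq_iff: "u \<in> forms q \<Longrightarrow> v \<in> forms q' \<Longrightarrow> emb u = emb v \<longleftrightarrow> ae_eq \<Omega> u v"
  unfolding emb_def ae_eq_def AE_on_domain
  by (subst toL2_eq_iff) (auto simp: sq_int_ext ext_def intro!: arg_cong[where f = "\<lambda>P. almost_everywhere lebesgue P"] ext)

lemma L2_norm_emb: "u \<in> forms q \<Longrightarrow> L2_norm \<Omega> u = norm (emb u)"
proof -
  assume u: "u \<in> forms q"
  have "ext (\<lambda>z. (norm (u z))\<^sup>2) = (\<lambda>z. (norm (ext u z))\<^sup>2)" by (auto simp: ext_def)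
  then have "L2_norm \<Omega> u = sqrt (norm (emb u) ^ 2)"
    unfolding L2_norm_def integral_on_domain emb_def norm_toL2_sq[OF sq_int_ext[OF u]] by simp
  then show ?thesis by simp
qed

lemma cinner_integrable:
  assumes "sq_int (f :: (complex, 'n) vec \<Rightarrow> complex)" "sq_int g"
  shows "integrable lebesgue (\<lambda>z. f z * g z)"
proof (rule Bochner_Integration.integrable_bound)
  show "integrable lebesgue (\<lambda>x. (norm (f x))\<^sup>2 + (norm (g x))\<^sup>2)"
    using assms unfolding sq_int_def by simp
  show "(\<lambda>z. f z * g z) \<in> borel_measurable lebesgue" using assms unfolding sq_int_def by (intro borel_measurable_times) auto
  have "norm (x * y) \<le> (norm x)\<^sup>2 + (norm y)\<^sup>2" for x y :: complex
  proof -
    have "0 \<le> norm x * norm y" by simp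
    then show ?thesis using sum_squares_bound[of "norm x" "norm y"] unfolding norm_mult by linarith
  qed
  then show "AE z in lebesgue. norm (f z * g z) \<le> norm ((norm (f z))\<^sup>2 + (norm (g z))\<^sup>2)"
    by (intro AE_I2) auto
qed

lemma inner_vec_complex: "x \<bullet> y = Re (\<Sum>J\<in>UNIV. x $ J * cnj (y $ J))" for x y :: "(complex, 'm::finite) vec"
  unfolding inner_vec_def by (simp add: inner_complex_def)

lemma L2_inner_integrable:
  assumes "u \<in> forms q" "v \<in> forms q'"
  shows "integrable lebesgue (ext (\<lambda>z. \<Sum>J\<in>UNIV. u z $ J * cnj (v z $ J)))"
proof -
  have "ext (\<lambda>z. \<Sum>J\<in>UNIV. u z $ J * cnj (v z $ J)) = (\<lambda>z. \<Sum>J\<in>UNIV. ext u z $ J * cnj (ext v z $ J))"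
    by (auto simp: ext_def)
  then show ?thesis using assms
    by (simp add: cinner_integrable sq_int_cnj sq_int_nth sq_int_ext)
qed

lemma Re_L2_inner:
  assumes "u \<in> forms q" "v \<in> forms q'"
  shows "Re (L2_inner \<Omega> u v) = emb u \<bullet> emb v"
proof -
  have "Re (L2_inner \<Omega> u v) = (LINT z|lebesgue. Re (ext (\<lambda>z. \<Sum>J\<in>UNIV. u z $ J * cnj (v z $ J)) z))"
    unfolding L2_inner_def integral_on_domain by (rule integral_Re[OF L2_inner_integrable[OF assms], symmetric])
  also have "\<dots> = (LINT z|lebesgue. ext u z \<bullet> ext v z)"
    by (intro Bochner_Integration.integral_cong) (auto simp: ext_def inner_vec_complex)
  finally show ?thesis unfolding emb_def using assms by (simp add: inner_toL2 sq_int_ext)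
qed

lemma L2_inner_smult_left:
  shows "L2_inner \<Omega> (\<lambda>z. c *s u z) v = c * L2_inner \<Omega> u v"
proof -
  have "(\<Sum>J\<in>UNIV. (c *s u z) $ J * cnj (v z $ J)) = c * (\<Sum>J\<in>UNIV. u z $ J * cnj (v z $ J))" for z
    by (simp add: sum_distrib_left mult.assoc)
  then show ?thesis unfolding L2_inner_def by simp
qed

lemma L2_inner_smult_right:
  shows "L2_inner \<Omega> u (\<lambda>z. c *s v z) = cnj c * L2_inner \<Omega> u v"
proof -
  have "(\<Sum>J\<in>UNIV. u z $ J * cnj ((c *s v z) $ J)) = cnj c * (\<Sum>J\<in>UNIV. u z $ J * cnj (v z $ J))" for z
    by (simp add: sum_distrib_left mult_ac)
  then show ?thesis unfolding L2_inner_def by simp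
qed

subsection \<open>The subspace of forms of a given degree\<close>

definition proj_form :: "nat \<Rightarrow> (complex, 'n) vec \<Rightarrow> (complex, 'n set) vec \<Rightarrow> (complex, 'n set) vec" where
  "proj_form q z a = (if z \<in> \<Omega> then (\<chi> J. if card J = q then a $ J else 0) else 0)"

end

sublocale form_domain \<subseteq> F: pointwise_projection "proj_form q" for q
proof
  fix f :: "(complex, 'n) vec \<Rightarrow> (complex, 'n set) vec" assume f: "f \<in> borel_measurable lebesgue"
  have "continuous_on UNIV (\<lambda>a :: (complex, 'n set) vec. (\<chi> J. if card J = q then a $ J else 0) :: (complex, 'n set) vec)"
  proof (rule continuous_on_vec_lambda)
    show "continuous_on UNIV (\<lambda>a :: (complex, 'n set) vec. if card J = q then a $ J else 0)" for J
      by (cases "card J = q") (auto intro: continuous_intros)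
  qed
  from measurable_compose[OF f borel_measurable_continuous_onI[OF this]]
  show "(\<lambda>x. proj_form q x (f x)) \<in> borel_measurable lebesgue"
    unfolding proj_form_def by (intro measurable_If_set) auto
qed (auto simp: proj_form_def vec_eq_iff inner_vec_def intro!: sum.cong)

context form_domain
begin

abbreviation "H q \<equiv> F.range_L2 q"

lemma emb_in_H: "u \<in> forms q \<Longrightarrow> emb u \<in> H q"
  unfolding emb_def forms_iff
  by (rule F.range_L2I) (auto simp: proj_form_def ext_def vec_eq_iff)

lemma H_cases:
  assumes "X \<in> H q"
  obtains u where "u \<in> forms q" "emb u = X"
proof -
  obtain f where f: "sq_int f" "\<forall>x. proj_form q x (f x) = f x" "X = toL2 f"
    using assms by (rule F.range_L2E)
  have z: "ext f = f"
  proof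
    show "ext f z = f z" for z
      using f(2)[rule_format, of z] by (cases "z \<in> \<Omega>") (auto simp: ext_def proj_form_def)
  qed
  have "f z $ J = 0" if "z \<in> \<Omega>" "card J \<noteq> q" for z J
  proof -
    have "f z $ J = proj_form q z (f z) $ J" using f(2) by simp
    then show ?thesis using that by (simp add: proj_form_def)
  qed
  then have "f \<in> forms q" unfolding forms_iff z using f(1) by blast
  then show thesis using that[of f] f(3) z unfolding emb_def by simp
qed

subsection \<open>The graph of the operator\<close>

text \<open>Represents a test functional: the inner product of \<open>emb u\<close> with it is the
  real part of the integral of \<open>\<phi>\<close> times the component of \<open>u\<close> at
  \<open>J\<close>. The conjugate cancels the one in the inner product.\<close>

definition tv :: "'n set \<Rightarrow> ((complex, 'n) vec \<Rightarrow> complex) \<Rightarrow> ((complex, 'n) vec, (complex, 'n set) vec) L2" where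
  "tv J \<phi> = toL2 (\<lambda>z. axis J (cnj (\<phi> z)))"

lemma ext_test:
  assumes "\<phi> \<in> test_functions \<Omega>"
  shows "ext (\<lambda>z. g z * \<phi> z) = (\<lambda>z. g z * \<phi> z)" "ext (\<lambda>z. g z * \<phi> z) = (\<lambda>z. ext g z * \<phi> z)"
proof -
  obtain K where "smooth_on \<phi> UNIV" "compact K" "K \<subseteq> \<Omega>" "\<forall>x. x \<notin> K \<longrightarrow> \<phi> x = 0"
    "\<forall>x v. x \<notin> K \<longrightarrow> frechet_derivative \<phi> (at x) v = 0"
    using assms by (rule test_functionsE)
  then have "\<phi> z = 0" if "z \<notin> \<Omega>" for z using that by blast
  then show "ext (\<lambda>z. g z * \<phi> z) = (\<lambda>z. g z * \<phi> z)" "ext (\<lambda>z. g z * \<phi> z) = (\<lambda>z. ext g z * \<phi> z)"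
    by (auto simp: ext_def)
qed

lemma inner_tv:
  assumes u: "u \<in> forms q" and \<phi>: "\<phi> \<in> test_functions \<Omega>"
  shows "emb u \<bullet> tv J \<phi> = Re (LINT z|lebesgue_on \<Omega>. u z $ J * \<phi> z)"
proof -
  have "emb u \<bullet> tv J \<phi> = (LINT z|lebesgue. ext u z \<bullet> axis J (cnj (\<phi> z)))"
    unfolding emb_def tv_def using assms
    by (intro inner_toL2 sq_int_ext sq_int_axis sq_int_cnj test_functions_sq_int)
  also have "\<dots> = (LINT z|lebesgue. Re (ext u z $ J * \<phi> z))"
    by (intro Bochner_Integration.integral_cong) (auto simp: inner_axis inner_complex_def)
  also have "\<dots> = Re (LINT z|lebesgue. ext u z $ J * \<phi> z)"
    using assms by (intro integral_Re cinner_integrable sq_int_nth sq_int_ext test_functions_sq_int)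
  also have "(\<lambda>z. ext u z $ J * \<phi> z) = ext (\<lambda>z. u z $ J * \<phi> z)"
    unfolding ext_test(2)[OF \<phi>] by (auto simp: ext_def)
  finally show ?thesis unfolding integral_on_domain .
qed

lemma dzbar_cmult:
  assumes "\<phi> \<in> test_functions \<Omega>"
  shows "dzbar j (\<lambda>z. c * \<phi> z) = (\<lambda>z. c * dzbar j \<phi> z)"
proof
  fix z :: "(complex, 'n) vec"
  have d: "frechet_derivative (\<lambda>z. c) (at z) = (\<lambda>v. 0)"
    using frechet_derivative_at[of "\<lambda>z. c" "\<lambda>v. 0" z] by simp
  have "dzbar j (\<lambda>z. c * \<phi> z) z = dzbar j (\<lambda>z. c) z * \<phi> z + c * dzbar j \<phi> z"
    using smooth_on_differentiable[OF test_functions_smooth[OF assms]] by (intro dzbar_mult) auto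
  then show "dzbar j (\<lambda>z. c * \<phi> z) z = c * dzbar j \<phi> z" unfolding dzbar_def[of j "\<lambda>z. c"] d by simp
qed

text \<open>The transpose of \<open>D\<close> on the test function \<open>\<phi>\<close> in the
  component \<open>K\<close>. The minus sign is that of the distributional derivative.\<close>

definition formal_adj :: "nat \<Rightarrow> 'n set \<Rightarrow> ((complex, 'n) vec \<Rightarrow> complex) \<Rightarrow> ((complex, 'n) vec, (complex, 'n set) vec) L2" where
  "formal_adj q K \<phi> = (\<Sum>j\<in>UNIV. \<Sum>J | card J = q. (- Re (wedge_coeff j J K)) *\<^sub>R tv J (dzbar j \<phi>))"

text \<open>The graph of \<open>D\<close> as the solution set of continuous real linear equations,
  whence it is a closed subspace.\<close>

definition dbar_rel :: "nat \<Rightarrow> (((complex, 'n) vec, (complex, 'n set) vec) L2 \<times> ((complex, 'n) vec, (complex, 'n set) vec) L2) set" where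
  "dbar_rel q = {(X, Y). X \<in> H q \<and> Y \<in> H (Suc q) \<and>
     (\<forall>K \<phi>. card K = Suc q \<longrightarrow> \<phi> \<in> test_functions \<Omega> \<longrightarrow> X \<bullet> formal_adj q K \<phi> = Y \<bullet> tv K \<phi>)}"

text \<open>\<open>- \<i> * \<phi>\<close> is again a test function, and the real part of
  \<open>- \<i> * A \<phi>\<close> is the imaginary part of \<open>A \<phi>\<close>.\<close>

lemma complex_linear_eq_iff:
  fixes A B :: "((complex, 'n) vec \<Rightarrow> complex) \<Rightarrow> complex"
  assumes "\<And>c \<phi>. \<phi> \<in> test_functions \<Omega> \<Longrightarrow> A (\<lambda>z. c * \<phi> z) = c * A \<phi>"
    and "\<And>c \<phi>. \<phi> \<in> test_functions \<Omega> \<Longrightarrow> B (\<lambda>z. c * \<phi> z) = c * B \<phi>"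
  shows "(\<forall>\<phi>\<in>test_functions \<Omega>. A \<phi> = B \<phi>) \<longleftrightarrow> (\<forall>\<phi>\<in>test_functions \<Omega>. Re (A \<phi>) = Re (B \<phi>))"
proof
  assume *: "\<forall>\<phi>\<in>test_functions \<Omega>. Re (A \<phi>) = Re (B \<phi>)"
  show "\<forall>\<phi>\<in>test_functions \<Omega>. A \<phi> = B \<phi>"
  proof
    fix \<phi> assume \<phi>: "\<phi> \<in> test_functions \<Omega>"
    have "Re (A (\<lambda>z. - \<i> * \<phi> z)) = Re (B (\<lambda>z. - \<i> * \<phi> z))" using * test_functions_cmult[OF \<phi>] by blast
    then have "Im (A \<phi>) = Im (B \<phi>)" unfolding assms[OF \<phi>] by simp
    then show "A \<phi> = B \<phi>" using * \<phi> by (simp add: complex_eq_iff)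
  qed
qed simp

lemma Re_dist_sum:
  assumes u: "u \<in> forms q" and \<phi>: "\<phi> \<in> test_functions \<Omega>"
  shows "Re (\<Sum>j\<in>UNIV. \<Sum>J | card J = q. wedge_coeff j J K * dist_dzbar \<Omega> j (\<lambda>z. u z $ J) \<phi>)
    = emb u \<bullet> formal_adj q K \<phi>"
proof -
  have "Re (wedge_coeff j J K * dist_dzbar \<Omega> j (\<lambda>z. u z $ J) \<phi>) = - Re (wedge_coeff j J K) * (emb u \<bullet> tv J (dzbar j \<phi>))" for j J
    unfolding inner_tv[OF u test_functions_dzbar[OF \<phi>]] dist_dzbar_def wedge_coeff_eq by simp
  then show ?thesis unfolding formal_adj_def by (simp add: inner_sum_right del: times_complex.sel)
qed

lemma has_dbar_iff:
  "has_dbar \<Omega> q u f \<longleftrightarrow> u \<in> forms q \<and> f \<in> forms (Suc q) \<and> (emb u, emb f) \<in> dbar_rel q"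
proof (cases "u \<in> forms q \<and> f \<in> forms (Suc q)")
  case True
  then have u: "u \<in> forms q" and f: "f \<in> forms (Suc q)" by auto
  have "(\<forall>\<phi>\<in>test_functions \<Omega>. (\<Sum>j\<in>UNIV. \<Sum>J | card J = q. wedge_coeff j J K * dist_dzbar \<Omega> j (\<lambda>z. u z $ J) \<phi>) = (LINT z|lebesgue_on \<Omega>. f z $ K * \<phi> z))
    \<longleftrightarrow> (\<forall>\<phi>\<in>test_functions \<Omega>. emb u \<bullet> formal_adj q K \<phi> = emb f \<bullet> tv K \<phi>)" for K
  proof -
    have "(\<forall>\<phi>\<in>test_functions \<Omega>. (\<Sum>j\<in>UNIV. \<Sum>J | card J = q. wedge_coeff j J K * dist_dzbar \<Omega> j (\<lambda>z. u z $ J) \<phi>) = (LINT z|lebesgue_on \<Omega>. f z $ K * \<phi> z))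
      \<longleftrightarrow> (\<forall>\<phi>\<in>test_functions \<Omega>. Re (\<Sum>j\<in>UNIV. \<Sum>J | card J = q. wedge_coeff j J K * dist_dzbar \<Omega> j (\<lambda>z. u z $ J) \<phi>) = Re (LINT z|lebesgue_on \<Omega>. f z $ K * \<phi> z))"
    proof (rule complex_linear_eq_iff)
      fix c and \<phi> assume \<phi>: "\<phi> \<in> test_functions \<Omega>"
      have "dist_dzbar \<Omega> j (\<lambda>z. u z $ J) (\<lambda>z. c * \<phi> z) = c * dist_dzbar \<Omega> j (\<lambda>z. u z $ J) \<phi>" for j J
        unfolding dist_dzbar_def dzbar_cmult[OF \<phi>] by (simp add: mult.left_commute[of _ c])
      then show "(\<Sum>j\<in>UNIV. \<Sum>J | card J = q. wedge_coeff j J K * dist_dzbar \<Omega> j (\<lambda>z. u z $ J) (\<lambda>z. c * \<phi> z))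
        = c * (\<Sum>j\<in>UNIV. \<Sum>J | card J = q. wedge_coeff j J K * dist_dzbar \<Omega> j (\<lambda>z. u z $ J) \<phi>)"
        by (simp add: sum_distrib_left mult.left_commute[of _ c])
      show "(LINT z|lebesgue_on \<Omega>. f z $ K * (c * \<phi> z)) = c * (LINT z|lebesgue_on \<Omega>. f z $ K * \<phi> z)"
        by (simp add: mult.left_commute[of _ c])
    qed
    then show ?thesis by (simp only: Re_dist_sum[OF u] inner_tv[OF f] cong: ball_cong)
  qed
  then show ?thesis unfolding has_dbar_def dbar_rel_def using True emb_in_H by blast
qed (auto simp: has_dbar_def)

lemma subspace_dbar_rel: "subspace (dbar_rel q)"
  unfolding dbar_rel_def
  by (rule subspaceI)
    (auto simp: zero_prod_def inner_add_left subspace_0[OF F.subspace_range_L2]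
      intro: subspace_add[OF F.subspace_range_L2] subspace_scale[OF F.subspace_range_L2])

lemma closed_dbar_rel: "closed (dbar_rel q)"
proof -
  have "dbar_rel q = (H q \<times> H (Suc q)) \<inter> (\<Inter>K\<in>{K. card K = Suc q}. \<Inter>\<phi>\<in>test_functions \<Omega>.
      {p. fst p \<bullet> formal_adj q K \<phi> = snd p \<bullet> tv K \<phi>})"
    unfolding dbar_rel_def by auto
  also have "closed \<dots>"
    by (intro closed_Int closed_Times F.closed_range_L2 closed_INT ballI closed_Collect_eq continuous_intros)
  finally show ?thesis .
qed

lemma dbar_rel_subset: "dbar_rel q \<subseteq> H q \<times> H (Suc q)"
  unfolding dbar_rel_def by auto

section \<open>Uniqueness of the value of the operator\<close>

lemma sq_int_domain_integrable:
  fixes w :: "(complex, 'n) vec \<Rightarrow> complex"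
  assumes w: "sq_int w" "\<And>z. z \<notin> \<Omega> \<Longrightarrow> w z = 0"
  shows "integrable lebesgue w"
proof -
  have "sq_int (\<lambda>z. indicator \<Omega> z :: complex)"
  proof (rule sq_int_bound)
    show "integrable lebesgue (\<lambda>z. indicator \<Omega> z :: real)"
      using domain_finite by (intro integrable_real_indicator) auto
  qed (auto simp: indicator_def)
  from cinner_integrable[OF w(1) this] show ?thesis
    using w(2) by (elim back_subst[of "integrable lebesgue"]) (auto simp: indicator_def fun_eq_iff)
qed

text \<open>Each component is annihilated by all test functions and so vanishes almost everywhere.
  Applied to a difference of two values, this makes \<open>D\<close> single valued.\<close>

lemma tests_total:
  assumes Y: "Y \<in> H q" and zero: "\<And>K \<phi>. card K = q \<Longrightarrow> \<phi> \<in> test_functions \<Omega> \<Longrightarrow> Y \<bullet> tv K \<phi> = 0"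
  shows "Y = 0"
proof -
  obtain f where f: "f \<in> forms q" "emb f = Y" using Y by (rule H_cases)
  have "AE z in lebesgue. ext f z $ K = 0" for K
  proof (cases "card K = q")
    case False
    then have "ext f z $ K = 0" for z using f(1) unfolding forms_iff by (auto simp: ext_def)
    then show ?thesis by simp
  next
    case True
    have "\<forall>\<phi>\<in>test_functions \<Omega>. (LINT z|lebesgue_on \<Omega>. f z $ K * \<phi> z) = (\<lambda>\<phi>. 0) \<phi>"
    proof (subst complex_linear_eq_iff)
      show "\<forall>\<phi>\<in>test_functions \<Omega>. Re (LINT z|lebesgue_on \<Omega>. f z $ K * \<phi> z) = Re 0"
        using zero[OF True] inner_tv[OF f(1)] f(2) by simp
    qed (simp_all add: mult.left_commute)
    note * = this
    have **: "(LINT z|lebesgue. ext f z $ K * \<phi> z) = 0" if "\<phi> \<in> test_functions \<Omega>" for \<phi>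
    proof -
      have "ext (\<lambda>z. f z $ K * \<phi> z) = (\<lambda>z. ext f z $ K * \<phi> z)" by (auto simp: ext_def fun_eq_iff)
      then show ?thesis using bspec[OF * that] unfolding integral_on_domain by simp
    qed
    show ?thesis
    proof (rule test_functions_separate[OF _ open_domain])
      show "integrable lebesgue (\<lambda>z. ext f z $ K)"
        by (rule sq_int_domain_integrable[OF sq_int_nth[OF sq_int_ext[OF f(1)]]]) (simp add: ext_def)
    qed (auto simp: ext_def[of f] intro: **[unfolded ext_def])
  qed
  then have "AE z in lebesgue. \<forall>K\<in>UNIV. ext f z $ K = 0" by (intro AE_finite_allI) auto
  then have "AE z in lebesgue. ext f z = 0" by eventually_elim (simp add: vec_eq_iff)
  then show ?thesis using f(2) toL2_eq_iff[OF sq_int_ext[OF f(1)] sq_int_zero] unfolding emb_def toL2_zero by simp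
qed

lemma dbar_rel_single_valued: "(X, Y) \<in> dbar_rel q \<Longrightarrow> (X, Y') \<in> dbar_rel q \<Longrightarrow> Y = Y'"
proof -
  assume "(X, Y) \<in> dbar_rel q" "(X, Y') \<in> dbar_rel q"
  from subspace_diff[OF subspace_dbar_rel this] have "(0, Y - Y') \<in> dbar_rel q" by simp
  then have "Y - Y' = 0" using tests_total[of "Y - Y'" "Suc q"] unfolding dbar_rel_def by auto
  then show ?thesis by simp
qed

lemma dbar_rel_dbar:
  assumes "u \<in> dom_dbar \<Omega> q"
  shows "u \<in> forms q" "dbar \<Omega> q u \<in> forms (Suc q)" "(emb u, emb (dbar \<Omega> q u)) \<in> dbar_rel q"
proof -
  have "has_dbar \<Omega> q u (dbar \<Omega> q u)"
    using assms someI_ex[of "has_dbar \<Omega> q u"] by (simp add: dom_dbar_def dbar_def)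
  then show "u \<in> forms q" "dbar \<Omega> q u \<in> forms (Suc q)" "(emb u, emb (dbar \<Omega> q u)) \<in> dbar_rel q"
    unfolding has_dbar_iff by auto
qed

lemma dom_dbarI:
  assumes "u \<in> forms q" "(emb u, Y) \<in> dbar_rel q"
  shows "u \<in> dom_dbar \<Omega> q" "emb (dbar \<Omega> q u) = Y"
proof -
  have "Y \<in> H (Suc q)" using assms(2) dbar_rel_subset by auto
  then obtain f where f: "f \<in> forms (Suc q)" "emb f = Y" by (rule H_cases)
  then have "has_dbar \<Omega> q u f" using assms unfolding has_dbar_iff by simp
  then show d: "u \<in> dom_dbar \<Omega> q" unfolding dom_dbar_def by blast
  show "emb (dbar \<Omega> q u) = Y"
    using dbar_rel_single_valued[OF dbar_rel_dbar(3)[OF d] assms(2)] .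
qed

lemma has_dbar_smult:
  assumes "has_dbar \<Omega> q u f"
  shows "has_dbar \<Omega> q (\<lambda>z. c *s u z) (\<lambda>z. c *s f z)"
proof -
  have "dist_dzbar \<Omega> j (\<lambda>z. (c *s u z) $ J) \<phi> = c * dist_dzbar \<Omega> j (\<lambda>z. u z $ J) \<phi>" for j J \<phi>
    unfolding dist_dzbar_def by (simp add: mult.assoc)
  then have "(\<Sum>j\<in>UNIV. \<Sum>J | card J = q. wedge_coeff j J K * dist_dzbar \<Omega> j (\<lambda>z. (c *s u z) $ J) \<phi>)
     = c * (\<Sum>j\<in>UNIV. \<Sum>J | card J = q. wedge_coeff j J K * dist_dzbar \<Omega> j (\<lambda>z. u z $ J) \<phi>)" for K \<phi>
    by (simp add: sum_distrib_left mult.left_commute[of _ c])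
  then show ?thesis using assms forms_smult unfolding has_dbar_def by (simp add: mult.assoc)
qed

lemma dbar_rel_smult:
  assumes "u \<in> forms q" "f \<in> forms (Suc q)" "(emb u, emb f) \<in> dbar_rel q"
  shows "(emb (\<lambda>z. c *s u z), emb (\<lambda>z. c *s f z)) \<in> dbar_rel q"
  using has_dbar_smult[of q u f c] assms unfolding has_dbar_iff by blast

text \<open>By the symmetry of second derivatives, against the sign change of the wedge product when
  two factors are exchanged.\<close>

lemma dbar_dbar_zero:
  assumes "(X, Y) \<in> dbar_rel q"
  shows "(Y, 0) \<in> dbar_rel (Suc q)"
proof -
  have XY: "X \<in> H q" "Y \<in> H (Suc q)" "\<And>K \<phi>. card K = Suc q \<Longrightarrow> \<phi> \<in> test_functions \<Omega> \<Longrightarrow> X \<bullet> formal_adj q K \<phi> = Y \<bullet> tv K \<phi>"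
    using assms unfolding dbar_rel_def by auto
  have "Y \<bullet> formal_adj (Suc q) K \<phi> = 0" if K: "card K = Suc (Suc q)" and \<phi>: "\<phi> \<in> test_functions \<Omega>" for K \<phi>
  proof -
    define W where "W j J K = Re (wedge_coeff j J K)" for j :: 'n and J K
    define t where "t I j k = X \<bullet> tv I (dzbar k (dzbar j \<phi>))" for I j k
    have tsym: "t I j k = t I k j" for I j k
    proof -
      have "dzbar k (dzbar j \<phi>) = dzbar j (dzbar k \<phi>)"
        by (rule ext) (rule dzbar_symmetric[OF test_functions_smooth[OF \<phi>]])
      then show ?thesis unfolding t_def by simp
    qed
    \<comment> \<open>The total weight with which component \<open>I\<close>, differentiated in
      \<open>k\<close> and \<open>j\<close>, enters component \<open>K\<close>.\<close>
    define c where "c I j k = (\<Sum>J | card J = Suc q. W j J K * W k I J)" for I j k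
    have c: "c I j k = (if j \<notin> I \<and> k \<notin> I \<and> j \<noteq> k \<and> K = insert j (insert k I) then wsgn j (insert k I) * wsgn k I else 0)" for I j k
    proof -
      have "W j J K * W k I J = (if J = insert k I then (if j \<notin> I \<and> k \<notin> I \<and> j \<noteq> k \<and> K = insert j (insert k I) then wsgn j (insert k I) * wsgn k I else 0) else 0)" for J
        unfolding W_def wedge_coeff_eq by auto
      then have "c I j k = (\<Sum>J | card J = Suc q. if J = insert k I then (if j \<notin> I \<and> k \<notin> I \<and> j \<noteq> k \<and> K = insert j (insert k I) then wsgn j (insert k I) * wsgn k I else 0) else 0)"
        unfolding c_def by simp
      also have "\<dots> = (if card (insert k I) = Suc q then (if j \<notin> I \<and> k \<notin> I \<and> j \<noteq> k \<and> K = insert j (insert k I) then wsgn j (insert k I) * wsgn k I else 0) else 0)"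
        by (subst sum.delta) auto
      also have "\<dots> = (if j \<notin> I \<and> k \<notin> I \<and> j \<noteq> k \<and> K = insert j (insert k I) then wsgn j (insert k I) * wsgn k I else 0)"
        using K by auto
      finally show ?thesis .
    qed
    have canti: "c I j k = - c I k j" for I j k
      unfolding c using wsgn_antisym[of j I k] by (auto simp: insert_commute)
    have "Y \<bullet> formal_adj (Suc q) K \<phi> = (\<Sum>j\<in>UNIV. \<Sum>J | card J = Suc q. - (W j J K * (Y \<bullet> tv J (dzbar j \<phi>))))"
      unfolding formal_adj_def W_def by (simp add: inner_sum_right)
    also have "\<dots> = (\<Sum>j\<in>UNIV. \<Sum>J | card J = Suc q. \<Sum>k\<in>UNIV. \<Sum>I | card I = q. W j J K * W k I J * t I j k)"
    proof (intro sum.cong refl)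
      fix j J assume "J \<in> {J :: 'n set. card J = Suc q}"
      then have "Y \<bullet> tv J (dzbar j \<phi>) = X \<bullet> formal_adj q J (dzbar j \<phi>)"
        using XY(3)[OF _ test_functions_dzbar[OF \<phi>]] by simp
      also have "\<dots> = - (\<Sum>k\<in>UNIV. \<Sum>I | card I = q. W k I J * t I j k)"
        unfolding formal_adj_def W_def t_def by (simp add: inner_sum_right sum_negf)
      finally show "- (W j J K * (Y \<bullet> tv J (dzbar j \<phi>))) = (\<Sum>k\<in>UNIV. \<Sum>I | card I = q. W j J K * W k I J * t I j k)"
        by (simp add: sum_distrib_left mult.assoc)
    qed
    also have "\<dots> = (\<Sum>j\<in>UNIV. \<Sum>k\<in>UNIV. \<Sum>J | card J = Suc q. \<Sum>I | card I = q. W j J K * W k I J * t I j k)"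
      by (intro sum.cong refl sum.swap)
    also have "\<dots> = (\<Sum>j\<in>UNIV. \<Sum>k\<in>UNIV. \<Sum>I | card I = q. \<Sum>J | card J = Suc q. W j J K * W k I J * t I j k)"
      by (intro sum.cong refl sum.swap)
    also have "\<dots> = (\<Sum>j\<in>UNIV. \<Sum>k\<in>UNIV. \<Sum>I | card I = q. c I j k * t I j k)"
      unfolding c_def by (simp add: sum_distrib_right)
    also have "\<dots> = (\<Sum>I | card I = q. \<Sum>j\<in>UNIV. \<Sum>k\<in>UNIV. c I j k * t I j k)"
    proof -
      have "(\<Sum>j\<in>UNIV. \<Sum>k\<in>UNIV. \<Sum>I | card I = q. c I j k * t I j k)
          = (\<Sum>j\<in>UNIV. \<Sum>I | card I = q. \<Sum>k\<in>UNIV. c I j k * t I j k)"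
        by (intro sum.cong refl sum.swap)
      then show ?thesis by (simp only: sum.swap[of _ UNIV "{I. card I = q}"])
    qed
    also have "\<dots> = 0"
    proof (rule sum.neutral, rule ballI)
      fix I :: "'n set"
      \<comment> \<open>Exchanging \<open>j\<close> and \<open>k\<close> fixes \<open>t\<close> and
        negates \<open>c\<close>, so the sum equals its own negative.\<close>
      define s where "s = (\<Sum>j\<in>UNIV. \<Sum>k\<in>UNIV. c I j k * t I j k)"
      have "s = (\<Sum>k\<in>UNIV. \<Sum>j\<in>UNIV. c I j k * t I j k)" unfolding s_def by (rule sum.swap)
      also have "\<dots> = (\<Sum>k\<in>UNIV. \<Sum>j\<in>UNIV. - (c I k j * t I k j))"
        using canti tsym by (intro sum.cong refl) (metis mult_minus_left)
      also have "\<dots> = - s" unfolding s_def by (simp add: sum_negf)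
      finally show "(\<Sum>j\<in>UNIV. \<Sum>k\<in>UNIV. c I j k * t I j k) = 0" unfolding s_def by simp
    qed
    finally show ?thesis .
  qed
  moreover have "0 \<in> H (Suc (Suc q))" by (rule subspace_0[OF F.subspace_range_L2])
  ultimately show ?thesis using XY(2) unfolding dbar_rel_def by auto
qed

subsection \<open>The adjoint operator\<close>

text \<open>These forms serve twice: they make the domain of \<open>D\<close> dense, and they are
  what the adjoint is tested with in the Fourier argument.\<close>

definition test_form :: "'n set \<Rightarrow> ((complex, 'n) vec \<Rightarrow> complex) \<Rightarrow> 'n form" where
  "test_form J \<psi> = (\<lambda>z. axis J (\<psi> z))"

definition dbar_test_form :: "'n set \<Rightarrow> ((complex, 'n) vec \<Rightarrow> complex) \<Rightarrow> 'n form" where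
  "dbar_test_form J \<psi> = (\<lambda>z. \<Sum>j\<in>- J. axis (insert j J) (complex_of_real (wsgn j J) * dzbar j \<psi> z))"

lemma sq_int_sum: "finite I \<Longrightarrow> (\<And>i. i \<in> I \<Longrightarrow> sq_int (f i)) \<Longrightarrow> sq_int (\<lambda>z. \<Sum>i\<in>I. f i z)"
  by (induction I rule: finite_induct) (auto intro: sq_int_zero sq_int_add)

lemma test_function_off:
  assumes "\<phi> \<in> test_functions \<Omega>" "z \<notin> \<Omega>"
  shows "\<phi> z = 0"
  using fun_cong[OF ext_test(1)[OF assms(1), of "\<lambda>z. 1"], of z] assms(2) by (simp add: ext_def)

lemma dbar_test_form_nth:
  "dbar_test_form J \<psi> z $ K = (\<Sum>j\<in>UNIV. wedge_coeff j J K * dzbar j \<psi> z)"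
proof -
  have "dbar_test_form J \<psi> z $ K = (\<Sum>j\<in>- J. wedge_coeff j J K * dzbar j \<psi> z)"
    unfolding dbar_test_form_def sum_component
    by (intro sum.cong refl) (auto simp: axis_def wedge_coeff_eq)
  also have "\<dots> = (\<Sum>j\<in>UNIV. wedge_coeff j J K * dzbar j \<psi> z)"
    by (rule sum.mono_neutral_left) (auto simp: wedge_coeff_eq)
  finally show ?thesis .
qed

lemma test_form_dbar:
  assumes J: "card J = q" and \<psi>: "\<psi> \<in> test_functions \<Omega>"
  shows "has_dbar \<Omega> q (test_form J \<psi>) (dbar_test_form J \<psi>)"
proof -
  have 1: "test_form J \<psi> \<in> forms q"
  proof -
    have "ext (test_form J \<psi>) = (\<lambda>z. axis J (\<psi> z))"
      using test_function_off[OF \<psi>] by (auto simp: ext_def test_form_def fun_eq_iff axis_def vec_eq_iff)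
    moreover have "test_form J \<psi> z $ I = 0" if "card I \<noteq> q" for z I
      using J that unfolding test_form_def axis_def by auto
    ultimately show ?thesis unfolding forms_iff
      using sq_int_axis[OF test_functions_sq_int[OF \<psi>]] by simp
  qed
  have 2: "dbar_test_form J \<psi> \<in> forms (Suc q)"
  proof -
    have "ext (dbar_test_form J \<psi>) = dbar_test_form J \<psi>"
      using test_function_off[OF test_functions_dzbar[OF \<psi>]]
      by (auto simp: ext_def fun_eq_iff dbar_test_form_nth vec_eq_iff)
    moreover have "dbar_test_form J \<psi> z $ I = 0" if "card I \<noteq> Suc q" for z I
      unfolding dbar_test_form_nth using J that by (intro sum.neutral) (auto simp: wedge_coeff_eq)
    moreover have "sq_int (dbar_test_form J \<psi>)"
      unfolding dbar_test_form_def
      by (intro sq_int_sum sq_int_axis test_functions_sq_int[OF test_functions_cmult[OF test_functions_dzbar[OF \<psi>]]]) simp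
    ultimately show ?thesis unfolding forms_iff by simp
  qed
  have "(\<Sum>j\<in>UNIV. \<Sum>I | card I = q. wedge_coeff j I K * dist_dzbar \<Omega> j (\<lambda>z. test_form J \<psi> z $ I) \<phi>)
      = (LINT z|lebesgue_on \<Omega>. dbar_test_form J \<psi> z $ K * \<phi> z)" if \<phi>: "\<phi> \<in> test_functions \<Omega>" for K \<phi>
  proof -
    have d: "dist_dzbar \<Omega> j (\<lambda>z. test_form J \<psi> z $ I) \<phi>
        = (if I = J then (LINT z|lebesgue. dzbar j \<psi> z * \<phi> z) else 0)" for j I
    proof (cases "I = J")
      case True
      have "dist_dzbar \<Omega> j (\<lambda>z. test_form J \<psi> z $ I) \<phi> = - (LINT z|lebesgue. \<psi> z * dzbar j \<phi> z)"
        unfolding dist_dzbar_def integral_on_domain ext_test(1)[OF test_functions_dzbar[OF \<phi>]]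
        using True by (simp add: test_form_def)
      then show ?thesis using True integral_dzbar_by_parts[OF test_functions_smooth[OF \<psi>] \<phi>] by simp
    next
      case False
      then show ?thesis unfolding dist_dzbar_def test_form_def by (simp add: axis_def)
    qed
    have "(\<Sum>j\<in>UNIV. \<Sum>I | card I = q. wedge_coeff j I K * dist_dzbar \<Omega> j (\<lambda>z. test_form J \<psi> z $ I) \<phi>)
      = (\<Sum>j\<in>UNIV. \<Sum>I | card I = q. if I = J then wedge_coeff j J K * (LINT z|lebesgue. dzbar j \<psi> z * \<phi> z) else 0)"
      unfolding d by (intro sum.cong refl) auto
    also have "\<dots> = (\<Sum>j\<in>UNIV. wedge_coeff j J K * (LINT z|lebesgue. dzbar j \<psi> z * \<phi> z))"
      using J by (simp add: sum.delta)
    also have "\<dots> = (LINT z|lebesgue. (\<Sum>j\<in>UNIV. wedge_coeff j J K * (dzbar j \<psi> z * \<phi> z)))"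
      using cinner_integrable[OF test_functions_sq_int[OF test_functions_dzbar[OF \<psi>]] test_functions_sq_int[OF \<phi>]]
      by (subst Bochner_Integration.integral_sum) auto
    also have "\<dots> = (LINT z|lebesgue_on \<Omega>. dbar_test_form J \<psi> z $ K * \<phi> z)"
      unfolding integral_on_domain ext_test(1)[OF \<phi>] dbar_test_form_nth
      by (simp add: sum_distrib_right mult.assoc)
    finally show ?thesis .
  qed
  then show ?thesis unfolding has_dbar_def using 1 2 by blast
qed

text \<open>The test forms lie in the domain, and a form orthogonal to all of them vanishes almost
  everywhere. Density makes the adjoint single valued.\<close>

lemma dbar_densely_defined:
  assumes w: "w \<in> H q" and orth: "\<And>u f. (u, f) \<in> dbar_rel q \<Longrightarrow> u \<bullet> w = 0"
  shows "w = 0"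
proof -
  obtain v where v: "v \<in> forms q" "emb v = w" using w by (rule H_cases)
  have test: "(LINT z|lebesgue. cnj (ext v z $ J) * \<psi> z) = 0" if J: "card J = q" and \<psi>: "\<psi> \<in> test_functions \<Omega>" for J \<psi>
  proof -
    have Re0: "Re (LINT z|lebesgue. cnj (ext v z $ J) * \<psi> z) = 0" if \<psi>: "\<psi> \<in> test_functions \<Omega>" for \<psi>
    proof -
      have d: "has_dbar \<Omega> q (test_form J \<psi>) (dbar_test_form J \<psi>)" by (rule test_form_dbar[OF J \<psi>])
      then have f: "test_form J \<psi> \<in> forms q" unfolding has_dbar_iff by simp
      have "emb (test_form J \<psi>) \<bullet> w = 0" using orth d unfolding has_dbar_iff by blast
      moreover have "emb (test_form J \<psi>) \<bullet> w = (LINT z|lebesgue. ext (test_form J \<psi>) z \<bullet> ext v z)"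
        unfolding v(2)[symmetric] emb_def by (intro inner_toL2 sq_int_ext[OF f] sq_int_ext[OF v(1)])
      moreover have "ext (test_form J \<psi>) z \<bullet> ext v z = Re (cnj (ext v z $ J) * \<psi> z)" for z
        by (simp add: ext_def test_form_def inner_axis' inner_complex_def)
      moreover have "(LINT z|lebesgue. Re (cnj (ext v z $ J) * \<psi> z)) = Re (LINT z|lebesgue. cnj (ext v z $ J) * \<psi> z)"
        by (intro integral_Re cinner_integrable sq_int_cnj sq_int_nth sq_int_ext[OF v(1)] test_functions_sq_int[OF \<psi>])
      ultimately show ?thesis by simp
    qed
    have "\<forall>\<psi>\<in>test_functions \<Omega>. (LINT z|lebesgue. cnj (ext v z $ J) * \<psi> z) = (\<lambda>\<psi>. 0) \<psi>"
      by (subst complex_linear_eq_iff) (auto simp: Re0 mult.left_commute)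
    then show ?thesis using \<psi> by simp
  qed
  have "AE z in lebesgue. ext v z $ J = 0" for J
  proof (cases "card J = q")
    case False
    then have "ext v z $ J = 0" for z using v(1) unfolding forms_iff by (auto simp: ext_def)
    then show ?thesis by simp
  next
    case True
    have "AE z in lebesgue. cnj (ext v z $ J) = 0"
    proof (rule test_functions_separate[OF _ open_domain _ test[OF True]])
      show "integrable lebesgue (\<lambda>z. cnj (ext v z $ J))"
        by (rule sq_int_domain_integrable[OF sq_int_cnj[OF sq_int_nth[OF sq_int_ext[OF v(1)]]]]) (simp add: ext_def)
    qed (auto simp: ext_def)
    then show ?thesis by simp
  qed
  then have "AE z in lebesgue. \<forall>J\<in>UNIV. ext v z $ J = 0" by (intro AE_finite_allI) auto
  then have "AE z in lebesgue. ext v z = 0" by eventually_elim (simp add: vec_eq_iff)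
  then show ?thesis using v(2) toL2_eq_iff[OF sq_int_ext[OF v(1)] sq_int_zero] unfolding emb_def toL2_zero by simp
qed

abbreviation "adj_rel q \<equiv> adjoint_rel (H q) (H (Suc q)) (dbar_rel q)"

lemma adj_rel_single_valued:
  assumes "(v, w) \<in> adj_rel q" "(v, w') \<in> adj_rel q"
  shows "w = w'"
proof -
  have "w - w' \<in> H q" using adjoint_relD(2)[OF assms(1)] adjoint_relD(2)[OF assms(2)]
    by (rule subspace_diff[OF F.subspace_range_L2])
  moreover have "u \<bullet> (w - w') = 0" if "(u, f) \<in> dbar_rel q" for u f
    using adjoint_relD(3)[OF assms(1) that] adjoint_relD(3)[OF assms(2) that] by (simp add: inner_diff_right)
  ultimately have "w - w' = 0" by (rule dbar_densely_defined)
  then show ?thesis by simp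
qed

text \<open>The real and the complex inner product define the same adjoint, because the graph of
  \<open>D\<close> is closed under complex multiples: testing with \<open>- \<i> * u\<close> gives
  the imaginary part.\<close>

lemma has_dbar_adj_iff:
  "has_dbar_adj \<Omega> q v w \<longleftrightarrow> v \<in> forms (Suc q) \<and> w \<in> forms q \<and> (emb v, emb w) \<in> adj_rel q"
proof (cases "v \<in> forms (Suc q) \<and> w \<in> forms q")
  case True
  then have v: "v \<in> forms (Suc q)" and w: "w \<in> forms q" by auto
  have "(\<forall>u\<in>dom_dbar \<Omega> q. L2_inner \<Omega> (dbar \<Omega> q u) v = L2_inner \<Omega> u w) \<longleftrightarrow> (emb v, emb w) \<in> adj_rel q"
  proof
    assume *: "\<forall>u\<in>dom_dbar \<Omega> q. L2_inner \<Omega> (dbar \<Omega> q u) v = L2_inner \<Omega> u w"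
    show "(emb v, emb w) \<in> adj_rel q"
    proof (rule adjoint_relI)
      fix X Y assume XY: "(X, Y) \<in> dbar_rel q"
      then have "X \<in> H q" using dbar_rel_subset by auto
      then obtain u where u: "u \<in> forms q" "emb u = X" by (rule H_cases)
      have d: "u \<in> dom_dbar \<Omega> q" "emb (dbar \<Omega> q u) = Y" using dom_dbarI[OF u(1), of Y] XY u(2) by auto
      have "Re (L2_inner \<Omega> (dbar \<Omega> q u) v) = Re (L2_inner \<Omega> u w)" using * d(1) by simp
      then show "Y \<bullet> emb v = X \<bullet> emb w"
        unfolding Re_L2_inner[OF dbar_rel_dbar(2)[OF d(1)] v] Re_L2_inner[OF u(1) w] d(2) u(2) .
    qed (use v w emb_in_H in auto)
  next
    assume adj: "(emb v, emb w) \<in> adj_rel q"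
    show "\<forall>u\<in>dom_dbar \<Omega> q. L2_inner \<Omega> (dbar \<Omega> q u) v = L2_inner \<Omega> u w"
    proof
      fix u assume u: "u \<in> dom_dbar \<Omega> q"
      note d = dbar_rel_dbar[OF u]
      have Re: "Re (L2_inner \<Omega> (\<lambda>z. c *s dbar \<Omega> q u z) v) = Re (L2_inner \<Omega> (\<lambda>z. c *s u z) w)" for c
        unfolding Re_L2_inner[OF forms_smult[OF d(2)] v] Re_L2_inner[OF forms_smult[OF d(1)] w]
        by (rule adjoint_relD(3)[OF adj dbar_rel_smult[OF d]])
      show "L2_inner \<Omega> (dbar \<Omega> q u) v = L2_inner \<Omega> u w"
        using Re[of 1] Re[of "- \<i>"] unfolding L2_inner_smult_left by (simp add: complex_eq_iff)
    qed
  qed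
  then show ?thesis unfolding has_dbar_adj_def using True by blast
qed (auto simp: has_dbar_adj_def)

lemma adj_rel_dbar_adj:
  assumes "v \<in> dom_dbar_adj \<Omega> q"
  shows "v \<in> forms (Suc q)" "dbar_adj \<Omega> q v \<in> forms q" "(emb v, emb (dbar_adj \<Omega> q v)) \<in> adj_rel q"
proof -
  have "has_dbar_adj \<Omega> q v (dbar_adj \<Omega> q v)"
    using assms someI_ex[of "has_dbar_adj \<Omega> q v"] by (simp add: dom_dbar_adj_def dbar_adj_def)
  then show "v \<in> forms (Suc q)" "dbar_adj \<Omega> q v \<in> forms q" "(emb v, emb (dbar_adj \<Omega> q v)) \<in> adj_rel q"
    unfolding has_dbar_adj_iff by auto
qed

lemma dom_dbar_adjI:
  assumes "v \<in> forms (Suc q)" "(emb v, Y) \<in> adj_rel q"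
  shows "v \<in> dom_dbar_adj \<Omega> q" "emb (dbar_adj \<Omega> q v) = Y"
proof -
  obtain w where w: "w \<in> forms q" "emb w = Y" using adjoint_relD(2)[OF assms(2)] by (rule H_cases)
  then have "has_dbar_adj \<Omega> q v w" using assms unfolding has_dbar_adj_iff by simp
  then show d: "v \<in> dom_dbar_adj \<Omega> q" unfolding dom_dbar_adj_def by blast
  show "emb (dbar_adj \<Omega> q v) = Y"
    using adj_rel_single_valued[OF adj_rel_dbar_adj(3)[OF d] assms(2)] .
qed

lemma adj_rel_smult:
  assumes "v \<in> forms (Suc q)" "w \<in> forms q" "(emb v, emb w) \<in> adj_rel q"
  shows "(emb (\<lambda>z. c *s v z), emb (\<lambda>z. c *s w z)) \<in> adj_rel q"
proof -
  have "has_dbar_adj \<Omega> q v w" using assms unfolding has_dbar_adj_iff by simp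
  then have "has_dbar_adj \<Omega> q (\<lambda>z. c *s v z) (\<lambda>z. c *s w z)"
    unfolding has_dbar_adj_def by (auto simp: L2_inner_smult_right forms_smult)
  then show ?thesis unfolding has_dbar_adj_iff by simp
qed

end

section \<open>The symbol of the complex\<close>

text \<open>The Fourier version of the identity \<open>\<Box> = - (1/4) \<Delta>\<close> on forms: wedge and interior
  multiplication by a covector \<open>\<zeta>\<close> satisfy \<open>\<zeta>\<^sup>* (\<zeta> \<and> v) + \<zeta> \<and> (\<zeta>\<^sup>* v) = |\<zeta>|\<^sup>2 v\<close>.\<close>

lemma symbol_identity:
  fixes \<zeta> :: "'n::{finite,linorder} \<Rightarrow> complex" and v A B :: "'n set \<Rightarrow> complex"
  assumes A: "\<And>K. card K = Suc q \<Longrightarrow> (\<Sum>j\<in>K. complex_of_real (wsgn j (K - {j})) * \<zeta> j * v (K - {j})) = A K"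
    and B: "\<And>I. Suc (card I) = q \<Longrightarrow> (\<Sum>j\<in>- I. complex_of_real (wsgn j I) * cnj (\<zeta> j) * v (insert j I)) = B I"
    and J: "card J = q"
  shows "complex_of_real (\<Sum>j\<in>UNIV. (norm (\<zeta> j))\<^sup>2) * v J
    = (\<Sum>j\<in>- J. complex_of_real (wsgn j J) * cnj (\<zeta> j) * A (insert j J))
    + (\<Sum>k\<in>J. complex_of_real (wsgn k (J - {k})) * \<zeta> k * B (J - {k}))"
proof -
  \<comment> \<open>The mixed terms, with \<open>j\<close> outside and \<open>k\<close> inside
    \<open>J\<close>. The two orders of wedge and interior multiplication produce them with opposite
    signs, so only the diagonal survives.\<close>
  define X where "X j k = complex_of_real (wsgn j (J - {k}) * wsgn k (J - {k})) * cnj (\<zeta> j) * \<zeta> k * v (insert j (J - {k}))" for j k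
  have sq: "complex_of_real (wsgn j I) * complex_of_real (wsgn j I) = 1" for j :: 'n and I
    using wsgn_sq[of j I] by (metis of_real_1 of_real_mult)
  have nsq: "cnj (\<zeta> j) * \<zeta> j = complex_of_real ((norm (\<zeta> j))\<^sup>2)" for j
    using complex_norm_square[of "\<zeta> j"] by (simp add: mult.commute)
  have 1: "complex_of_real (wsgn j J) * cnj (\<zeta> j) * A (insert j J)
      = complex_of_real ((norm (\<zeta> j))\<^sup>2) * v J - (\<Sum>k\<in>J. X j k)" if j: "j \<in> - J" for j
  proof -
    have cK: "card (insert j J) = Suc q" using j J by simp
    have "A (insert j J) = complex_of_real (wsgn j J) * \<zeta> j * v J
        + (\<Sum>k\<in>J. complex_of_real (wsgn k (insert j J - {k})) * \<zeta> k * v (insert j J - {k}))"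
      unfolding A[OF cK, symmetric] using j by (subst sum.insert) auto
    then have "complex_of_real (wsgn j J) * cnj (\<zeta> j) * A (insert j J)
      = (complex_of_real (wsgn j J) * complex_of_real (wsgn j J)) * (cnj (\<zeta> j) * \<zeta> j) * v J
        + (\<Sum>k\<in>J. complex_of_real (wsgn j J) * cnj (\<zeta> j) * (complex_of_real (wsgn k (insert j J - {k})) * \<zeta> k * v (insert j J - {k})))"
      by (simp add: distrib_left sum_distrib_left mult_ac)
    also have "(\<Sum>k\<in>J. complex_of_real (wsgn j J) * cnj (\<zeta> j) * (complex_of_real (wsgn k (insert j J - {k})) * \<zeta> k * v (insert j J - {k})))
        = (\<Sum>k\<in>J. - X j k)"
    proof (rule sum.cong)
      fix k assume k: "k \<in> J"
      have eq: "insert j J - {k} = insert j (J - {k})" "insert k (J - {k}) = J" using j k by auto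
      have "wsgn j (insert k (J - {k})) * wsgn k (insert j (J - {k})) = - (wsgn j (J - {k}) * wsgn k (J - {k}))"
        by (rule wsgn_exchange) (use j k in auto)
      then have "complex_of_real (wsgn j J) * complex_of_real (wsgn k (insert j (J - {k}))) = - complex_of_real (wsgn j (J - {k}) * wsgn k (J - {k}))"
        unfolding eq(2) by (simp flip: of_real_mult)
      then have "(complex_of_real (wsgn j J) * complex_of_real (wsgn k (insert j (J - {k})))) * (cnj (\<zeta> j) * \<zeta> k * v (insert j (J - {k})))
        = - X j k"
        unfolding X_def by (simp add: mult_ac)
      then show "complex_of_real (wsgn j J) * cnj (\<zeta> j) * (complex_of_real (wsgn k (insert j J - {k})) * \<zeta> k * v (insert j J - {k})) = - X j k"
        unfolding eq(1) by (simp add: mult_ac)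
    qed simp
    finally show ?thesis unfolding sq nsq by (simp add: sum_negf)
  qed
  have 2: "complex_of_real (wsgn k (J - {k})) * \<zeta> k * B (J - {k})
      = complex_of_real ((norm (\<zeta> k))\<^sup>2) * v J + (\<Sum>j\<in>- J. X j k)" if k: "k \<in> J" for k
  proof -
    have cI: "Suc (card (J - {k})) = q" using k J by (metis card_Suc_Diff1 finite)
    have co: "- (J - {k}) = insert k (- J)" using k by auto
    have "B (J - {k}) = complex_of_real (wsgn k (J - {k})) * cnj (\<zeta> k) * v J
        + (\<Sum>j\<in>- J. complex_of_real (wsgn j (J - {k})) * cnj (\<zeta> j) * v (insert j (J - {k})))"
      unfolding B[OF cI, symmetric] co using k by (subst sum.insert) (auto simp: insert_absorb)
    then have "complex_of_real (wsgn k (J - {k})) * \<zeta> k * B (J - {k})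
      = (complex_of_real (wsgn k (J - {k})) * complex_of_real (wsgn k (J - {k}))) * (cnj (\<zeta> k) * \<zeta> k) * v J
        + (\<Sum>j\<in>- J. X j k)"
      unfolding X_def by (simp add: distrib_left sum_distrib_left mult_ac)
    then show ?thesis unfolding sq nsq by simp
  qed
  have "(\<Sum>j\<in>- J. complex_of_real (wsgn j J) * cnj (\<zeta> j) * A (insert j J))
      + (\<Sum>k\<in>J. complex_of_real (wsgn k (J - {k})) * \<zeta> k * B (J - {k}))
    = ((\<Sum>j\<in>- J. complex_of_real ((norm (\<zeta> j))\<^sup>2) * v J) + (\<Sum>k\<in>J. complex_of_real ((norm (\<zeta> k))\<^sup>2) * v J))
      - (\<Sum>j\<in>- J. \<Sum>k\<in>J. X j k) + (\<Sum>k\<in>J. \<Sum>j\<in>- J. X j k)"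
    using 1 2 by (simp add: sum_subtractf sum.distrib)
  also have "(\<Sum>k\<in>J. \<Sum>j\<in>- J. X j k) = (\<Sum>j\<in>- J. \<Sum>k\<in>J. X j k)" by (rule sum.swap)
  also have "(\<Sum>j\<in>- J. complex_of_real ((norm (\<zeta> j))\<^sup>2) * v J) + (\<Sum>k\<in>J. complex_of_real ((norm (\<zeta> k))\<^sup>2) * v J)
      = (\<Sum>j\<in>- J \<union> J. complex_of_real ((norm (\<zeta> j))\<^sup>2) * v J)"
    by (rule sum.union_disjoint[symmetric]) auto
  also have "- J \<union> J = UNIV" by auto
  finally show ?thesis by (simp add: sum_distrib_right)
qed

text \<open>In \<open>symbol_identity\<close> each index \<open>j\<close> contributes one term, with
  a factor of modulus \<open>norm (\<zeta> j)\<close>. Cauchy-Schwarz bounds the square of the sum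
  by \<open>|\<zeta>|^2\<close> times the sum of squares, and one factor \<open>|\<zeta>|^2\<close>
  cancels.\<close>

lemma symbol_bound:
  fixes \<zeta> :: "'n::{finite,linorder} \<Rightarrow> complex" and v A B :: "'n set \<Rightarrow> complex"
  assumes A: "\<And>K. card K = Suc q \<Longrightarrow> (\<Sum>j\<in>K. complex_of_real (wsgn j (K - {j})) * \<zeta> j * v (K - {j})) = A K"
    and B: "\<And>I. Suc (card I) = q \<Longrightarrow> (\<Sum>j\<in>- I. complex_of_real (wsgn j I) * cnj (\<zeta> j) * v (insert j I)) = B I"
    and J: "card J = q"
  shows "(\<Sum>j\<in>UNIV. (norm (\<zeta> j))\<^sup>2) * (norm (v J))\<^sup>2
    \<le> (\<Sum>j\<in>UNIV. (norm (if j \<in> J then B (J - {j}) else A (insert j J)))\<^sup>2)"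
proof -
  define D where "D j = (if j \<in> J then B (J - {j}) else A (insert j J))" for j
  define s where "s j = (if j \<in> J then complex_of_real (wsgn j (J - {j})) * \<zeta> j else complex_of_real (wsgn j J) * cnj (\<zeta> j))" for j
  define Z where "Z = (\<Sum>j\<in>UNIV. (norm (\<zeta> j))\<^sup>2)"
  have Z: "Z \<ge> 0" unfolding Z_def by (intro sum_nonneg) auto
  have w1: "\<bar>wsgn j I\<bar> = 1" for j :: 'n and I unfolding wsgn_def by (simp add: power_abs)
  have ns: "norm (s j) = norm (\<zeta> j)" for j unfolding s_def by (simp add: norm_mult w1)
  have "complex_of_real Z * v J
      = (\<Sum>j\<in>- J. complex_of_real (wsgn j J) * cnj (\<zeta> j) * A (insert j J))
      + (\<Sum>k\<in>J. complex_of_real (wsgn k (J - {k})) * \<zeta> k * B (J - {k}))"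
    unfolding Z_def by (rule symbol_identity[OF A B J])
  also have "\<dots> = (\<Sum>j\<in>- J. s j * D j) + (\<Sum>j\<in>J. s j * D j)"
    by (intro arg_cong2[where f = "(+)"] sum.cong) (auto simp: s_def D_def)
  also have "\<dots> = (\<Sum>j\<in>- J \<union> J. s j * D j)" by (rule sum.union_disjoint[symmetric]) auto
  also have "- J \<union> J = UNIV" by auto
  finally have "Z * norm (v J) = norm (\<Sum>j\<in>UNIV. s j * D j)" using Z by (metis abs_of_nonneg norm_mult norm_of_real)
  also have "\<dots> \<le> (\<Sum>j\<in>UNIV. norm (\<zeta> j) * norm (D j))" by (rule sum_norm_le) (simp add: norm_mult ns)
  finally have "(Z * norm (v J))\<^sup>2 \<le> (\<Sum>j\<in>UNIV. norm (\<zeta> j) * norm (D j))\<^sup>2"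
    using Z by (intro power_mono) auto
  also have "\<dots> \<le> Z * (\<Sum>j\<in>UNIV. (norm (D j))\<^sup>2)"
    unfolding Z_def by (rule Cauchy_Schwarz_ineq_sum)
  finally have *: "Z * (Z * (norm (v J))\<^sup>2) \<le> Z * (\<Sum>j\<in>UNIV. (norm (D j))\<^sup>2)"
    by (simp add: power_mult_distrib power2_eq_square mult_ac)
  show ?thesis
  proof (cases "Z = 0")
    case True
    then show ?thesis unfolding Z_def[symmetric] by (simp add: sum_nonneg)
  next
    case False
    then show ?thesis using * Z unfolding Z_def[symmetric] D_def[symmetric] by (simp add: mult_le_cancel_left_pos)
  qed
qed

section \<open>Interior ellipticity\<close>

text \<open>\<open>h\<close> lies in \<open>smooth_alg\<close> so that its product with an
  exponential is again smooth, and it is real so that it passes through the conjugation in the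
  adjoint equation.\<close>

locale form_cube = form_domain \<Omega> + fourier_cube L "TYPE((complex, 'n) vec)"
  for \<Omega> :: "((complex, 'n::{finite,linorder}) vec) set" and L +
  fixes h :: "(complex, 'n) vec \<Rightarrow> complex"
  assumes h: "h \<in> test_functions \<Omega>" and h_alg: "smooth_alg h" and h_real: "cnj (h z) = h z" and h_le: "norm (h z) \<le> 1"
    and domain_cube: "\<Omega> \<subseteq> cube"
begin

section \<open>Fourier coefficients of truncated forms\<close>

lemma sq_int_mult_bounded:
  fixes f g :: "(complex, 'n) vec \<Rightarrow> complex"
  assumes "sq_int f" "g \<in> borel_measurable lebesgue" "\<And>z. norm (g z) \<le> D"
  shows "sq_int (\<lambda>z. g z * f z)"
proof (rule sq_int_bound)
  show "(\<lambda>z. g z * f z) \<in> borel_measurable lebesgue"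
    using assms by (intro borel_measurable_times) (auto simp: sq_int_def)
  show "integrable lebesgue (\<lambda>z. D\<^sup>2 * (norm (f z))\<^sup>2)" using assms(1) unfolding sq_int_def by simp
  show "(norm (g z * f z))\<^sup>2 \<le> D\<^sup>2 * (norm (f z))\<^sup>2" for z
    unfolding norm_mult power_mult_distrib using assms(3)[of z] by (intro mult_right_mono power_mono) auto
qed

definition admissible :: "((complex, 'n) vec \<Rightarrow> complex) \<Rightarrow> bool" where
  "admissible f \<longleftrightarrow> sq_int f \<and> (\<forall>z. z \<notin> \<Omega> \<longrightarrow> f z = 0)"

lemma admissible_mult:
  assumes "admissible f" "\<phi> \<in> test_functions \<Omega>"
  shows "admissible (\<lambda>z. \<phi> z * f z)" "admissible (\<lambda>z. cnj (\<phi> z) * f z)"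
proof -
  obtain B where B: "B \<ge> 0" "\<And>z. norm (\<phi> z) \<le> B" using test_functions_bounded[OF assms(2)] by blast
  have m: "\<phi> \<in> borel_measurable lebesgue" "(\<lambda>z. cnj (\<phi> z)) \<in> borel_measurable lebesgue"
    using sq_int_measurable test_functions_sq_int[OF assms(2)] sq_int_cnj by blast+
  show "admissible (\<lambda>z. \<phi> z * f z)" "admissible (\<lambda>z. cnj (\<phi> z) * f z)"
    using assms(1) sq_int_mult_bounded[OF _ m(1), of f B] sq_int_mult_bounded[OF _ m(2), of f B] B(2)
    unfolding admissible_def by auto
qed

lemma admissible_cmult: "admissible f \<Longrightarrow> admissible (\<lambda>z. c * f z)"
  using sq_int_mult_bounded[of f "\<lambda>z. c" "norm c"] unfolding admissible_def by auto

lemma admissible_add: "admissible f \<Longrightarrow> admissible g \<Longrightarrow> admissible (\<lambda>z. f z + g z)"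
  unfolding admissible_def by (auto intro: sq_int_add)

lemma admissible_diff: "admissible f \<Longrightarrow> admissible g \<Longrightarrow> admissible (\<lambda>z. f z - g z)"
  unfolding admissible_def by (auto intro: sq_int_diff)

lemma admissible_sum: "finite I \<Longrightarrow> (\<And>i. i \<in> I \<Longrightarrow> admissible (f i)) \<Longrightarrow> admissible (\<lambda>z. \<Sum>i\<in>I. f i z)"
  unfolding admissible_def by (auto intro: sq_int_sum)

lemma admissible_cube:
  assumes "admissible f"
  shows "sq_int f" "z \<notin> cube \<Longrightarrow> f z = 0"
  using assms domain_cube unfolding admissible_def by auto

lemma coeff_integrable:
  assumes "admissible f"
  shows "integrable lebesgue (\<lambda>z. f z * cis (- (z \<bullet> \<mu>)))"
proof -
  have "integrable lebesgue f" by (rule sq_int_cube_integrable[OF admissible_cube[OF assms]])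
  from integrable_mult_bounded[OF this cis_measurable[of "- \<mu>"], of 1] show ?thesis by simp
qed

lemma coeff_add: "admissible f \<Longrightarrow> admissible g \<Longrightarrow> coeff (\<lambda>z. f z + g z) \<mu> = coeff f \<mu> + coeff g \<mu>"
  unfolding coeff_def distrib_right by (intro Bochner_Integration.integral_add coeff_integrable)

lemma coeff_diff: "admissible f \<Longrightarrow> admissible g \<Longrightarrow> coeff (\<lambda>z. f z - g z) \<mu> = coeff f \<mu> - coeff g \<mu>"
  unfolding coeff_def left_diff_distrib by (intro Bochner_Integration.integral_diff coeff_integrable)

lemma coeff_cmult: "coeff (\<lambda>z. c * f z) \<mu> = c * coeff f \<mu>"
  unfolding coeff_def mult.assoc by (rule integral_mult_right_zero)

lemma coeff_sum: "(\<And>i. i \<in> I \<Longrightarrow> admissible (f i)) \<Longrightarrow> coeff (\<lambda>z. \<Sum>i\<in>I. f i z) \<mu> = (\<Sum>i\<in>I. coeff (f i) \<mu>)"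
  unfolding coeff_def sum_distrib_right by (intro Bochner_Integration.integral_sum coeff_integrable)

text \<open>The cutoff sits on the exponential, which turns it into a test function of
  \<open>\<Omega>\<close> and hence into a legitimate argument of the weak definitions.\<close>

definition character :: "(complex, 'n) vec \<Rightarrow> (complex, 'n) vec \<Rightarrow> complex" where
  "character \<mu> z = h z * cis (z \<bullet> \<mu>)"

lemma character_test: "character \<mu> \<in> test_functions \<Omega>"
proof -
  obtain K where K: "smooth_on h UNIV" "compact K" "K \<subseteq> \<Omega>" "\<forall>x. x \<notin> K \<longrightarrow> h x = 0"
    "\<forall>x v. x \<notin> K \<longrightarrow> frechet_derivative h (at x) v = 0"
    using h by (rule test_functionsE)
  have "smooth_alg (character \<mu>)" unfolding character_def[abs_def] by (intro smooth_alg.mult smooth_alg.cis h_alg)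
  then show ?thesis
    by (rule test_functionsI[OF smooth_alg_smooth_on K(2,3)]) (simp add: character_def K(4))
qed

lemma dzbar_character:
  "dzbar j (character \<mu>) z = (dzbar j h z + \<i> * (\<mu> $ j / 2) * h z) * cis (z \<bullet> \<mu>)"
proof -
  have "dzbar j (character \<mu>) z = dzbar j h z * cis (z \<bullet> \<mu>) + h z * dzbar j (\<lambda>z. cis (z \<bullet> \<mu>)) z"
    unfolding character_def[abs_def]
    by (intro dzbar_mult smooth_on_differentiable smooth_alg_smooth_on smooth_alg.cis h_alg)
  then show ?thesis unfolding dzbar_cis by (simp add: algebra_simps)
qed

lemma form_admissible:
  assumes "u \<in> forms q"
  shows "admissible (\<lambda>z. ext u z $ J)"
  unfolding admissible_def
proof (intro conjI allI impI)
  show "sq_int (\<lambda>z. ext u z $ J)" by (rule sq_int_nth[OF sq_int_ext[OF assms]])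
qed (simp add: ext_def)

lemma ext_nth: "ext (\<lambda>z. u z $ J * g z) = (\<lambda>z. ext u z $ J * g z)"
  for g :: "(complex, 'n) vec \<Rightarrow> complex" and u :: "'n form"
  by (auto simp: ext_def fun_eq_iff)

text \<open>For \<open>f = D u\<close> this is the \<open>K\<close>-component of
  \<open>D (h u)\<close>: the term \<open>h f\<close> and the commutator with \<open>h\<close>. No
  derivative of \<open>u\<close> is left, so it is controlled by \<open>f\<close> and
  \<open>u\<close>.\<close>

definition wedge_err :: "'n form \<Rightarrow> 'n form \<Rightarrow> 'n set \<Rightarrow> (complex, 'n) vec \<Rightarrow> complex" where
  "wedge_err u f K z = h z * ext f z $ K + (\<Sum>j\<in>K. complex_of_real (wsgn j (K - {j})) * (dzbar j h z * ext u z $ (K - {j})))"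

text \<open>For \<open>g = D* u\<close> this is the \<open>I\<close>-component of the formal adjoint
  of \<open>D\<close> on \<open>h u\<close>; as \<open>h\<close> is real, the conjugate of
  \<open>dzbar j h\<close> is its derivative in \<open>z_j\<close>.\<close>

definition interior_err :: "'n form \<Rightarrow> 'n form \<Rightarrow> 'n set \<Rightarrow> (complex, 'n) vec \<Rightarrow> complex" where
  "interior_err u g I z = h z * ext g z $ I - (\<Sum>j\<in>- I. complex_of_real (wsgn j I) * (cnj (dzbar j h z) * ext u z $ (insert j I)))"

lemma admissible_err:
  assumes "u \<in> forms q" "f \<in> forms q'"
  shows "admissible (wedge_err u f K)" "admissible (interior_err u f I)"
  unfolding wedge_err_def[abs_def] interior_err_def[abs_def]
  by (intro admissible_add admissible_diff admissible_sum admissible_cmult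
      admissible_mult(1)[OF form_admissible[OF assms(2)] h]
      admissible_mult(1)[OF form_admissible[OF assms(1)] test_functions_dzbar[OF h]]
      admissible_mult(2)[OF form_admissible[OF assms(1)] test_functions_dzbar[OF h]] finite)+

text \<open>Test the equation for \<open>D u\<close> with \<open>character (- \<mu>)\<close>. The
  derivative falls either on the exponential, giving the factor \<open>\<mu> $ j / 2\<close>, or on
  \<open>h\<close>, giving the commutator term.\<close>

lemma wedge_coeffs:
  assumes d: "has_dbar \<Omega> q u f" and K: "card K = Suc q"
  shows "(\<Sum>j\<in>K. complex_of_real (wsgn j (K - {j})) * (\<mu> $ j / 2) * coeff (\<lambda>z. h z * ext u z $ (K - {j})) \<mu>)
    = - \<i> * coeff (wedge_err u f K) \<mu>"
proof -
  have u: "u \<in> forms q" and f: "f \<in> forms (Suc q)" using d unfolding has_dbar_def by auto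
  define V where "V I = coeff (\<lambda>z. h z * ext u z $ I) \<mu>" for I
  define W where "W j I = coeff (\<lambda>z. dzbar j h z * ext u z $ I) \<mu>" for j I
  have dd: "dist_dzbar \<Omega> j (\<lambda>z. u z $ I) (character (- \<mu>)) = \<i> * (\<mu> $ j / 2) * V I - W j I" for j I
  proof -
    have "dist_dzbar \<Omega> j (\<lambda>z. u z $ I) (character (- \<mu>)) = - (LINT z|lebesgue. ext u z $ I * dzbar j (character (- \<mu>)) z)"
      unfolding dist_dzbar_def integral_on_domain ext_nth ..
    also have "(\<lambda>z. ext u z $ I * dzbar j (character (- \<mu>)) z)
        = (\<lambda>z. (dzbar j h z * ext u z $ I - (\<i> * (\<mu> $ j / 2)) * (h z * ext u z $ I)) * cis (- (z \<bullet> \<mu>)))"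
      unfolding dzbar_character by (simp add: algebra_simps)
    also have "(LINT z|lebesgue. (dzbar j h z * ext u z $ I - (\<i> * (\<mu> $ j / 2)) * (h z * ext u z $ I)) * cis (- (z \<bullet> \<mu>)))
        = W j I - (\<i> * (\<mu> $ j / 2)) * V I"
      unfolding coeff_def[symmetric] W_def V_def coeff_cmult[symmetric]
      by (intro coeff_diff admissible_cmult admissible_mult(1)[OF form_admissible[OF u]] h test_functions_dzbar)
    finally show ?thesis by simp
  qed
  have "(\<Sum>j\<in>UNIV. \<Sum>I | card I = q. wedge_coeff j I K * dist_dzbar \<Omega> j (\<lambda>z. u z $ I) (character (- \<mu>)))
      = (LINT z|lebesgue_on \<Omega>. f z $ K * character (- \<mu>) z)"
    using d K character_test unfolding has_dbar_def by blast
  also have "(LINT z|lebesgue_on \<Omega>. f z $ K * character (- \<mu>) z) = coeff (\<lambda>z. h z * ext f z $ K) \<mu>"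
    unfolding integral_on_domain ext_nth coeff_def character_def by (simp add: mult_ac)
  also have "(\<Sum>j\<in>UNIV. \<Sum>I | card I = q. wedge_coeff j I K * dist_dzbar \<Omega> j (\<lambda>z. u z $ I) (character (- \<mu>)))
      = (\<Sum>j\<in>UNIV. if j \<in> K then complex_of_real (wsgn j (K - {j})) * (\<i> * (\<mu> $ j / 2) * V (K - {j}) - W j (K - {j})) else 0)"
    unfolding sum_wedge_coeff[OF K] dd ..
  also have "\<dots> = (\<Sum>j\<in>K. complex_of_real (wsgn j (K - {j})) * (\<i> * (\<mu> $ j / 2) * V (K - {j}) - W j (K - {j})))"
    by (simp add: sum.If_cases)
  also have "\<dots> = \<i> * (\<Sum>j\<in>K. complex_of_real (wsgn j (K - {j})) * (\<mu> $ j / 2) * V (K - {j}))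
      - (\<Sum>j\<in>K. complex_of_real (wsgn j (K - {j})) * W j (K - {j}))"
    unfolding sum_distrib_left sum_subtractf[symmetric] by (intro sum.cong) (auto simp: algebra_simps)
  finally have "\<i> * (\<Sum>j\<in>K. complex_of_real (wsgn j (K - {j})) * (\<mu> $ j / 2) * V (K - {j}))
    = coeff (\<lambda>z. h z * ext f z $ K) \<mu> + (\<Sum>j\<in>K. complex_of_real (wsgn j (K - {j})) * W j (K - {j}))"
    by (simp add: algebra_simps)
  also have "\<dots> = coeff (wedge_err u f K) \<mu>"
    unfolding wedge_err_def[abs_def] W_def coeff_cmult[symmetric]
    by (subst coeff_add, (intro admissible_sum admissible_cmult admissible_mult(1)[OF form_admissible[OF f] h]
          admissible_mult(1)[OF form_admissible[OF u] test_functions_dzbar[OF h]] finite)+,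
        subst coeff_sum, (intro admissible_cmult admissible_mult(1)[OF form_admissible[OF u] test_functions_dzbar[OF h]]), rule refl)
  finally have "- \<i> * (\<i> * (\<Sum>j\<in>K. complex_of_real (wsgn j (K - {j})) * (\<mu> $ j / 2) * V (K - {j}))) = - \<i> * coeff (wedge_err u f K) \<mu>"
    by simp
  then show ?thesis unfolding V_def by (simp add: mult.assoc[symmetric])
qed

text \<open>The adjoint relation in complex form, for any value \<open>f\<close> of
  \<open>D u\<close> and not only the chosen one; the multiple by \<open>- \<i>\<close> supplies the
  imaginary part.\<close>

lemma adj_L2_inner:
  assumes "v \<in> forms (Suc p)" "w \<in> forms p" "(emb v, emb w) \<in> adj_rel p" and d: "has_dbar \<Omega> p u f"
  shows "L2_inner \<Omega> f v = L2_inner \<Omega> u w"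
proof -
  have u: "u \<in> forms p" "f \<in> forms (Suc p)" "(emb u, emb f) \<in> dbar_rel p" using d unfolding has_dbar_iff by auto
  have Re: "Re (L2_inner \<Omega> (\<lambda>z. c *s f z) v) = Re (L2_inner \<Omega> (\<lambda>z. c *s u z) w)" for c
    unfolding Re_L2_inner[OF forms_smult[OF u(2)] assms(1)] Re_L2_inner[OF forms_smult[OF u(1)] assms(2)]
    by (rule adjoint_relD(3)[OF assms(3) dbar_rel_smult[OF u]])
  show ?thesis using Re[of 1] Re[of "- \<i>"] unfolding L2_inner_smult_left by (simp add: complex_eq_iff)
qed

text \<open>Test the adjoint with the form whose only component is \<open>character \<mu>\<close>,
  and conjugate. Conjugation turns the exponential into the kernel of \<open>coeff\<close> and fixes
  \<open>h\<close>.\<close>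

lemma interior_coeffs:
  assumes u: "u \<in> forms (Suc p)" and g: "g \<in> forms p" and adj: "(emb u, emb g) \<in> adj_rel p" and I: "card I = p"
  shows "(\<Sum>j\<in>- I. complex_of_real (wsgn j I) * cnj (\<mu> $ j / 2) * coeff (\<lambda>z. h z * ext u z $ (insert j I)) \<mu>)
    = \<i> * coeff (interior_err u g I) \<mu>"
proof -
  define V where "V J = coeff (\<lambda>z. h z * ext u z $ J) \<mu>" for J
  define W where "W j J = coeff (\<lambda>z. cnj (dzbar j h z) * ext u z $ J) \<mu>" for j J
  have "cnj (L2_inner \<Omega> (dbar_test_form I (character \<mu>)) u) = cnj (L2_inner \<Omega> (test_form I (character \<mu>)) g)"
    using adj_L2_inner[OF u g adj test_form_dbar[OF I character_test]] by simp
  also have "cnj (L2_inner \<Omega> (test_form I (character \<mu>)) g) = coeff (\<lambda>z. h z * ext g z $ I) \<mu>"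
  proof -
    have "L2_inner \<Omega> (test_form I (character \<mu>)) g = (LINT z|lebesgue. character \<mu> z * cnj (ext g z $ I))"
      unfolding L2_inner_def integral_on_domain
    proof (intro Bochner_Integration.integral_cong refl)
      fix z
      have "(\<Sum>J\<in>UNIV. test_form I (character \<mu>) z $ J * cnj (g z $ J)) = (\<Sum>J\<in>UNIV. if J = I then character \<mu> z * cnj (g z $ I) else 0)"
        by (intro sum.cong) (auto simp: test_form_def axis_def)
      then show "ext (\<lambda>z. \<Sum>J\<in>UNIV. test_form I (character \<mu>) z $ J * cnj (g z $ J)) z = character \<mu> z * cnj (ext g z $ I)"
        by (auto simp: ext_def)
    qed
    then have "cnj (L2_inner \<Omega> (test_form I (character \<mu>)) g) = (LINT z|lebesgue. cnj (character \<mu> z * cnj (ext g z $ I)))"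
      by (simp only: Bochner_Integration.integral_cnj)
    also have "\<dots> = coeff (\<lambda>z. h z * ext g z $ I) \<mu>"
      unfolding coeff_def character_def by (simp add: h_real mult_ac cis_cnj)
    finally show ?thesis .
  qed
  also have "cnj (L2_inner \<Omega> (dbar_test_form I (character \<mu>)) u)
    = (\<Sum>j\<in>- I. complex_of_real (wsgn j I) * (W j (insert j I) - \<i> * (cnj (\<mu> $ j / 2)) * V (insert j I)))"
  proof -
    have "L2_inner \<Omega> (dbar_test_form I (character \<mu>)) u
      = (LINT z|lebesgue. (\<Sum>j\<in>- I. complex_of_real (wsgn j I) * (dzbar j (character \<mu>) z * cnj (ext u z $ insert j I))))"
      unfolding L2_inner_def integral_on_domain
    proof (intro Bochner_Integration.integral_cong refl)
      fix z
      have "(\<Sum>K\<in>UNIV. dbar_test_form I (character \<mu>) z $ K * cnj (u z $ K))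
          = (\<Sum>K\<in>UNIV. \<Sum>j\<in>- I. if K = insert j I then complex_of_real (wsgn j I) * dzbar j (character \<mu>) z * cnj (u z $ K) else 0)"
        unfolding dbar_test_form_def sum_component sum_distrib_right by (intro sum.cong) (auto simp: axis_def)
      also have "\<dots> = (\<Sum>j\<in>- I. \<Sum>K\<in>UNIV. if K = insert j I then complex_of_real (wsgn j I) * dzbar j (character \<mu>) z * cnj (u z $ K) else 0)"
        by (rule sum.swap)
      also have "\<dots> = (\<Sum>j\<in>- I. complex_of_real (wsgn j I) * (dzbar j (character \<mu>) z * cnj (u z $ insert j I)))"
        by (simp add: mult.assoc)
      finally show "ext (\<lambda>z. \<Sum>K\<in>UNIV. dbar_test_form I (character \<mu>) z $ K * cnj (u z $ K)) z
        = (\<Sum>j\<in>- I. complex_of_real (wsgn j I) * (dzbar j (character \<mu>) z * cnj (ext u z $ insert j I)))"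
        by (auto simp: ext_def)
    qed
    then have "cnj (L2_inner \<Omega> (dbar_test_form I (character \<mu>)) u)
      = (LINT z|lebesgue. cnj (\<Sum>j\<in>- I. complex_of_real (wsgn j I) * (dzbar j (character \<mu>) z * cnj (ext u z $ insert j I))))"
      by (simp only: Bochner_Integration.integral_cnj)
    also have "(\<lambda>z. cnj (\<Sum>j\<in>- I. complex_of_real (wsgn j I) * (dzbar j (character \<mu>) z * cnj (ext u z $ insert j I))))
      = (\<lambda>z. (\<Sum>j\<in>- I. complex_of_real (wsgn j I) * (cnj (dzbar j h z) * ext u z $ insert j I
          - \<i> * (cnj (\<mu> $ j / 2)) * (h z * ext u z $ insert j I))) * cis (- (z \<bullet> \<mu>)))"
      unfolding dzbar_character sum_distrib_right
      by (auto simp: h_real cis_cnj algebra_simps intro!: sum.cong)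
    also have "(LINT z|lebesgue. (\<Sum>j\<in>- I. complex_of_real (wsgn j I) * (cnj (dzbar j h z) * ext u z $ insert j I
          - \<i> * (cnj (\<mu> $ j / 2)) * (h z * ext u z $ insert j I))) * cis (- (z \<bullet> \<mu>)))
      = (\<Sum>j\<in>- I. complex_of_real (wsgn j I) * (W j (insert j I) - \<i> * (cnj (\<mu> $ j / 2)) * V (insert j I)))"
      unfolding coeff_def[symmetric] W_def V_def
    proof (subst coeff_sum)
      show "admissible (\<lambda>z. complex_of_real (wsgn j I) * (cnj (dzbar j h z) * ext u z $ insert j I
          - \<i> * (cnj (\<mu> $ j / 2)) * (h z * ext u z $ insert j I)))" for j
        by (intro admissible_cmult admissible_diff admissible_mult[OF form_admissible[OF u]] h test_functions_dzbar)
      show "(\<Sum>j\<in>- I. coeff (\<lambda>z. complex_of_real (wsgn j I) * (cnj (dzbar j h z) * ext u z $ insert j I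
            - \<i> * (cnj (\<mu> $ j / 2)) * (h z * ext u z $ insert j I))) \<mu>)
        = (\<Sum>j\<in>- I. complex_of_real (wsgn j I) * (coeff (\<lambda>z. cnj (dzbar j h z) * ext u z $ insert j I) \<mu>
            - \<i> * (cnj (\<mu> $ j / 2)) * coeff (\<lambda>z. h z * ext u z $ insert j I) \<mu>))"
      proof (intro sum.cong refl)
        fix j
        have "coeff (\<lambda>z. cnj (dzbar j h z) * ext u z $ insert j I - \<i> * (cnj (\<mu> $ j / 2)) * (h z * ext u z $ insert j I)) \<mu>
          = coeff (\<lambda>z. cnj (dzbar j h z) * ext u z $ insert j I) \<mu> - coeff (\<lambda>z. \<i> * (cnj (\<mu> $ j / 2)) * (h z * ext u z $ insert j I)) \<mu>"
          by (intro coeff_diff admissible_cmult admissible_mult[OF form_admissible[OF u]] h test_functions_dzbar)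
        then show "coeff (\<lambda>z. complex_of_real (wsgn j I) * (cnj (dzbar j h z) * ext u z $ insert j I
            - \<i> * (cnj (\<mu> $ j / 2)) * (h z * ext u z $ insert j I))) \<mu>
          = complex_of_real (wsgn j I) * (coeff (\<lambda>z. cnj (dzbar j h z) * ext u z $ insert j I) \<mu>
            - \<i> * (cnj (\<mu> $ j / 2)) * coeff (\<lambda>z. h z * ext u z $ insert j I) \<mu>)"
          by (simp only: coeff_cmult)
      qed
    qed
    finally show ?thesis .
  qed
  also have "\<dots> = (\<Sum>j\<in>- I. complex_of_real (wsgn j I) * W j (insert j I))
      - \<i> * (\<Sum>j\<in>- I. complex_of_real (wsgn j I) * cnj (\<mu> $ j / 2) * V (insert j I))"
    unfolding sum_distrib_left sum_subtractf[symmetric] by (intro sum.cong) (auto simp: algebra_simps)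
  finally have "\<i> * (\<Sum>j\<in>- I. complex_of_real (wsgn j I) * cnj (\<mu> $ j / 2) * V (insert j I))
    = - (coeff (\<lambda>z. h z * ext g z $ I) \<mu> - (\<Sum>j\<in>- I. complex_of_real (wsgn j I) * W j (insert j I)))"
    by (simp add: algebra_simps)
  also have "coeff (\<lambda>z. h z * ext g z $ I) \<mu> - (\<Sum>j\<in>- I. complex_of_real (wsgn j I) * W j (insert j I))
    = coeff (interior_err u g I) \<mu>"
    unfolding interior_err_def[abs_def] W_def coeff_cmult[symmetric]
    by (subst coeff_diff, (intro admissible_sum admissible_cmult admissible_mult(1)[OF form_admissible[OF g] h]
          admissible_mult(2)[OF form_admissible[OF u] test_functions_dzbar[OF h]] finite)+,
        subst coeff_sum, (intro admissible_cmult admissible_mult(2)[OF form_admissible[OF u] test_functions_dzbar[OF h]]), rule refl)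
  finally have "- \<i> * (\<i> * (\<Sum>j\<in>- I. complex_of_real (wsgn j I) * cnj (\<mu> $ j / 2) * V (insert j I))) = \<i> * coeff (interior_err u g I) \<mu>"
    by simp
  then show ?thesis unfolding V_def by (simp add: mult.assoc[symmetric])
qed

text \<open>The symbol bound for the covector \<open>\<mu> $ j / 2\<close>, with the coefficients of
  \<open>h u\<close> as \<open>v\<close>. The factors \<open>\<i>\<close> and \<open>- \<i>\<close>
  disappear in the norms.\<close>

lemma ellipticity:
  assumes d: "has_dbar \<Omega> (Suc p) u f" and g: "g \<in> forms p" and adj: "(emb u, emb g) \<in> adj_rel p" and J: "card J = Suc p"
  shows "(norm \<mu>)\<^sup>2 / 4 * (norm (coeff (\<lambda>z. h z * ext u z $ J) \<mu>))\<^sup>2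
    \<le> (\<Sum>j\<in>UNIV. (norm (coeff (if j \<in> J then interior_err u g (J - {j}) else wedge_err u f (insert j J)) \<mu>))\<^sup>2)"
proof -
  have u: "u \<in> forms (Suc p)" using d unfolding has_dbar_def by auto
  have "(\<Sum>j\<in>UNIV. (norm (\<mu> $ j / 2))\<^sup>2) * (norm (coeff (\<lambda>z. h z * ext u z $ J) \<mu>))\<^sup>2
    \<le> (\<Sum>j\<in>UNIV. (norm (if j \<in> J then \<i> * coeff (interior_err u g (J - {j})) \<mu> else - \<i> * coeff (wedge_err u f (insert j J)) \<mu>))\<^sup>2)"
    by (rule symbol_bound[where v = "\<lambda>J. coeff (\<lambda>z. h z * ext u z $ J) \<mu>" and q = "Suc p"])
      (use wedge_coeffs[OF d] interior_coeffs[OF u g adj] J in auto)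
  also have "(\<Sum>j\<in>UNIV. (norm (\<mu> $ j / 2))\<^sup>2) = (norm \<mu>)\<^sup>2 / 4"
    by (simp add: norm_vec_def L2_set_def sum_nonneg norm_divide power_divide sum_divide_distrib)
  also have "(\<Sum>j\<in>UNIV. (norm (if j \<in> J then \<i> * coeff (interior_err u g (J - {j})) \<mu> else - \<i> * coeff (wedge_err u f (insert j J)) \<mu>))\<^sup>2)
    = (\<Sum>j\<in>UNIV. (norm (coeff (if j \<in> J then interior_err u g (J - {j}) else wedge_err u f (insert j J)) \<mu>))\<^sup>2)"
    by (intro sum.cong) (auto simp: norm_mult)
  finally show ?thesis .
qed

section \<open>Bounds for the error functions and splitting of the frequencies\<close>

lemma dzbar_h_bound:
  obtains D where "D \<ge> 0" "\<forall>j z. norm (dzbar j h z) \<le> D"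
proof -
  have "\<exists>B\<ge>0. \<forall>z. norm (dzbar j h z) \<le> B" for j
    using test_functions_bounded[OF test_functions_dzbar[OF h]] by blast
  then obtain B where B: "\<And>j. B j \<ge> 0" "\<And>j z. norm (dzbar j h z) \<le> B j" by metis
  have "norm (dzbar j h z) \<le> (\<Sum>j\<in>UNIV. B j)" for j z
    using B(2)[of j z] member_le_sum[of j UNIV B] B(1) by simp
  then show thesis using that[of "\<Sum>j\<in>UNIV. B j"] B(1) by (simp add: sum_nonneg)
qed

lemma sq_sum_le:
  fixes x a b c :: real
  assumes "0 \<le> x" "x \<le> a + c * b"
  shows "x\<^sup>2 \<le> 2 * a\<^sup>2 + 2 * c\<^sup>2 * b\<^sup>2"
proof -
  have "x\<^sup>2 \<le> (a + c * b)\<^sup>2" using assms by (intro power_mono)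
  also have "\<dots> \<le> 2 * a\<^sup>2 + 2 * c\<^sup>2 * b\<^sup>2"
    using sum_squares_bound[of a "c * b"] unfolding power2_sum power_mult_distrib by linarith
  finally show ?thesis .
qed

text \<open>At most \<open>CARD('n)\<close> commutator terms occur, each bounded by
  \<open>D * norm (ext u z)\<close>; the factors \<open>2\<close> come from squaring a sum of two
  terms.\<close>

lemma err_bound:
  assumes u: "u \<in> forms q" and f: "f \<in> forms q'" and D: "D \<ge> 0" "\<forall>j z. norm (dzbar j h z) \<le> D"
  shows "(LINT z|lebesgue. (norm (wedge_err u f K z))\<^sup>2) \<le> 2 * (norm (emb f))\<^sup>2 + 2 * (real CARD('n) * D)\<^sup>2 * (norm (emb u))\<^sup>2"
    and "(LINT z|lebesgue. (norm (interior_err u f I z))\<^sup>2) \<le> 2 * (norm (emb f))\<^sup>2 + 2 * (real CARD('n) * D)\<^sup>2 * (norm (emb u))\<^sup>2"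
proof -
  have w1: "\<bar>wsgn j I\<bar> = 1" for j :: 'n and I unfolding wsgn_def by (simp add: power_abs)
  have sums: "norm (\<Sum>j\<in>K. complex_of_real (wsgn j (F j)) * (X j z * ext u z $ G j)) \<le> real CARD('n) * D * norm (ext u z)"
    if "\<And>j. norm (X j z) \<le> D" for K :: "'n set" and F X G z
  proof -
    have "norm (\<Sum>j\<in>K. complex_of_real (wsgn j (F j)) * (X j z * ext u z $ G j)) \<le> (\<Sum>j\<in>K. D * norm (ext u z))"
    proof (rule sum_norm_le)
      fix j
      have "norm (X j z) * norm (ext u z $ G j) \<le> D * norm (ext u z)"
        using that D by (intro mult_mono Finite_Cartesian_Product.norm_nth_le) auto
      then show "norm (complex_of_real (wsgn j (F j)) * (X j z * ext u z $ G j)) \<le> D * norm (ext u z)"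
        by (simp add: norm_mult w1)
    qed
    also have "\<dots> \<le> (\<Sum>j\<in>(UNIV :: 'n set). D * norm (ext u z))"
      using D by (intro sum_mono2) auto
    finally show ?thesis by simp
  qed
  have hF: "norm (h z * ext f z $ K) \<le> norm (ext f z)" for z K
    unfolding norm_mult using mult_mono[OF h_le[of z] Finite_Cartesian_Product.norm_nth_le[of "ext f z" K]] by simp
  have 1: "(norm (wedge_err u f K z))\<^sup>2 \<le> 2 * (norm (ext f z))\<^sup>2 + 2 * (real CARD('n) * D)\<^sup>2 * (norm (ext u z))\<^sup>2" for z
    unfolding wedge_err_def
    by (rule sq_sum_le[OF norm_ge_zero order_trans[OF norm_triangle_ineq add_mono[OF hF sums]]]) (use D in auto)
  have 2: "(norm (interior_err u f I z))\<^sup>2 \<le> 2 * (norm (ext f z))\<^sup>2 + 2 * (real CARD('n) * D)\<^sup>2 * (norm (ext u z))\<^sup>2" for z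
    unfolding interior_err_def
    by (rule sq_sum_le[OF norm_ge_zero order_trans[OF norm_triangle_ineq4 add_mono[OF hF sums[of "\<lambda>j z. cnj (dzbar j h z)"]]]]) (use D in auto)
  have int: "integrable lebesgue (\<lambda>z. (norm (ext f z))\<^sup>2)" "integrable lebesgue (\<lambda>z. (norm (ext u z))\<^sup>2)"
    using sq_int_ext[OF f] sq_int_ext[OF u] unfolding sq_int_def by auto
  have I: "(LINT z|lebesgue. 2 * (norm (ext f z))\<^sup>2 + 2 * (real CARD('n) * D)\<^sup>2 * (norm (ext u z))\<^sup>2)
    = 2 * (norm (emb f))\<^sup>2 + 2 * (real CARD('n) * D)\<^sup>2 * (norm (emb u))\<^sup>2"
    unfolding emb_def norm_toL2_sq[OF sq_int_ext[OF f]] norm_toL2_sq[OF sq_int_ext[OF u]]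
    using int by (subst Bochner_Integration.integral_add) auto
  have "integrable lebesgue (\<lambda>z. (norm (wedge_err u f K z))\<^sup>2)" "integrable lebesgue (\<lambda>z. (norm (interior_err u f I z))\<^sup>2)"
    using admissible_err[OF u f] unfolding admissible_def sq_int_def by auto
  then show "(LINT z|lebesgue. (norm (wedge_err u f K z))\<^sup>2) \<le> 2 * (norm (emb f))\<^sup>2 + 2 * (real CARD('n) * D)\<^sup>2 * (norm (emb u))\<^sup>2"
    "(LINT z|lebesgue. (norm (interior_err u f I z))\<^sup>2) \<le> 2 * (norm (emb f))\<^sup>2 + 2 * (real CARD('n) * D)\<^sup>2 * (norm (emb u))\<^sup>2"
    unfolding I[symmetric] using 1 2 int
    by (intro integral_mono Bochner_Integration.integrable_add integrable_mult_right; simp)+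
qed

text \<open>For \<open>norm \<mu> > R\<close> ellipticity gains \<open>4 / R^2\<close>, and Bessel's
  inequality bounds each of the \<open>CARD('n)\<close> error functions by \<open>vol * K\<close>,
  whatever the finite set \<open>M\<close> is.\<close>

lemma high_frequencies:
  assumes d: "has_dbar \<Omega> (Suc p) u f" and g: "g \<in> forms p" and adj: "(emb u, emb g) \<in> adj_rel p" and J: "card J = Suc p"
    and D: "D \<ge> 0" "\<forall>j z. norm (dzbar j h z) \<le> D"
    and K: "2 * (norm (emb f))\<^sup>2 + 2 * (real CARD('n) * D)\<^sup>2 * (norm (emb u))\<^sup>2 \<le> K"
      "2 * (norm (emb g))\<^sup>2 + 2 * (real CARD('n) * D)\<^sup>2 * (norm (emb u))\<^sup>2 \<le> K"
    and R: "R > 0" and M: "finite M" "M \<subseteq> lattice" "\<And>\<mu>. \<mu> \<in> M \<Longrightarrow> norm \<mu> > R"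
  shows "(\<Sum>\<mu>\<in>M. (norm (coeff (\<lambda>z. h z * ext u z $ J) \<mu>))\<^sup>2) \<le> 4 / R\<^sup>2 * (real CARD('n) * (vol * K))"
proof -
  have u: "u \<in> forms (Suc p)" and f: "f \<in> forms (Suc (Suc p))" using d unfolding has_dbar_def by auto
  define E where "E j = (if j \<in> J then interior_err u g (J - {j}) else wedge_err u f (insert j J))" for j
  have 1: "(norm (coeff (\<lambda>z. h z * ext u z $ J) \<mu>))\<^sup>2 \<le> 4 / R\<^sup>2 * (\<Sum>j\<in>UNIV. (norm (coeff (E j) \<mu>))\<^sup>2)" if "\<mu> \<in> M" for \<mu>
  proof -
    have "R\<^sup>2 \<le> (norm \<mu>)\<^sup>2" using M(3)[OF that] R by (intro power_mono) auto
    then have "R\<^sup>2 / 4 * (norm (coeff (\<lambda>z. h z * ext u z $ J) \<mu>))\<^sup>2 \<le> (norm \<mu>)\<^sup>2 / 4 * (norm (coeff (\<lambda>z. h z * ext u z $ J) \<mu>))\<^sup>2"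
      by (intro mult_right_mono divide_right_mono) auto
    also have "\<dots> \<le> (\<Sum>j\<in>UNIV. (norm (coeff (E j) \<mu>))\<^sup>2)"
      unfolding E_def by (rule ellipticity[OF d g adj J])
    finally show ?thesis using R by (simp add: field_simps)
  qed
  have 2: "(\<Sum>\<mu>\<in>M. (norm (coeff (E j) \<mu>))\<^sup>2) \<le> vol * K" for j
  proof -
    have "admissible (E j)" unfolding E_def using admissible_err[OF u f] admissible_err[OF u g] by auto
    from bessel[OF admissible_cube[OF this] M(1,2)]
    have "(\<Sum>\<mu>\<in>M. (norm (coeff (E j) \<mu>))\<^sup>2) \<le> vol * (LINT z|lebesgue. (norm (E j z))\<^sup>2)" .
    also have "(LINT z|lebesgue. (norm (E j z))\<^sup>2) \<le> K"
      unfolding E_def using order_trans[OF err_bound(1)[OF u f D] K(1)] order_trans[OF err_bound(2)[OF u g D] K(2)] by auto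
    finally show ?thesis using vol_pos by (simp add: mult_left_mono)
  qed
  have "(\<Sum>\<mu>\<in>M. (norm (coeff (\<lambda>z. h z * ext u z $ J) \<mu>))\<^sup>2) \<le> (\<Sum>\<mu>\<in>M. 4 / R\<^sup>2 * (\<Sum>j\<in>UNIV. (norm (coeff (E j) \<mu>))\<^sup>2))"
    by (rule sum_mono) (rule 1)
  also have "\<dots> = 4 / R\<^sup>2 * (\<Sum>j\<in>UNIV. \<Sum>\<mu>\<in>M. (norm (coeff (E j) \<mu>))\<^sup>2)"
    unfolding sum_distrib_left[symmetric] by (subst sum.swap) simp
  also have "\<dots> \<le> 4 / R\<^sup>2 * (\<Sum>j\<in>(UNIV :: 'n set). vol * K)"
    by (intro mult_left_mono sum_mono 2) simp
  finally show ?thesis by simp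
qed

lemma low_frequencies:
  assumes d: "has_dbar \<Omega> (Suc p) u f" and g: "g \<in> forms p" and adj: "(emb u, emb g) \<in> adj_rel p" and J: "card J = Suc p"
    and D: "D \<ge> 0" "\<forall>j z. norm (dzbar j h z) \<le> D"
    and K: "2 * (norm (emb f))\<^sup>2 + 2 * (real CARD('n) * D)\<^sup>2 * (norm (emb u))\<^sup>2 \<le> K"
      "2 * (norm (emb g))\<^sup>2 + 2 * (real CARD('n) * D)\<^sup>2 * (norm (emb u))\<^sup>2 \<le> K"
    and R: "R > 0"
  shows "vol * (LINT z|lebesgue. (norm (h z * ext u z $ J))\<^sup>2)
    \<le> (\<Sum>\<mu>\<in>{\<mu>\<in>lattice. norm \<mu> \<le> R}. (norm (coeff (\<lambda>z. h z * ext u z $ J) \<mu>))\<^sup>2) + 4 / R\<^sup>2 * (real CARD('n) * (vol * K))"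
\<comment> \<open>Parseval holds only up to an error \<open>e\<close>, for a set \<open>M\<close>
  depending on it; the bound obtained does not depend on \<open>M\<close>.\<close>
proof (rule field_le_epsilon)
  fix e :: real assume e: "e > 0"
  have u: "u \<in> forms (Suc p)" using d unfolding has_dbar_def by auto
  have adm: "admissible (\<lambda>z. h z * ext u z $ J)" by (rule admissible_mult(1)[OF form_admissible[OF u] h])
  define c where "c \<mu> = (norm (coeff (\<lambda>z. h z * ext u z $ J) \<mu>))\<^sup>2" for \<mu>
  obtain M where M: "finite M" "M \<subseteq> lattice" "vol * (LINT z|lebesgue. (norm (h z * ext u z $ J))\<^sup>2) \<le> (\<Sum>\<mu>\<in>M. c \<mu>) + e"
    using parseval[OF admissible_cube[OF adm] e] unfolding c_def by blast
  have "(\<Sum>\<mu>\<in>M. c \<mu>) = (\<Sum>\<mu>\<in>{\<mu>\<in>M. norm \<mu> \<le> R} \<union> {\<mu>\<in>M. norm \<mu> > R}. c \<mu>)"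
    by (rule sum.cong) auto
  also have "\<dots> = (\<Sum>\<mu>\<in>{\<mu>\<in>M. norm \<mu> \<le> R}. c \<mu>) + (\<Sum>\<mu>\<in>{\<mu>\<in>M. norm \<mu> > R}. c \<mu>)"
    using M(1) by (intro sum.union_disjoint) auto
  also have "(\<Sum>\<mu>\<in>{\<mu>\<in>M. norm \<mu> \<le> R}. c \<mu>) \<le> (\<Sum>\<mu>\<in>{\<mu>\<in>lattice. norm \<mu> \<le> R}. c \<mu>)"
    using M(2) finite_lattice_ball[of R] by (intro sum_mono2) (auto simp: c_def)
  also have "(\<Sum>\<mu>\<in>{\<mu>\<in>M. norm \<mu> > R}. c \<mu>) \<le> 4 / R\<^sup>2 * (real CARD('n) * (vol * K))"
    unfolding c_def using M(1,2) by (intro high_frequencies[OF d g adj J D K R]) auto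
  finally show "vol * (LINT z|lebesgue. (norm (h z * ext u z $ J))\<^sup>2)
    \<le> (\<Sum>\<mu>\<in>{\<mu>\<in>lattice. norm \<mu> \<le> R}. (norm (coeff (\<lambda>z. h z * ext u z $ J) \<mu>))\<^sup>2) + 4 / R\<^sup>2 * (real CARD('n) * (vol * K)) + e"
    using M(3) unfolding c_def by linarith
qed

text \<open>The real and imaginary part of a coefficient are real linear functionals of
  \<open>emb u\<close>; the factor \<open>- \<i>\<close> produces the second one.\<close>

lemma coeff_as_inner:
  assumes u: "u \<in> forms q"
  shows "(norm (coeff (\<lambda>z. h z * ext u z $ J) \<mu>))\<^sup>2
    = (emb u \<bullet> tv J (character (- \<mu>)))\<^sup>2 + (emb u \<bullet> tv J (\<lambda>z. - \<i> * character (- \<mu>) z))\<^sup>2"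
proof -
  have c: "coeff (\<lambda>z. h z * ext u z $ J) \<mu> = (LINT z|lebesgue_on \<Omega>. u z $ J * character (- \<mu>) z)"
    unfolding integral_on_domain ext_nth coeff_def character_def by (simp add: mult_ac)
  have "(LINT z|lebesgue_on \<Omega>. u z $ J * (- \<i> * character (- \<mu>) z)) = - \<i> * coeff (\<lambda>z. h z * ext u z $ J) \<mu>"
    unfolding c mult.left_commute[of _ "- \<i>"] by (rule integral_mult_right_zero)
  then show ?thesis
    unfolding inner_tv[OF u character_test] inner_tv[OF u test_functions_cmult[OF character_test]] c[symmetric]
    by (simp add: cmod_power2)
qed

text \<open>Rellich's theorem for the truncated form \<open>h u\<close>, in quantitative form.\<close>

lemma interior_compactness:
  assumes e: "e > 0" and c: "c \<ge> 0"
  obtains Y B where "finite Y" "B \<ge> 0"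
    "\<forall>u f g. has_dbar \<Omega> (Suc p) u f \<longrightarrow> g \<in> forms p \<longrightarrow> (emb u, emb g) \<in> adj_rel p \<longrightarrow> norm (emb f) \<le> 1 \<longrightarrow> norm (emb g) \<le> 1 \<longrightarrow> norm (emb u) \<le> c \<longrightarrow>
      (LINT z|lebesgue. (norm (h z * norm (ext u z)))\<^sup>2) \<le> e + B * (\<Sum>y\<in>Y. (emb u \<bullet> y)\<^sup>2)"
proof -
  obtain D where D: "D \<ge> 0" "\<forall>j z. norm (dzbar j h z) \<le> D" by (rule dzbar_h_bound)
  \<comment> \<open>Bounds both error estimates when \<open>f\<close> and \<open>g\<close> have norm
    at most \<open>1\<close> and \<open>u\<close> has norm at most \<open>c\<close>.\<close>
  define K where "K = 2 + 2 * (real CARD('n) * D)\<^sup>2 * c\<^sup>2"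
  have K: "K > 0" unfolding K_def by (simp add: add_pos_nonneg)
  define N where "N = real CARD('n set)"
  have N: "N > 0" unfolding N_def by (simp add: card_gt_0_iff)
  \<comment> \<open>Makes the high frequency term of one component equal to
    \<open>vol * (e / N)\<close>, so that the \<open>N\<close> components together contribute
    \<open>e\<close>.\<close>
  define R where "R = sqrt (4 * N * real CARD('n) * K / e)"
  have N1: "real CARD('n) > 0" by (simp add: card_gt_0_iff)
  have R: "R > 0" unfolding R_def using N N1 K e by simp
  have R2: "R\<^sup>2 = 4 * N * real CARD('n) * K / e" unfolding R_def using N N1 K e by simp
  define \<Lambda> where "\<Lambda> = {\<mu>\<in>lattice. norm \<mu> \<le> R}"
  have \<Lambda>: "finite \<Lambda>" unfolding \<Lambda>_def by (rule finite_lattice_ball)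
  define y1 where "y1 = (\<lambda>(J, \<mu>). tv J (character (- \<mu>)))"
  define y2 where "y2 = (\<lambda>(J, \<mu>). tv J (\<lambda>z. - \<i> * character (- \<mu>) z))"
  define Y where "Y = y1 ` (UNIV \<times> \<Lambda>) \<union> y2 ` (UNIV \<times> \<Lambda>)"
  have Y: "finite Y" unfolding Y_def using \<Lambda> by auto
  \<comment> \<open>For each of the \<open>N\<close> components there are
    \<open>card \<Lambda>\<close> low frequencies, and each squared coefficient is a sum of two
    squares of functionals in \<open>Y\<close>.\<close>
  define B where "B = N * (real (card \<Lambda>) * 2) / vol"
  have B: "B \<ge> 0" unfolding B_def using N vol_pos by simp
  have "(LINT z|lebesgue. (norm (h z * norm (ext u z)))\<^sup>2) \<le> e + B * (\<Sum>y\<in>Y. (emb u \<bullet> y)\<^sup>2)"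
    if d: "has_dbar \<Omega> (Suc p) u f" and g: "g \<in> forms p" and adj: "(emb u, emb g) \<in> adj_rel p"
      and n: "norm (emb f) \<le> 1" "norm (emb g) \<le> 1" "norm (emb u) \<le> c" for u f g
  proof -
    have u: "u \<in> forms (Suc p)" using d unfolding has_dbar_def by auto
    define S where "S = (\<Sum>y\<in>Y. (emb u \<bullet> y)\<^sup>2)"
    have S: "S \<ge> 0" unfolding S_def by (intro sum_nonneg) auto
    have "(norm (emb f))\<^sup>2 \<le> 1" "(norm (emb g))\<^sup>2 \<le> 1" using n by (auto intro: power_le_one)
    moreover have "(norm (emb u))\<^sup>2 \<le> c\<^sup>2" using n by (intro power_mono) auto
    then have "2 * (real CARD('n) * D)\<^sup>2 * (norm (emb u))\<^sup>2 \<le> 2 * (real CARD('n) * D)\<^sup>2 * c\<^sup>2"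
      by (intro mult_left_mono) auto
    ultimately have KK: "2 * (norm (emb f))\<^sup>2 + 2 * (real CARD('n) * D)\<^sup>2 * (norm (emb u))\<^sup>2 \<le> K"
      "2 * (norm (emb g))\<^sup>2 + 2 * (real CARD('n) * D)\<^sup>2 * (norm (emb u))\<^sup>2 \<le> K"
      unfolding K_def by linarith+
    have low: "(norm (coeff (\<lambda>z. h z * ext u z $ J) \<mu>))\<^sup>2 \<le> 2 * S" if "\<mu> \<in> \<Lambda>" for J \<mu>
    proof -
      have "y1 (J, \<mu>) \<in> Y" "y2 (J, \<mu>) \<in> Y" unfolding Y_def using that by auto
      then have "(emb u \<bullet> y1 (J, \<mu>))\<^sup>2 \<le> S" "(emb u \<bullet> y2 (J, \<mu>))\<^sup>2 \<le> S"
        unfolding S_def using Y by (auto intro: member_le_sum)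
      then show ?thesis unfolding coeff_as_inner[OF u] y1_def y2_def by simp
    qed
    have comp: "(LINT z|lebesgue. (norm (h z * ext u z $ J))\<^sup>2) \<le> (real (card \<Lambda>) * (2 * S)) / vol + e / N" for J
    proof (cases "card J = Suc p")
      case False
      then have "ext u z $ J = 0" for z using u unfolding forms_iff by (auto simp: ext_def)
      then show ?thesis using S e N vol_pos by simp
    next
      case True
      have "vol * (LINT z|lebesgue. (norm (h z * ext u z $ J))\<^sup>2)
        \<le> (\<Sum>\<mu>\<in>\<Lambda>. (norm (coeff (\<lambda>z. h z * ext u z $ J) \<mu>))\<^sup>2) + 4 / R\<^sup>2 * (real CARD('n) * (vol * K))"
        unfolding \<Lambda>_def by (rule low_frequencies[OF d g adj True D KK R])
      also have "(\<Sum>\<mu>\<in>\<Lambda>. (norm (coeff (\<lambda>z. h z * ext u z $ J) \<mu>))\<^sup>2) \<le> real (card \<Lambda>) * (2 * S)"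
        using sum_bounded_above[of \<Lambda> "\<lambda>\<mu>. (norm (coeff (\<lambda>z. h z * ext u z $ J) \<mu>))\<^sup>2" "2 * S"] low by simp
      also have "4 / R\<^sup>2 * (real CARD('n) * (vol * K)) = vol * (e / N)"
        unfolding R2 using N N1 K e by (simp add: field_simps)
      finally have "vol * (LINT z|lebesgue. (norm (h z * ext u z $ J))\<^sup>2) \<le> vol * ((real (card \<Lambda>) * (2 * S)) / vol + e / N)"
        using vol_pos by (simp add: distrib_left)
      then show ?thesis using vol_pos by simp
    qed
    have int: "integrable lebesgue (\<lambda>z. (norm (h z * ext u z $ J))\<^sup>2)" for J
      using admissible_mult(1)[OF form_admissible[OF u] h] unfolding admissible_def sq_int_def by auto
    have "(norm (h z * norm (ext u z)))\<^sup>2 = (\<Sum>J\<in>UNIV. (norm (h z * ext u z $ J))\<^sup>2)" for z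
      by (simp add: norm_mult power_mult_distrib norm_vec_def L2_set_def sum_nonneg sum_distrib_left)
    then have "(LINT z|lebesgue. (norm (h z * norm (ext u z)))\<^sup>2) = (\<Sum>J\<in>UNIV. LINT z|lebesgue. (norm (h z * ext u z $ J))\<^sup>2)"
      using int by (simp add: Bochner_Integration.integral_sum)
    also have "\<dots> \<le> (\<Sum>J\<in>(UNIV :: 'n set set). (real (card \<Lambda>) * (2 * S)) / vol + e / N)"
      by (intro sum_mono comp)
    also have "\<dots> = N * ((real (card \<Lambda>) * (2 * S)) / vol + e / N)" unfolding N_def by (rule sum_constant)
    also have "\<dots> = e + B * S" unfolding B_def using N by (simp add: field_simps)
    finally show ?thesis unfolding S_def .
  qed
  then show thesis using that[OF Y B] by blast
qed

end

section \<open>Gain of integrability\<close>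

locale integrability_gain = form_domain +
  fixes p :: nat and r C :: real
  assumes r: "r > 2" and C: "C > 0"
    and gain: "\<And>u. u \<in> dom_dbar \<Omega> (Suc p) \<inter> dom_dbar_adj \<Omega> p \<Longrightarrow>
      Lr_norm \<Omega> r u \<le> ennreal (C * sqrt ((L2_norm \<Omega> (dbar \<Omega> (Suc p) u))\<^sup>2 + (L2_norm \<Omega> (dbar_adj \<Omega> p u))\<^sup>2))"
begin

text \<open>Representatives of \<open>u\<close>, \<open>D u\<close> and \<open>D* u\<close>: the
  assumed inequality speaks of functions, the abstract theory of classes.\<close>

definition energy_rep :: "'a form \<Rightarrow> 'a form \<Rightarrow> 'a form \<Rightarrow> bool" where
  "energy_rep u f g \<longleftrightarrow> has_dbar \<Omega> (Suc p) u f \<and> g \<in> forms p \<and> (emb u, emb g) \<in> adj_rel p"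

lemma energy_rep_exists:
  assumes "(X, a) \<in> dbar_rel (Suc p)" "(X, b) \<in> adj_rel p"
  obtains u f g where "energy_rep u f g" "emb u = X" "emb f = a" "emb g = b"
proof -
  obtain u where u: "u \<in> forms (Suc p)" "emb u = X" using adjoint_relD(1)[OF assms(2)] by (rule H_cases)
  have "a \<in> H (Suc (Suc p))" using assms(1) dbar_rel_subset by auto
  then obtain f where f: "f \<in> forms (Suc (Suc p))" "emb f = a" by (rule H_cases)
  obtain g where g: "g \<in> forms p" "emb g = b" using adjoint_relD(2)[OF assms(2)] by (rule H_cases)
  show thesis
    by (rule that[of u f g]) (use u f g assms in \<open>auto simp: energy_rep_def has_dbar_iff\<close>)
qed

lemma energy_repD:
  assumes "energy_rep u f g"
  shows "u \<in> forms (Suc p)" "f \<in> forms (Suc (Suc p))" "g \<in> forms p"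
    "(emb u, emb f) \<in> dbar_rel (Suc p)" "(emb u, emb g) \<in> adj_rel p"
  using assms unfolding energy_rep_def has_dbar_iff by auto

lemma power_integrable:
  assumes w: "energy_rep u f g" and n: "norm (emb f, emb g) \<le> 1"
  shows "integrable lebesgue (\<lambda>z. norm (ext u z) powr r)" "(LINT z|lebesgue. norm (ext u z) powr r) \<le> C powr r"
proof -
  note wD = energy_repD[OF w]
  have d: "u \<in> dom_dbar \<Omega> (Suc p)" "emb (dbar \<Omega> (Suc p) u) = emb f" using dom_dbarI[OF wD(1,4)] by auto
  have a: "u \<in> dom_dbar_adj \<Omega> p" "emb (dbar_adj \<Omega> p u) = emb g" using dom_dbar_adjI[OF wD(1,5)] by auto
  have "Lr_norm \<Omega> r u \<le> ennreal (C * norm (emb f, emb g))"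
    using gain[of u] d a L2_norm_emb[OF dbar_rel_dbar(2)[OF d(1)]] L2_norm_emb[OF adj_rel_dbar_adj(2)[OF a(1)]]
    by (simp add: norm_Pair)
  also have "\<dots> \<le> ennreal (C * 1)" using n C by (intro ennreal_leI mult_left_mono) auto
  finally have le: "Lr_norm \<Omega> r u \<le> ennreal C" by simp
  define I where "I = (\<integral>\<^sup>+ z. ennreal (norm (u z) powr r) \<partial>lebesgue_on \<Omega>)"
  have "I = (\<integral>\<^sup>+ z. ennreal (norm (u z) powr r) * indicator \<Omega> z \<partial>lebesgue)"
    unfolding I_def by (rule nn_integral_restrict_space) simp
  also have "(\<lambda>z. ennreal (norm (u z) powr r) * indicator \<Omega> z) = (\<lambda>z. ennreal (norm (ext u z) powr r))"
    by (auto simp: ext_def indicator_def fun_eq_iff)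
  finally have I: "I = (\<integral>\<^sup>+ z. ennreal (norm (ext u z) powr r) \<partial>lebesgue)" .
  \<comment> \<open>An infinite integral would make \<open>Lr_norm\<close> infinite by definition,
    against the finite bound \<open>C\<close>.\<close>
  have Ifin: "I \<noteq> \<infinity>" using le unfolding Lr_norm_def I_def[symmetric] Let_def by (auto simp: top_unique)
  then have "ennreal (enn2real I powr (1 / r)) \<le> ennreal C"
    using le unfolding Lr_norm_def I_def[symmetric] Let_def by simp
  then have "enn2real I powr (1 / r) \<le> C" using C by (simp add: ennreal_le_iff)
  then have "(enn2real I powr (1 / r)) powr r \<le> C powr r" using r by (intro powr_mono2) auto
  then have IC: "enn2real I \<le> C powr r" using r by (simp add: powr_powr)
  have m: "(\<lambda>z. norm (ext u z) powr r) \<in> borel_measurable lebesgue"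
    using sq_int_measurable[OF sq_int_ext[OF wD(1)]] by measurable
  show int: "integrable lebesgue (\<lambda>z. norm (ext u z) powr r)"
    using Ifin m unfolding I by (intro integrableI_bounded) (auto simp: less_top[symmetric])
  have "I = ennreal (LINT z|lebesgue. norm (ext u z) powr r)"
    unfolding I by (intro nn_integral_eq_integral int) auto
  then show "(LINT z|lebesgue. norm (ext u z) powr r) \<le> C powr r"
    using IC by (simp add: enn2real_ennreal)
qed

text \<open>Replaces Hoelder's inequality: \<open>t\<^sup>2 \<le> M\<^sup>2\<close> if \<open>t \<le> M\<close>, and
  \<open>t\<^sup>2 \<le> M powr (2 - r) * t powr r\<close> otherwise.\<close>

lemma weighted_bound:
  assumes w: "energy_rep u f g" and n: "norm (emb f, emb g) \<le> 1"
    and \<theta>: "integrable lebesgue \<theta>" "\<And>z. 0 \<le> \<theta> z" "\<And>z. \<theta> z \<le> 1" and M: "M > 0"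
  shows "(LINT z|lebesgue. \<theta> z * (norm (ext u z))\<^sup>2) \<le> M\<^sup>2 * (LINT z|lebesgue. \<theta> z) + M powr (2 - r) * C powr r"
proof -
  note wD = energy_repD[OF w]
  have le: "\<theta> z * (norm (ext u z))\<^sup>2 \<le> M\<^sup>2 * \<theta> z + M powr (2 - r) * norm (ext u z) powr r" for z
  proof (cases "norm (ext u z) \<le> M")
    case True
    then have "(norm (ext u z))\<^sup>2 \<le> M\<^sup>2" by (intro power_mono) auto
    then have "\<theta> z * (norm (ext u z))\<^sup>2 \<le> \<theta> z * M\<^sup>2" using \<theta>(2) by (intro mult_left_mono)
    moreover have "0 \<le> M powr (2 - r) * norm (ext u z) powr r" by simp
    ultimately show ?thesis unfolding mult.commute[of "M\<^sup>2"] by linarith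
  next
    case False
    then have pos: "norm (ext u z) > 0" using M by linarith
    have "\<theta> z * (norm (ext u z))\<^sup>2 \<le> 1 * (norm (ext u z))\<^sup>2" using \<theta>(3) by (intro mult_right_mono) auto
    also have "\<dots> = norm (ext u z) powr (2 - r) * norm (ext u z) powr r"
      using pos powr_add[of "norm (ext u z)" "2 - r" r] by simp
    also have "\<dots> \<le> M powr (2 - r) * norm (ext u z) powr r"
      using False M r by (intro mult_right_mono powr_mono2') auto
    also have "\<dots> \<le> M\<^sup>2 * \<theta> z + M powr (2 - r) * norm (ext u z) powr r" using \<theta>(2)[of z] by simp
    finally show ?thesis .
  qed
  have int: "integrable lebesgue (\<lambda>z. \<theta> z * (norm (ext u z))\<^sup>2)"
  proof (rule Bochner_Integration.integrable_bound)
    show "integrable lebesgue (\<lambda>z. (norm (ext u z))\<^sup>2)" using sq_int_ext[OF wD(1)] unfolding sq_int_def by simp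
    then show "(\<lambda>z. \<theta> z * (norm (ext u z))\<^sup>2) \<in> borel_measurable lebesgue" using \<theta>(1) by (intro borel_measurable_times) auto
    show "AE z in lebesgue. norm (\<theta> z * (norm (ext u z))\<^sup>2) \<le> norm ((norm (ext u z))\<^sup>2)"
      using \<theta>(2,3) by (intro AE_I2) (simp add: abs_mult mult_left_le_one_le)
  qed
  have "(LINT z|lebesgue. \<theta> z * (norm (ext u z))\<^sup>2)
    \<le> (LINT z|lebesgue. M\<^sup>2 * \<theta> z + M powr (2 - r) * norm (ext u z) powr r)"
    using le int \<theta>(1) power_integrable(1)[OF w n]
    by (intro integral_mono Bochner_Integration.integrable_add integrable_mult_right) auto
  also have "\<dots> = M\<^sup>2 * (LINT z|lebesgue. \<theta> z) + M powr (2 - r) * (LINT z|lebesgue. norm (ext u z) powr r)"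
    using \<theta>(1) power_integrable(1)[OF w n] by simp
  also have "\<dots> \<le> M\<^sup>2 * (LINT z|lebesgue. \<theta> z) + M powr (2 - r) * C powr r"
    using power_integrable(2)[OF w n] by (intro add_left_mono mult_left_mono) auto
  finally show ?thesis .
qed

text \<open>The result of \<open>weighted_bound\<close> for the indicator of \<open>\<Omega>\<close>
  as weight and the level \<open>M = 1\<close>.\<close>

definition c0 :: real where "c0 = sqrt (measure lebesgue \<Omega> + C powr r)"

lemma c0_pos: "c0 > 0"
  unfolding c0_def using C by (simp add: add_nonneg_pos)

lemma norm_emb_sq: "u \<in> forms q \<Longrightarrow> (norm (emb u))\<^sup>2 = (LINT z|lebesgue. (norm (ext u z))\<^sup>2)"
  unfolding emb_def by (rule norm_toL2_sq[OF sq_int_ext])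

lemma basic_estimate_unit:
  assumes w: "energy_rep u f g" and n: "norm (emb f, emb g) \<le> 1"
  shows "norm (emb u) \<le> c0"
proof -
  note wD = energy_repD[OF w]
  have "(norm (emb u))\<^sup>2 = (LINT z|lebesgue. indicator \<Omega> z * (norm (ext u z))\<^sup>2)"
    unfolding norm_emb_sq[OF wD(1)] by (intro Bochner_Integration.integral_cong) (auto simp: ext_def)
  also have "\<dots> \<le> 1\<^sup>2 * (LINT z|lebesgue. indicator \<Omega> z) + 1 powr (2 - r) * C powr r"
    using domain_finite by (intro weighted_bound[OF w n] integrable_real_indicator) (auto simp: indicator_def)
  finally have "(norm (emb u))\<^sup>2 \<le> measure lebesgue \<Omega> + C powr r" by simp
  then show ?thesis unfolding c0_def by (rule real_le_rsqrt)
qed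

lemma subspace_adj_rel: "subspace (adj_rel p)"
  by (intro subspace_adjoint_rel F.subspace_range_L2)

lemma basic_estimate:
  assumes "(X, a) \<in> dbar_rel (Suc p)" "(X, b) \<in> adj_rel p"
  shows "norm X \<le> c0 * norm (a, b)"
proof -
  have *: "norm X \<le> c0 * (norm (a, b) + e)" if e: "e > 0" for e
  proof -
    \<comment> \<open>Normalises the energy even if \<open>norm (a, b) = 0\<close>; afterwards
      \<open>e\<close> is sent to zero.\<close>
    define t where "t = 1 / (norm (a, b) + e)"
    have s: "norm (a, b) + e > 0" using e by (simp add: add_nonneg_pos)
    then have t: "t > 0" unfolding t_def by simp
    have "(t *\<^sub>R X, t *\<^sub>R a) \<in> dbar_rel (Suc p)" "(t *\<^sub>R X, t *\<^sub>R b) \<in> adj_rel p"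
      using subspace_scale[OF subspace_dbar_rel assms(1), of t] subspace_scale[OF subspace_adj_rel assms(2), of t] by auto
    then obtain u f g where w: "energy_rep u f g" "emb u = t *\<^sub>R X" "emb f = t *\<^sub>R a" "emb g = t *\<^sub>R b"
      by (rule energy_rep_exists)
    have "norm (emb f, emb g) = norm (t *\<^sub>R (a, b))" unfolding w by simp
    also have "\<dots> = norm (a, b) / (norm (a, b) + e)" using t s unfolding norm_scaleR by (simp add: t_def)
    also have "\<dots> \<le> 1" using s e by simp
    finally have "norm (t *\<^sub>R X) \<le> c0" using basic_estimate_unit[OF w(1)] w(2) by simp
    then have "t * norm X \<le> c0" using t by simp
    then show ?thesis using s unfolding t_def by (simp add: field_simps)
  qed
  then have "norm X \<le> c0 * norm (a, b) + e" if "e > 0" for e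
  proof -
    have "norm X \<le> c0 * (norm (a, b) + e / c0)" using that c0_pos by (intro *) simp
    then show ?thesis using c0_pos by (simp add: distrib_left)
  qed
  then show ?thesis by (rule field_le_epsilon)
qed

end

text \<open>The Laplacian acts in the middle degree. If \<open>Suc p\<close> is the dimension, the
  last space is zero and the second operator is the zero operator.\<close>

sublocale integrability_gain \<subseteq> hc: hilbert_complex "H p" "H (Suc p)" "H (Suc (Suc p))" "dbar_rel p" "dbar_rel (Suc p)" c0
  by (intro hilbert_complex.intro F.subspace_range_L2 F.closed_range_L2 subspace_dbar_rel closed_dbar_rel
      dbar_rel_subset dbar_dbar_zero less_imp_le[OF c0_pos] basic_estimate)

context integrability_gain
begin

section \<open>The compactness estimate\<close>

lemma domain_in_cube:
  obtains L where "L > 0" "\<Omega> \<subseteq> fourier_cube.cube L"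
proof -
  obtain b where b: "\<And>x. x \<in> \<Omega> \<Longrightarrow> norm x \<le> b" using bounded_domain by (auto simp: bounded_iff)
  define L where "L = \<bar>b\<bar> + 1"
  have L: "L > 0" unfolding L_def by simp
  have "\<Omega> \<subseteq> fourier_cube.cube L"
  proof
    fix x assume x: "x \<in> \<Omega>"
    have "\<bar>x \<bullet> i\<bar> < pi * L" if "i \<in> Basis" for i
    proof -
      have "\<bar>x \<bullet> i\<bar> \<le> norm x" using that by (rule Basis_le_norm)
      also have "\<dots> < 1 * L" using b[OF x] unfolding L_def by simp
      also have "1 * L \<le> pi * L" using pi_gt3 by (intro mult_right_mono) (auto simp: L_def)
      finally show ?thesis .
    qed
    then have "- (pi * L) < x \<bullet> i \<and> x \<bullet> i < pi * L" if "i \<in> Basis" for i using that by (meson abs_less_iff minus_less_iff)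
    then show "x \<in> fourier_cube.cube L" unfolding fourier_cube.mem_cube[OF fourier_cube.intro[OF L]] by simp
  qed
  then show thesis using that[of L] L by blast
qed

text \<open>\<open>|u|^2\<close> is split as \<open>\<eta>^2 |u|^2 + (1 - \<eta>^2) |u|^2\<close>.
  The first part is covered by interior compactness, the second by the gain of integrability; each
  of three errors is at most \<open>e / 3\<close>.\<close>

lemma compactness_estimate:
  assumes e: "e > 0"
  shows "\<exists>Y D. finite Y \<and> D \<ge> 0 \<and> (\<forall>X a b. (X, a) \<in> dbar_rel (Suc p) \<longrightarrow> (X, b) \<in> adj_rel p \<longrightarrow> norm (a, b) \<le> 1 \<longrightarrow>
      norm X ^ 2 \<le> e + D * (\<Sum>y\<in>Y. (X \<bullet> y) ^ 2))"
proof -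
  obtain L where L: "L > 0" "\<Omega> \<subseteq> fourier_cube.cube L" by (rule domain_in_cube)
  obtain \<eta> K where \<eta>: "\<And>m. smooth_alg (\<lambda>x. complex_of_real (\<eta> m x))" "\<And>m x. 0 \<le> \<eta> m x" "\<And>m x. \<eta> m x \<le> 1"
    "\<And>m. compact (K m)" "\<And>m. K m \<subseteq> \<Omega>" "\<And>m x. x \<notin> K m \<Longrightarrow> \<eta> m x = 0"
    "\<And>x. x \<in> \<Omega> \<Longrightarrow> (\<lambda>m. \<eta> m x) \<longlonglongrightarrow> 1"
    using cutoff_exists[OF open_domain] by metis
  have test: "(\<lambda>x. complex_of_real (\<eta> m x)) \<in> test_functions \<Omega>" for m
    by (rule test_functionsI[OF smooth_alg_smooth_on[OF \<eta>(1)] \<eta>(4)[of m] \<eta>(5)]) (simp add: \<eta>(6))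
  \<comment> \<open>Solves \<open>M powr (2 - r) * C powr r = e / 3\<close>; as
    \<open>2 - r < 0\<close>, a small \<open>e\<close> means a high level.\<close>
  define M where "M = (3 * C powr r / e) powr (1 / (r - 2))"
  have Cr: "C powr r > 0" using C by simp
  have M: "M > 0" unfolding M_def using Cr e by simp
  have "M powr (2 - r) = (3 * C powr r / e) powr (-1)"
  proof -
    have "1 / (r - 2) * (2 - r) = - 1" using r by (simp add: field_simps)
    then show ?thesis unfolding M_def powr_powr by (rule arg_cong)
  qed
  also have "\<dots> = e / (3 * C powr r)" using Cr e by (simp add: powr_minus_divide)
  finally have Me: "M powr (2 - r) * C powr r = e / 3" using Cr by simp
  \<comment> \<open>The weight of the boundary layer, complementary to the square of the cutoff
    because the interior part is measured by \<open>|\<eta> u|^2\<close>.\<close>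
  define \<theta> where "\<theta> m = ext (\<lambda>z. 1 - (\<eta> m z)\<^sup>2)" for m
  have \<theta>01: "0 \<le> \<theta> m z" "\<theta> m z \<le> 1" "\<theta> m z \<le> indicator \<Omega> z" for m z
    unfolding \<theta>_def ext_def using \<eta>(2,3)[of m z] by (auto intro: power_le_one)
  have \<eta>m: "\<eta> m \<in> borel_measurable lebesgue" for m
  proof -
    have "(\<lambda>x. Re (complex_of_real (\<eta> m x))) \<in> borel_measurable lebesgue"
      using sq_int_measurable[OF test_functions_sq_int[OF test]] by (rule measurable_compose) (rule borel_measurable_Re)
    then show ?thesis by simp
  qed
  have \<theta>m: "\<theta> m \<in> borel_measurable lebesgue" for m
    unfolding \<theta>_def ext_def[abs_def] using \<eta>m[of m] by (intro measurable_If_set) auto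
  have ind: "integrable lebesgue (\<lambda>z. indicator \<Omega> z :: real)"
    using domain_finite by (intro integrable_real_indicator) auto
  have \<theta>int: "integrable lebesgue (\<theta> m)" for m
    by (rule Bochner_Integration.integrable_bound[OF ind \<theta>m]) (use \<theta>01 in \<open>auto intro!: AE_I2\<close>)
  have "(\<lambda>m. LINT z|lebesgue. \<theta> m z) \<longlonglongrightarrow> (LINT z|(lebesgue :: (complex, 'a) vec measure). 0)"
  proof (rule integral_dominated_convergence[OF _ \<theta>m ind])
    show "AE z in lebesgue. norm (\<theta> m z) \<le> indicator \<Omega> z" for m using \<theta>01 by (intro AE_I2) auto
    show "AE z in lebesgue. (\<lambda>m. \<theta> m z) \<longlonglongrightarrow> 0"
    proof (rule AE_I2)
      fix z
      show "(\<lambda>m. \<theta> m z) \<longlonglongrightarrow> 0"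
      proof (cases "z \<in> \<Omega>")
        case True
        have "(\<lambda>m. 1 - (\<eta> m z)\<^sup>2) \<longlonglongrightarrow> 1 - 1\<^sup>2" by (intro tendsto_intros \<eta>(7)[OF True])
        then show ?thesis using True by (simp add: \<theta>_def ext_def)
      qed (simp add: \<theta>_def ext_def)
    qed
  qed simp
  then have "(\<lambda>m. M\<^sup>2 * (LINT z|lebesgue. \<theta> m z)) \<longlonglongrightarrow> M\<^sup>2 * 0" by (intro tendsto_mult_left) simp
  then have "\<forall>\<^sub>F m in sequentially. M\<^sup>2 * (LINT z|lebesgue. \<theta> m z) < e / 3"
    using e by (intro order_tendstoD) auto
  \<comment> \<open>\<open>M\<close> is fixed first; only then is the cutoff chosen so close to
    \<open>1\<close> that the layer is thin relative to \<open>M^2\<close>.\<close>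
  then obtain m where m: "M\<^sup>2 * (LINT z|lebesgue. \<theta> m z) < e / 3" by (auto simp: eventually_sequentially)
  interpret form_cube \<Omega> L "\<lambda>x. complex_of_real (\<eta> m x)"
  proof (intro form_cube.intro form_domain_axioms fourier_cube.intro form_cube_axioms.intro L test \<eta>(1))
    show "cnj (complex_of_real (\<eta> m z)) = complex_of_real (\<eta> m z)" for z by simp
    show "norm (complex_of_real (\<eta> m z)) \<le> 1" for z using \<eta>(2,3)[of m z] by simp
  qed
  obtain Y B where Y: "finite Y" "B \<ge> 0" and YB:
    "\<forall>u f g. has_dbar \<Omega> (Suc p) u f \<longrightarrow> g \<in> forms p \<longrightarrow> (emb u, emb g) \<in> adj_rel p \<longrightarrow> norm (emb f) \<le> 1 \<longrightarrow> norm (emb g) \<le> 1 \<longrightarrow> norm (emb u) \<le> c0 \<longrightarrow>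
      (LINT z|lebesgue. (norm (complex_of_real (\<eta> m z) * norm (ext u z)))\<^sup>2) \<le> e / 3 + B * (\<Sum>y\<in>Y. (emb u \<bullet> y)\<^sup>2)"
    using interior_compactness[of "e / 3" c0 p] e c0_pos by auto
  have "norm X ^ 2 \<le> e + B * (\<Sum>y\<in>Y. (X \<bullet> y) ^ 2)"
    if Xa: "(X, a) \<in> dbar_rel (Suc p)" and Xb: "(X, b) \<in> adj_rel p" and n: "norm (a, b) \<le> 1" for X a b
  proof -
    obtain u f g where w: "energy_rep u f g" "emb u = X" "emb f = a" "emb g = b"
      using energy_rep_exists[OF Xa Xb] .
    note wD = energy_repD[OF w(1)]
    have n': "norm (emb f, emb g) \<le> 1" using n w by simp
    have ab: "norm (emb f) \<le> 1" "norm (emb g) \<le> 1"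
      using n' norm_fst_le[of "emb f" "emb g"] norm_snd_le[of "emb g" "emb f"]
      by linarith+
    have intu: "integrable lebesgue (\<lambda>z. (norm (ext u z))\<^sup>2)"
      using sq_int_ext[OF wD(1)] unfolding sq_int_def by simp
    have i1: "integrable lebesgue (\<lambda>z. (norm (complex_of_real (\<eta> m z) * norm (ext u z)))\<^sup>2)"
    proof (rule Bochner_Integration.integrable_bound[OF intu])
      have "(\<lambda>z. ext u z) \<in> borel_measurable lebesgue" using sq_int_measurable[OF sq_int_ext[OF wD(1)]] .
      then show "(\<lambda>z. (norm (complex_of_real (\<eta> m z) * norm (ext u z)))\<^sup>2) \<in> borel_measurable lebesgue"
        using \<eta>m[of m] unfolding norm_mult norm_of_real by measurable
      show "AE z in lebesgue. norm ((norm (complex_of_real (\<eta> m z) * norm (ext u z)))\<^sup>2) \<le> norm ((norm (ext u z))\<^sup>2)"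
        using \<eta>(2,3) by (intro AE_I2) (simp add: norm_mult power_mult_distrib mult_left_le_one_le power_le_one)
    qed
    have i2: "integrable lebesgue (\<lambda>z. \<theta> m z * (norm (ext u z))\<^sup>2)"
    proof (rule Bochner_Integration.integrable_bound[OF intu])
      show "(\<lambda>z. \<theta> m z * (norm (ext u z))\<^sup>2) \<in> borel_measurable lebesgue"
        using \<theta>m intu by (intro borel_measurable_times) auto
      show "AE z in lebesgue. norm (\<theta> m z * (norm (ext u z))\<^sup>2) \<le> norm ((norm (ext u z))\<^sup>2)"
        using \<theta>01 by (intro AE_I2) (simp add: abs_mult mult_left_le_one_le)
    qed
    have split: "(norm (ext u z))\<^sup>2 = (norm (complex_of_real (\<eta> m z) * norm (ext u z)))\<^sup>2 + \<theta> m z * (norm (ext u z))\<^sup>2" for z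
      unfolding \<theta>_def ext_def by (simp add: norm_mult power_mult_distrib algebra_simps)
    have "norm X ^ 2 = (LINT z|lebesgue. (norm (ext u z))\<^sup>2)"
      unfolding w(2)[symmetric] by (rule norm_emb_sq[OF wD(1)])
    also have "\<dots> = (LINT z|lebesgue. (norm (complex_of_real (\<eta> m z) * norm (ext u z)))\<^sup>2 + \<theta> m z * (norm (ext u z))\<^sup>2)"
      using split by simp
    also have "\<dots> = (LINT z|lebesgue. (norm (complex_of_real (\<eta> m z) * norm (ext u z)))\<^sup>2) + (LINT z|lebesgue. \<theta> m z * (norm (ext u z))\<^sup>2)"
      by (rule Bochner_Integration.integral_add[OF i1 i2])
    also have "(LINT z|lebesgue. (norm (complex_of_real (\<eta> m z) * norm (ext u z)))\<^sup>2) \<le> e / 3 + B * (\<Sum>y\<in>Y. (emb u \<bullet> y)\<^sup>2)"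
      using w(1) ab basic_estimate_unit[OF w(1) n'] unfolding energy_rep_def by (intro YB[rule_format, of u f g]) auto
    also have "(LINT z|lebesgue. \<theta> m z * (norm (ext u z))\<^sup>2) \<le> M\<^sup>2 * (LINT z|lebesgue. \<theta> m z) + M powr (2 - r) * C powr r"
      by (rule weighted_bound[OF w(1) n' \<theta>int \<theta>01(1,2) M])
    also have "\<dots> \<le> e / 3 + e / 3" unfolding Me using m by simp
    finally show ?thesis unfolding w(2) by simp
  qed
  then show ?thesis using Y by blast
qed

section \<open>The Neumann operator\<close>

text \<open>Passes from chosen representatives to classes. The choices made by \<open>dbar\<close>
  and \<open>dbar_adj\<close> are harmless, since both graphs are single valued.\<close>

lemma laplacian_iff:
  assumes F: "F \<in> forms (Suc p)"
  shows "u \<in> dom_complex_laplacian \<Omega> (Suc p) \<and> ae_eq \<Omega> (complex_laplacian \<Omega> (Suc p) u) F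
    \<longleftrightarrow> u \<in> forms (Suc p) \<and> (\<exists>a b. hc.laplacian_rel (emb u) a b (emb F))"
proof
  assume "u \<in> dom_complex_laplacian \<Omega> (Suc p) \<and> ae_eq \<Omega> (complex_laplacian \<Omega> (Suc p) u) F"
  then have u: "u \<in> dom_dbar \<Omega> (Suc p)" "u \<in> dom_dbar_adj \<Omega> p" "dbar \<Omega> (Suc p) u \<in> dom_dbar_adj \<Omega> (Suc p)"
      "dbar_adj \<Omega> p u \<in> dom_dbar \<Omega> p"
    and ae: "ae_eq \<Omega> (\<lambda>z. dbar \<Omega> p (dbar_adj \<Omega> p u) z + dbar_adj \<Omega> (Suc p) (dbar \<Omega> (Suc p) u) z) F"
    unfolding dom_complex_laplacian_def complex_laplacian_def by auto
  note 1 = dbar_rel_dbar[OF u(1)] and 2 = adj_rel_dbar_adj[OF u(2)] and 3 = adj_rel_dbar_adj[OF u(3)] and 4 = dbar_rel_dbar[OF u(4)]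
  have "emb (dbar \<Omega> p (dbar_adj \<Omega> p u)) + emb (dbar_adj \<Omega> (Suc p) (dbar \<Omega> (Suc p) u)) = emb F"
    unfolding emb_add[OF 4(2) 3(2), symmetric] using ae by (subst emb_eq_iff[OF forms_add[OF 4(2) 3(2)] F])
  then have "hc.laplacian_rel (emb u) (emb (dbar \<Omega> (Suc p) u)) (emb (dbar_adj \<Omega> p u)) (emb F)"
    unfolding hc.laplacian_rel_def using 1(3) 2(3) 3(3) 4(3) by blast
  then show "u \<in> forms (Suc p) \<and> (\<exists>a b. hc.laplacian_rel (emb u) a b (emb F))" using 1(1) by blast
next
  assume "u \<in> forms (Suc p) \<and> (\<exists>a b. hc.laplacian_rel (emb u) a b (emb F))"
  then obtain a b g h where u: "u \<in> forms (Suc p)" "(emb u, a) \<in> dbar_rel (Suc p)" "(emb u, b) \<in> adj_rel p"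
    "(b, g) \<in> dbar_rel p" "(a, h) \<in> adj_rel (Suc p)" "g + h = emb F"
    unfolding hc.laplacian_rel_def by blast
  note 1 = dom_dbarI[OF u(1,2)] and 2 = dom_dbar_adjI[OF u(1,3)]
  have 3: "dbar \<Omega> (Suc p) u \<in> dom_dbar_adj \<Omega> (Suc p)" "emb (dbar_adj \<Omega> (Suc p) (dbar \<Omega> (Suc p) u)) = h"
    using dom_dbar_adjI[OF dbar_rel_dbar(2)[OF 1(1)], of h] u(5) 1(2) by auto
  have 4: "dbar_adj \<Omega> p u \<in> dom_dbar \<Omega> p" "emb (dbar \<Omega> p (dbar_adj \<Omega> p u)) = g"
    using dom_dbarI[OF adj_rel_dbar_adj(2)[OF 2(1)], of g] u(4) 2(2) by auto
  note f = dbar_rel_dbar(2)[OF 4(1)] adj_rel_dbar_adj(2)[OF 3(1)]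
  have "emb (complex_laplacian \<Omega> (Suc p) u) = emb F"
    unfolding complex_laplacian_def diff_Suc_1 emb_add[OF f] 3(2) 4(2) u(6) ..
  moreover have "complex_laplacian \<Omega> (Suc p) u \<in> forms (Suc p)"
    unfolding complex_laplacian_def diff_Suc_1 by (rule forms_add[OF f])
  ultimately have "ae_eq \<Omega> (complex_laplacian \<Omega> (Suc p) u) F" using emb_eq_iff[OF _ F] by blast
  then show "u \<in> dom_complex_laplacian \<Omega> (Suc p) \<and> ae_eq \<Omega> (complex_laplacian \<Omega> (Suc p) u) F"
    unfolding dom_complex_laplacian_def using 1(1) 2(1) 3(1) 4(1) by simp
qed

lemma neumann:
  assumes F: "F \<in> forms (Suc p)"
  shows "dbar_Neumann \<Omega> (Suc p) F \<in> forms (Suc p)"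
    and "\<exists>a b. hc.laplacian_rel (emb (dbar_Neumann \<Omega> (Suc p) F)) a b (emb F)"
proof -
  obtain X a b where X: "hc.laplacian_rel X a b (emb F)" using hc.laplacian_rel_exists[OF emb_in_H[OF F]] .
  then have "X \<in> H (Suc p)" unfolding hc.laplacian_rel_def using dbar_rel_subset by auto
  then obtain u where "u \<in> forms (Suc p)" "emb u = X" by (rule H_cases)
  then have "\<exists>u. u \<in> dom_complex_laplacian \<Omega> (Suc p) \<and> ae_eq \<Omega> (complex_laplacian \<Omega> (Suc p) u) F"
    using X laplacian_iff[OF F] by blast
  then have "dbar_Neumann \<Omega> (Suc p) F \<in> dom_complex_laplacian \<Omega> (Suc p) \<and>
      ae_eq \<Omega> (complex_laplacian \<Omega> (Suc p) (dbar_Neumann \<Omega> (Suc p) F)) F"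
    unfolding dbar_Neumann_def by (rule someI_ex)
  then show "dbar_Neumann \<Omega> (Suc p) F \<in> forms (Suc p)"
    "\<exists>a b. hc.laplacian_rel (emb (dbar_Neumann \<Omega> (Suc p) F)) a b (emb F)"
    unfolding laplacian_iff[OF F] by auto
qed

lemma neumann_unique:
  assumes F: "F \<in> forms (Suc p)" and "hc.laplacian_rel X a b (emb F)"
  shows "emb (dbar_Neumann \<Omega> (Suc p) F) = X"
  using neumann(2)[OF F] assms(2) hc.laplacian_rel_unique by blast

text \<open>The abstract Laplacian is only real linear. Complex multiples are taken on
  representatives, where all four graph conditions are preserved.\<close>

lemma laplacian_rel_smult:
  assumes u: "u \<in> forms (Suc p)" and F: "F \<in> forms (Suc p)" and rel: "hc.laplacian_rel (emb u) a b (emb F)"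
  shows "\<exists>a b. hc.laplacian_rel (emb (\<lambda>z. c *s u z)) a b (emb (\<lambda>z. c *s F z))"
proof -
  obtain g h where *: "(emb u, a) \<in> dbar_rel (Suc p)" "(emb u, b) \<in> adj_rel p"
    "(b, g) \<in> dbar_rel p" "(a, h) \<in> adj_rel (Suc p)" "g + h = emb F"
    using rel unfolding hc.laplacian_rel_def by blast
  obtain a' where a': "a' \<in> forms (Suc (Suc p))" "emb a' = a" using adjoint_relD(1)[OF *(4)] by (rule H_cases)
  obtain b' where b': "b' \<in> forms p" "emb b' = b" using adjoint_relD(2)[OF *(2)] by (rule H_cases)
  have "g \<in> H (Suc p)" using *(3) dbar_rel_subset by auto
  then obtain g' where g': "g' \<in> forms (Suc p)" "emb g' = g" by (rule H_cases)
  obtain h' where h': "h' \<in> forms (Suc p)" "emb h' = h" using adjoint_relD(2)[OF *(4)] by (rule H_cases)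
  have "emb (\<lambda>z. g' z + h' z) = emb F" unfolding emb_add[OF g'(1) h'(1)] g'(2) h'(2) by (rule *(5))
  then have "ae_eq \<Omega> (\<lambda>z. g' z + h' z) F" using emb_eq_iff[OF forms_add[OF g'(1) h'(1)] F] by simp
  then have "ae_eq \<Omega> (\<lambda>z. c *s g' z + c *s h' z) (\<lambda>z. c *s F z)"
    unfolding ae_eq_def by (rule eventually_mono) (metis vector_add_ldistrib)
  then have "emb (\<lambda>z. c *s g' z) + emb (\<lambda>z. c *s h' z) = emb (\<lambda>z. c *s F z)"
    using emb_eq_iff[OF forms_add[OF forms_smult[OF g'(1)] forms_smult[OF h'(1)]] forms_smult[OF F], of c c c]
      emb_add[OF forms_smult[OF g'(1)] forms_smult[OF h'(1)], of c c] by simp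
  moreover have "(emb (\<lambda>z. c *s u z), emb (\<lambda>z. c *s a' z)) \<in> dbar_rel (Suc p)"
    by (rule dbar_rel_smult[OF u a'(1)]) (simp add: a'(2) *(1))
  moreover have "(emb (\<lambda>z. c *s u z), emb (\<lambda>z. c *s b' z)) \<in> adj_rel p"
    by (rule adj_rel_smult[OF u b'(1)]) (simp add: b'(2) *(2))
  moreover have "(emb (\<lambda>z. c *s b' z), emb (\<lambda>z. c *s g' z)) \<in> dbar_rel p"
    by (rule dbar_rel_smult[OF b'(1) g'(1)]) (simp add: b'(2) g'(2) *(3))
  moreover have "(emb (\<lambda>z. c *s a' z), emb (\<lambda>z. c *s h' z)) \<in> adj_rel (Suc p)"
    by (rule adj_rel_smult[OF a'(1) h'(1)]) (simp add: a'(2) h'(2) *(4))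
  ultimately show ?thesis unfolding hc.laplacian_rel_def by blast
qed

lemma neumann_linear: "linear_operator_L2 \<Omega> (Suc p) (dbar_Neumann \<Omega> (Suc p))"
  unfolding linear_operator_L2_def
proof (intro conjI ballI allI impI)
  fix f assume f: "f \<in> forms (Suc p)"
  obtain a b where ab: "hc.laplacian_rel (emb (dbar_Neumann \<Omega> (Suc p) f)) a b (emb f)" using neumann(2)[OF f] by blast
  show "dbar_Neumann \<Omega> (Suc p) f \<in> forms (Suc p)" by (rule neumann(1)[OF f])
  show "ae_eq \<Omega> (dbar_Neumann \<Omega> (Suc p) (\<lambda>z. c *s f z)) (\<lambda>z. c *s dbar_Neumann \<Omega> (Suc p) f z)" for c
  proof -
    have "emb (dbar_Neumann \<Omega> (Suc p) (\<lambda>z. c *s f z)) = emb (\<lambda>z. c *s dbar_Neumann \<Omega> (Suc p) f z)"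
      using laplacian_rel_smult[OF neumann(1)[OF f] f ab, of c] neumann_unique[OF forms_smult[OF f]] by blast
    then show ?thesis using emb_eq_iff[OF neumann(1)[OF forms_smult[OF f]] forms_smult[OF neumann(1)[OF f]]] by blast
  qed
  fix g assume g: "g \<in> forms (Suc p)"
  obtain a' b' where ab': "hc.laplacian_rel (emb (dbar_Neumann \<Omega> (Suc p) g)) a' b' (emb g)" using neumann(2)[OF g] by blast
  show "ae_eq \<Omega> (dbar_Neumann \<Omega> (Suc p) f) (dbar_Neumann \<Omega> (Suc p) g)" if "ae_eq \<Omega> f g"
  proof -
    have "emb f = emb g" using emb_eq_iff[OF f g] that by blast
    then have "emb (dbar_Neumann \<Omega> (Suc p) f) = emb (dbar_Neumann \<Omega> (Suc p) g)"
      using neumann_unique[OF f] ab' by simp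
    then show ?thesis using emb_eq_iff[OF neumann(1)[OF f] neumann(1)[OF g]] by blast
  qed
  show "ae_eq \<Omega> (dbar_Neumann \<Omega> (Suc p) (\<lambda>z. f z + g z)) (\<lambda>z. dbar_Neumann \<Omega> (Suc p) f z + dbar_Neumann \<Omega> (Suc p) g z)"
  proof -
    have "emb (dbar_Neumann \<Omega> (Suc p) (\<lambda>z. f z + g z)) = emb (\<lambda>z. dbar_Neumann \<Omega> (Suc p) f z + dbar_Neumann \<Omega> (Suc p) g z)"
      using hc.laplacian_rel_add[OF ab ab'] neumann_unique[OF forms_add[OF f g]]
      unfolding emb_add[OF f g] emb_add[OF neumann(1)[OF f] neumann(1)[OF g]] by blast
    then show ?thesis
      using emb_eq_iff[OF neumann(1)[OF forms_add[OF f g]] forms_add[OF neumann(1)[OF f] neumann(1)[OF g]]] by blast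
  qed
qed

theorem neumann_compact: "compact_operator_L2 \<Omega> (Suc p) (dbar_Neumann \<Omega> (Suc p))"
  unfolding compact_operator_L2_def
proof (intro conjI neumann_linear allI impI)
  fix F :: "nat \<Rightarrow> 'a form"
  assume "(\<forall>k. F k \<in> forms (Suc p)) \<and> (\<exists>B. \<forall>k. L2_norm \<Omega> (F k) \<le> B)"
  then obtain B where F: "\<And>k. F k \<in> forms (Suc p)" and B: "\<And>k. L2_norm \<Omega> (F k) \<le> B" by blast
  define U where "U k = dbar_Neumann \<Omega> (Suc p) (F k)" for k
  have U: "U k \<in> forms (Suc p)" for k unfolding U_def by (rule neumann(1)[OF F])
  have "\<forall>k. \<exists>a b. hc.laplacian_rel (emb (U k)) a b (emb (F k))" unfolding U_def using neumann(2)[OF F] by blast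
  then obtain a b where ab: "\<And>k. hc.laplacian_rel (emb (U k)) (a k) (b k) (emb (F k))" by metis
  have bd: "norm (emb (F k)) \<le> B" for k using B[of k] unfolding L2_norm_emb[OF F] .
  obtain l \<sigma> where l: "strict_mono \<sigma>" "((\<lambda>k. emb (U k)) \<circ> \<sigma>) \<longlonglongrightarrow> l"
    by (rule hc.compactness[OF compactness_estimate ab bd])
  have "l \<in> H (Suc p)"
    by (rule closed_sequentially[OF F.closed_range_L2 _ l(2)]) (simp add: emb_in_H[OF U])
  then obtain g where g: "g \<in> forms (Suc p)" "emb g = l" by (rule H_cases)
  have "L2_norm \<Omega> (\<lambda>z. U (\<sigma> k) z - g z) = norm (emb (U (\<sigma> k)) - l)" for k
    unfolding L2_norm_emb[OF forms_diff[OF U g(1)]] emb_diff[OF U g(1)] g(2) ..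
  moreover have "(\<lambda>k. norm (emb (U (\<sigma> k)) - l)) \<longlonglongrightarrow> 0"
    using tendsto_norm_zero[OF LIM_zero[OF l(2)]] by (simp add: o_def)
  ultimately have "(\<lambda>k. L2_norm \<Omega> (\<lambda>z. U (\<sigma> k) z - g z)) \<longlonglongrightarrow> 0" by simp
  then show "\<exists>g\<in>forms (Suc p). \<exists>\<sigma>. strict_mono \<sigma> \<and>
      (\<lambda>k. L2_norm \<Omega> (\<lambda>z. dbar_Neumann \<Omega> (Suc p) (F (\<sigma> k)) z - g z)) \<longlonglongrightarrow> 0"
    unfolding U_def using g(1) l(1) by blast
qed

end

theorem theorem2p2:
  fixes \<Omega> :: "(complex^'n::{finite,linorder}) set"
    and q :: nat and r C :: real
  assumes "smoothly_bounded_domain \<Omega>"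
    and "pseudoconvex \<Omega>"
    and "1 \<le> q" and "q \<le> CARD('n)"
    and "r > 2" and "C > 0"
    and "\<And>u. u \<in> dom_dbar \<Omega> q \<inter> dom_dbar_adj \<Omega> (q - 1) \<Longrightarrow>
           Lr_norm \<Omega> r u \<le>
             ennreal (C * sqrt ((L2_norm \<Omega> (dbar \<Omega> q u))\<^sup>2 + (L2_norm \<Omega> (dbar_adj \<Omega> (q - 1) u))\<^sup>2))"
  shows "compact_operator_L2 \<Omega> q (dbar_Neumann \<Omega> q)"
proof -
  \<comment> \<open>\<open>dbar_adj \<Omega> p\<close> acts on forms of degree
    \<open>Suc p = q\<close>, so writing \<open>q\<close> as a successor replaces
    \<open>q - 1\<close> by \<open>p\<close>.\<close>
  obtain p where q: "q = Suc p" using assms(3) by (cases q) auto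
  interpret integrability_gain \<Omega> p r C
    by unfold_locales (use assms in \<open>auto simp: smoothly_bounded_domain_def q\<close>)
  show ?thesis unfolding q by (rule neumann_compact)
qed

end
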